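(* Let $\mathcal{D}$ be a domain and let $G<\mathrm{IET}(\mathcal{D})$ be a finitely generated, torsion-free, solvable group. Then $G$ is virtually abelian.
   Context: A domain is a non-empty disjoint union of finitely many oriented circles and oriented half-open bounded intervals closed on the left (of the form $[a,b)$). For a domain $\mathcal{D}$, $\mathrm{IET}(\mathcal{D})$ is the group of bijections of $\mathcal{D}$ that are orientation-preserving piecewise isometries, left-continuous, with finitely many discontinuity points. *)

theory Defs
  imports "HOL-Analysis.Analysis" "HOL-Algebra.Algebra"
begin

text \<open>A domain is encoded (up to orientation-preserving isometry) by a number n of
components, lengths L i > 0 and a flag circ i telling whether component i is an
oriented circle R/(L i)Z (parametrised by [0, L i)) or a half-open interval [0, L i).
Points are pairs (i, x).\<close>

definition domain_ok :: "nat \<Rightarrow> (nat \<Rightarrow> real) \<Rightarrow> bool" where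
  "domain_ok n L \<longleftrightarrow> n \<ge> 1 \<and> (\<forall>i<n. L i > 0)"

definition dom_pts :: "nat \<Rightarrow> (nat \<Rightarrow> real) \<Rightarrow> (nat \<times> real) set" where
  "dom_pts n L = {(i, x). i < n \<and> 0 \<le> x \<and> x < L i}"

definition shift :: "(nat \<Rightarrow> real) \<Rightarrow> (nat \<Rightarrow> bool) \<Rightarrow> nat \<times> real \<Rightarrow> real \<Rightarrow> nat \<times> real" where
  "shift L circ p t = (fst p,
     if circ (fst p) then (snd p + t) - L (fst p) * of_int \<lfloor>(snd p + t) / L (fst p)\<rfloor>
     else snd p + t)"

text \<open>Orientation-preserving piecewise isometric bijection, left-continuous, with
finitely many discontinuity points: at every point it is locally a translation on the
left (left-continuity + local isometry), and outside a finite set S also on the right.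
Outside the domain the map is the identity (so that functions are canonical).\<close>
definition is_IET :: "nat \<Rightarrow> (nat \<Rightarrow> real) \<Rightarrow> (nat \<Rightarrow> bool) \<Rightarrow> (nat \<times> real \<Rightarrow> nat \<times> real) \<Rightarrow> bool" where
  "is_IET n L circ f \<longleftrightarrow>
     bij_betw f (dom_pts n L) (dom_pts n L) \<and>
     (\<forall>p. p \<notin> dom_pts n L \<longrightarrow> f p = p) \<and>
     (\<exists>S. finite S \<and>
        (\<forall>p\<in>dom_pts n L. \<exists>e>0. \<forall>t. 0 \<le> t \<and> t < e \<and> shift L circ p (-t) \<in> dom_pts n L
             \<longrightarrow> f (shift L circ p (-t)) = shift L circ (f p) (-t)) \<and>
        (\<forall>p\<in>dom_pts n L - S. \<exists>e>0. \<forall>t. 0 \<le> t \<and> t < e \<and> shift L circ p t \<in> dom_pts n L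
             \<longrightarrow> f (shift L circ p t) = shift L circ (f p) t))"

definition IET_group :: "nat \<Rightarrow> (nat \<Rightarrow> real) \<Rightarrow> (nat \<Rightarrow> bool) \<Rightarrow> (nat \<times> real \<Rightarrow> nat \<times> real) monoid" where
  "IET_group n L circ = \<lparr> carrier = {f. is_IET n L circ f}, mult = (\<lambda>f g. f \<circ> g), one = id \<rparr>"

definition finitely_generated_group :: "('a, 'b) monoid_scheme \<Rightarrow> bool" where
  "finitely_generated_group G \<longleftrightarrow> (\<exists>S. finite S \<and> S \<subseteq> carrier G \<and> generate G S = carrier G)"

definition torsion_free_group :: "('a, 'b) monoid_scheme \<Rightarrow> bool" where
  "torsion_free_group G \<longleftrightarrow>
     (\<forall>g\<in>carrier G. \<forall>k::nat. k > 0 \<and> g [^]\<^bsub>G\<^esub> k = \<one>\<^bsub>G\<^esub> \<longrightarrow> g = \<one>\<^bsub>G\<^esub>)"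

definition virtually_abelian :: "('a, 'b) monoid_scheme \<Rightarrow> bool" where
  "virtually_abelian G \<longleftrightarrow>
     (\<exists>K. subgroup K G \<and> finite (rcosets\<^bsub>G\<^esub> K) \<and>
          (\<forall>x\<in>K. \<forall>y\<in>K. x \<otimes>\<^bsub>G\<^esub> y = y \<otimes>\<^bsub>G\<^esub> x))"

end

theory Submission
  imports Defs
begin

text \<open>
  Gluing the components end to end turns the group into a group G of bijections of the line that are
  left-continuous piecewise translations; this loses only finitely supported permutations, hence
  nothing in a torsion-free group. Let A be the last nontrivial term of the derived series. For z in
  A, the set of points with infinite z-orbit contains only finitely many z-invariant finite unions of
  intervals, because their end points lie on orbit segments between two discontinuities of z. So the
  infinite orbits of A split into atoms (minimal A-invariant unions of intervals). G permutes the
  atoms preserving measure, and every atom is a translate of one containing a discontinuity of a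
  generator, so there are finitely many atoms and a subgroup of finite index fixes each of them.

  On an atom W there are two cases. If some z in A has a left germ and a right germ that travel
  together in the far past but not in the far future, then such pairs of orbits are finite in number
  and permuted by everything commuting with z, so A acts on W as a virtually cyclic group; since
  conjugation preserves the linear growth rate of the number of discontinuities of the iterates, it
  inverts or fixes z up to powers. Otherwise the iterates of z have boundedly many discontinuities
  on W, and if z is a commutator its mean displacement, measured by any additive functional of the
  reals, vanishes; this forces bounded displacements and finite orbits. Both cases together show that
  the centralizer of A has finite index. In it, the term of the derived series before A is nilpotent
  of class two, and the same dichotomy makes it abelian. Induction on the derived length concludes.
\<close>

text \<open>Triviality of an element of A is always proved in the same way: one point with finite
  orbit in each atom is enough, because the infinite orbits of the element form a union of atoms.
  With none left, a uniform power is the identity, and torsion-freeness finishes. So the two cases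
  may be mixed freely from atom to atom. Displacements of iterates are trivially bounded as real
  numbers. The additive functionals are there to bound them in rational coordinates, where
  boundedness means finiteness; they must be defined on all reals, since the flux of a commutator is
  computed from the displacements of its factors. The main obstacle is that A need not be finitely
  generated. Finiteness comes instead from a single z having few invariant sets inside its infinite
  orbits, and from the discontinuities of G lying in finitely many G-orbits. Growth rates of
  discontinuity counts are needed because commuting with z only shows that a power of a conjugate of
  z is some power of z; conjugation invariance of the growth forces the two exponents to agree up to
  sign.\<close>

section \<open>Left-continuous step functions\<close>

text \<open>\<open>S\<close> only has to contain the jumps, so sums and compositions may simply
  enlarge it.\<close>

definition lstep :: "(real \<Rightarrow> 'a) \<Rightarrow> real set \<Rightarrow> bool" where
  "lstep f S \<longleftrightarrow> (\<forall>x. \<forall>\<^sub>F y in at_left x. f y = f x) \<and>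
    (\<forall>x. x \<notin> S \<longrightarrow> (\<forall>\<^sub>F y in at_right x. f y = f x))"

lemma lstep_left: "lstep f S \<Longrightarrow> \<forall>\<^sub>F y in at_left x. f y = f x"
  and lstep_right: "lstep f S \<Longrightarrow> x \<notin> S \<Longrightarrow> \<forall>\<^sub>F y in at_right x. f y = f x"
  by (auto simp: lstep_def)

lemma lstep_map2:
  assumes "lstep f S" "lstep g S'"
  shows "lstep (\<lambda>x. h (f x) (g x)) (S \<union> S')"
  unfolding lstep_def
proof (intro conjI allI impI)
  fix x
  show "\<forall>\<^sub>F y in at_left x. h (f y) (g y) = h (f x) (g x)"
    using lstep_left[OF assms(1), of x] lstep_left[OF assms(2), of x] by eventually_elim simp
  assume "x \<notin> S \<union> S'"
  then show "\<forall>\<^sub>F y in at_right x. h (f y) (g y) = h (f x) (g x)"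
    using lstep_right[OF assms(1), of x] lstep_right[OF assms(2), of x]
    by (auto elim: eventually_elim2)
qed

lemma lstep_map: "lstep f S \<Longrightarrow> lstep (\<lambda>x. h (f x)) S"
  using lstep_map2[of f S f S "\<lambda>a b. h a"] by simp

text \<open>Left-constancy holds at every point, so a jump at \<open>b\<close> is felt only to the
  right of \<open>b\<close>. Hence f is locally constant on the connected interval from a to b, both
  ends included.\<close>

lemma lstep_const:
  assumes "lstep f S" "a \<le> b" "S \<inter> {a..<b} = {}"
  shows "f a = f b"
proof (cases "a < b")
  case True
  have "\<forall>\<^sub>F y in at x within {a..b}. f x = f y" if x: "x \<in> {a..b}" for x
  proof (cases "x = b")
    case True
    then show ?thesis
      using lstep_left[OF assms(1), of b] \<open>a < b\<close>
      by (auto simp: at_within_Icc_at_left eq_commute)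
  next
    case False
    then have "x \<notin> S" using x assms(3) by auto
    then have "\<forall>\<^sub>F y in at x. f y = f x"
      using lstep_left[OF assms(1), of x] lstep_right[OF assms(1), of x]
      by (simp add: eventually_at_split)
    then have "\<forall>\<^sub>F y in at x within {a..b}. f y = f x"
      by (rule filter_leD[OF at_le, rotated]) simp
    then show ?thesis by (simp add: eq_commute)
  qed
  then show ?thesis
    using connected_local_const[of "{a..b}" a b f] True by auto
qed (use assms in auto)

lemma finite_avoids_at_right:
  assumes "finite S"
  shows "\<forall>\<^sub>F y in at_right x. y \<notin> (S::real set)"
proof -
  have "\<forall>\<^sub>F y in at_right x. \<forall>s\<in>S. y \<noteq> s"
    using assms by (intro eventually_ball_finite ballI eventually_neq_at_within) auto
  then show ?thesis by eventually_elim auto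
qed

lemma finite_avoids_at_left:
  assumes "finite S"
  shows "\<forall>\<^sub>F y in at_left x. y \<notin> (S::real set)"
proof -
  have "\<forall>\<^sub>F y in at_left x. \<forall>s\<in>S. y \<noteq> s"
    using assms by (intro eventually_ball_finite ballI eventually_neq_at_within) auto
  then show ?thesis by eventually_elim auto
qed

lemma lstep_right_limit:
  assumes "lstep f S" "finite S"
  shows "\<exists>v. \<forall>\<^sub>F y in at_right x. f y = v"
proof -
  obtain b where b: "b > x" "\<And>y. x < y \<Longrightarrow> y < b \<Longrightarrow> y \<notin> S"
    using finite_avoids_at_right[OF assms(2), of x] by (auto simp: eventually_at_right_field)
  let ?c = "(x + b) / 2"
  have "f y = f ?c" if y: "x < y" "y < b" for y
  proof (cases "y \<le> ?c")
    case True
    show ?thesis by (rule lstep_const[OF assms(1) True]) (use y b in auto)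
  next
    case False
    have "f ?c = f y" by (rule lstep_const[OF assms(1)]) (use y b False in auto)
    then show ?thesis by simp
  qed
  then show ?thesis using b(1) by (auto simp: eventually_at_right_field)
qed

text \<open>The pieces of a left-continuous step function are closed on the right, so each is
  represented by its right end point. The last, unbounded piece is represented by a point beyond all
  of \<open>P\<close>; inserting 0 keeps \<open>Max\<close> defined for empty
  \<open>P\<close>.\<close>

definition rep :: "real set \<Rightarrow> real \<Rightarrow> real" where
  "rep P x = (if P \<inter> {x..} = {} then Max (insert 0 P) + 1 else Min (P \<inter> {x..}))"

lemma lstep_rep:
  assumes "finite P" "lstep f P"
  shows "f x = f (rep P x)"
proof (cases "P \<inter> {x..} = {}")
  case True
  have *: "p < x" "p < rep P x" if "p \<in> P" for p
  proof -
    show "p < x" using that True by force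
    have "p \<le> Max (insert 0 P)" using that assms(1) by auto
    then show "p < rep P x" using True by (simp add: rep_def)
  qed
  show ?thesis
  proof (cases "x \<le> rep P x")
    case True
    show ?thesis by (rule lstep_const[OF assms(2) True]) (use * in force)
  next
    case False
    then have "rep P x \<le> x" by simp
    from lstep_const[OF assms(2) this] have "f (rep P x) = f x" using * by force
    then show ?thesis ..
  qed
next
  case False
  then have m: "rep P x \<in> P \<inter> {x..}" "\<And>p. p \<in> P \<inter> {x..} \<Longrightarrow> rep P x \<le> p"
    using assms(1) Min_in[of "P \<inter> {x..}"] by (auto simp: rep_def)
  have "x \<le> rep P x" using m(1) by simp
  from lstep_const[OF assms(2) this] show ?thesis using m(2) by force
qed

lemma rep_range: "finite P \<Longrightarrow> rep P x \<in> insert (Max (insert 0 P) + 1) P"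
  using Min_in[of "P \<inter> {x..}"] by (auto simp: rep_def)

lemma lstep_range:
  assumes "finite P" "lstep f P"
  shows "finite (range f)" "card (range f) \<le> card P + 1"
proof -
  let ?Q = "insert (Max (insert 0 P) + 1) P"
  have sub: "range f \<subseteq> f ` ?Q"
    using lstep_rep[OF assms] rep_range[OF assms(1)] by blast
  have fin: "finite (f ` ?Q)" using assms(1) by simp
  show "finite (range f)" using sub fin by (rule finite_subset)
  have "card (range f) \<le> card (f ` ?Q)" by (rule card_mono[OF fin sub])
  also have "\<dots> \<le> card ?Q" using assms(1) by (intro card_image_le) simp
  also have "\<dots> \<le> card P + 1" using assms(1) by (simp add: card_insert_if)
  finally show "card (range f) \<le> card P + 1" .
qed

text \<open>Each such set is determined by its trace on the representatives \<open>rep P x\<close>.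
  The finiteness of the families of fixed point sets and of invariant sets is later reduced to a
  common jump set.\<close>

lemma finite_lstep_sets:
  assumes "finite P"
  shows "finite {V. lstep (\<lambda>x. x \<in> V) P}"
proof (rule finite_subset)
  let ?Q = "insert (Max (insert 0 P) + 1) P"
  show "{V. lstep (\<lambda>x. x \<in> V) P} \<subseteq> (\<lambda>U. {x. rep P x \<in> U}) ` Pow ?Q"
  proof
    fix V assume "V \<in> {V. lstep (\<lambda>x. x \<in> V) P}"
    then have V: "lstep (\<lambda>x. x \<in> V) P" by simp
    have "V = {x. rep P x \<in> V \<inter> ?Q}"
      using lstep_rep[OF assms V] rep_range[OF assms] by auto
    then show "V \<in> (\<lambda>U. {x. rep P x \<in> U}) ` Pow ?Q" by blast
  qed
  show "finite ((\<lambda>U. {x. rep P x \<in> U}) ` Pow ?Q)" using assms by simp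
qed

lemma lstep_borel_measurable:
  fixes f :: "real \<Rightarrow> real"
  assumes "lstep f S" "finite S"
  shows "f \<in> borel_measurable borel"
proof (rule borel_measurable_continuous_countable_exceptions)
  show "countable S" using assms(2) by (simp add: countable_finite)
  have "isCont f x" if "x \<notin> S" for x
  proof -
    have "\<forall>\<^sub>F y in at x. f y = f x"
      using lstep_left[OF assms(1), of x] lstep_right[OF assms(1) that]
      by (simp add: eventually_at_split)
    then show ?thesis unfolding isCont_def by (rule tendsto_eventually)
  qed
  then show "continuous_on (- S) f"
    by (intro continuous_at_imp_continuous_on) auto
qed

section \<open>Finite unions of intervals open on the left and closed on the right\<close>

definition elem :: "real set \<Rightarrow> bool" where
  "elem V \<longleftrightarrow> (\<exists>S. finite S \<and> lstep (\<lambda>x. x \<in> V) S)"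

text \<open>For an \<open>elem\<close> set this is the least jump set of the indicator: by
  left-constancy only the right side can fail.\<close>

definition bdry :: "real set \<Rightarrow> real set" where
  "bdry V = {x. \<not> (\<forall>\<^sub>F y in at_right x. y \<in> V \<longleftrightarrow> x \<in> V)}"

lemma lstep_imp_elem: "finite S \<Longrightarrow> lstep (\<lambda>x. x \<in> V) S \<Longrightarrow> elem V"
  by (auto simp: elem_def)

lemma elem_bdry:
  assumes "elem V" shows "finite (bdry V)" "lstep (\<lambda>x. x \<in> V) (bdry V)"
proof -
  obtain S where S: "finite S" "lstep (\<lambda>x. x \<in> V) S" using assms by (auto simp: elem_def)
  then have "bdry V \<subseteq> S" by (auto simp: bdry_def lstep_def)
  with S show "finite (bdry V)" by (auto intro: finite_subset)
  show "lstep (\<lambda>x. x \<in> V) (bdry V)" using S(2) by (auto simp: bdry_def lstep_def)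
qed

lemma elem_left: "elem V \<Longrightarrow> \<forall>\<^sub>F y in at_left x. y \<in> V \<longleftrightarrow> x \<in> V"
  using elem_bdry(2) lstep_left by fastforce

lemma elem_right: "elem V \<Longrightarrow> (\<forall>\<^sub>F y in at_right x. y \<in> V) \<or> (\<forall>\<^sub>F y in at_right x. y \<notin> V)"
proof -
  assume "elem V"
  then obtain S where "finite S" "lstep (\<lambda>x. x \<in> V) S" by (auto simp: elem_def)
  from lstep_right_limit[OF this(2,1), of x] obtain v where "\<forall>\<^sub>F y in at_right x. (y \<in> V) = v" ..
  then show ?thesis by (cases v) auto
qed

lemma elem_map2:
  assumes "elem V" "elem W" shows "elem {x. h (x \<in> V) (x \<in> W)}"
proof -
  obtain S S' where "finite S" "lstep (\<lambda>x. x \<in> V) S" "finite S'" "lstep (\<lambda>x. x \<in> W) S'"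
    using assms by (auto simp: elem_def)
  then show ?thesis
    using lstep_map2[of "\<lambda>x. x \<in> V" S "\<lambda>x. x \<in> W" S' h]
    by (intro lstep_imp_elem[of "S \<union> S'"]) simp_all
qed

lemma elem_Int: "elem V \<Longrightarrow> elem W \<Longrightarrow> elem (V \<inter> W)"
  using elem_map2[of V W "\<lambda>a b. a \<and> b"] by (simp add: Int_def)

lemma elem_Diff: "elem V \<Longrightarrow> elem W \<Longrightarrow> elem (V - W)"
  using elem_map2[of V W "\<lambda>a b. a \<and> \<not> b"] by (simp add: set_diff_eq)

lemma elem_Compl: "elem V \<Longrightarrow> elem (- V)"
  using elem_map2[of V V "\<lambda>a b. \<not> a"] by (simp add: Compl_eq)

lemma elem_UNIV: "elem UNIV"
  by (auto simp: elem_def lstep_def)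

lemma elem_INT:
  assumes "finite F" "\<And>V. V \<in> F \<Longrightarrow> elem V" shows "elem (\<Inter>F)"
  using assms by (induction F) (auto intro: elem_Int elem_UNIV)

lemma elem_level:
  assumes "lstep f S" "finite S" shows "elem {x. P (f x)}"
  using lstep_map[OF assms(1), of P] assms(2) by (auto simp: elem_def)

lemma elem_borel:
  assumes "elem V" shows "V \<in> sets borel"
proof -
  obtain S where S: "finite S" "lstep (\<lambda>x. x \<in> V) S" using assms by (auto simp: elem_def)
  have "(\<lambda>x. if x \<in> V then 1 else 0::real) \<in> borel_measurable borel"
    by (rule lstep_borel_measurable[OF lstep_map[OF S(2)] S(1)])
  then have "(indicator V :: real \<Rightarrow> real) \<in> borel_measurable borel"
    by (simp add: indicator_def[abs_def] of_bool_def)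
  then show ?thesis by (simp add: borel_measurable_indicator_iff)
qed

section \<open>Left-continuous piecewise translations\<close>

text \<open>A map l acts on left germs of points; rgt l is the induced action on right germs.\<close>

definition pt :: "(real \<Rightarrow> real) \<Rightarrow> bool" where
  "pt l \<longleftrightarrow> bij l \<and> (\<exists>S. finite S \<and> lstep (\<lambda>x. l x - x) S)"

definition rgt :: "(real \<Rightarrow> real) \<Rightarrow> real \<Rightarrow> real" where
  "rgt l x = x + (THE v. \<forall>\<^sub>F y in at_right x. l y - y = v)"

definition disc :: "(real \<Rightarrow> real) \<Rightarrow> real set" where
  "disc l = {x. rgt l x \<noteq> l x}"

lemma pt_bij: "pt l \<Longrightarrow> bij l" by (simp add: pt_def)

lemma pt_left: "pt l \<Longrightarrow> \<forall>\<^sub>F y in at_left x. l y = y + (l x - x)"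
  unfolding pt_def by (auto dest!: lstep_left[of _ _ x] elim!: eventually_mono)

lemma rgt_eqI:
  assumes "\<forall>\<^sub>F y in at_right x. l y = y + (v - x)" shows "rgt l x = v"
proof -
  have *: "\<forall>\<^sub>F y in at_right x. l y - y = v - x"
    using assms by eventually_elim simp
  have "(THE w. \<forall>\<^sub>F y in at_right x. l y - y = w) = v - x"
  proof (rule the_equality)
    show "\<forall>\<^sub>F y in at_right x. l y - y = v - x" by (rule *)
    fix w assume "\<forall>\<^sub>F y in at_right x. l y - y = w"
    with * have "\<forall>\<^sub>F y in at_right x. w = v - x" by eventually_elim simp
    then show "w = v - x" by simp
  qed
  then show ?thesis by (simp add: rgt_def)
qed

lemma pt_right: assumes "pt l" shows "\<forall>\<^sub>F y in at_right x. l y = y + (rgt l x - x)"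
proof -
  obtain S where "finite S" "lstep (\<lambda>x. l x - x) S" using assms by (auto simp: pt_def)
  from lstep_right_limit[OF this(2,1), of x] obtain v where v: "\<forall>\<^sub>F y in at_right x. l y - y = v" ..
  then have e: "\<forall>\<^sub>F y in at_right x. l y = y + ((x + v) - x)" by eventually_elim simp
  show ?thesis using e rgt_eqI[OF e] by simp
qed

lemma pt_disc:
  assumes "pt l" shows "finite (disc l)" "lstep (\<lambda>x. l x - x) (disc l)"
proof -
  obtain S where S: "finite S" "lstep (\<lambda>x. l x - x) S" using assms by (auto simp: pt_def)
  have "x \<in> S" if "x \<in> disc l" for x
  proof (rule ccontr)
    assume "x \<notin> S"
    then have "\<forall>\<^sub>F y in at_right x. l y = y + (l x - x)"
      using lstep_right[OF S(2), of x] by (auto elim: eventually_mono)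
    from rgt_eqI[OF this] that show False by (simp add: disc_def)
  qed
  then show "finite (disc l)" using S(1) by (meson finite_subset subsetI)
  show "lstep (\<lambda>x. l x - x) (disc l)"
    unfolding lstep_def
  proof safe
    fix x assume "x \<notin> disc l"
    then have "rgt l x = l x" by (simp add: disc_def)
    then show "\<forall>\<^sub>F y in at_right x. l y - y = l x - x"
      using pt_right[OF assms, of x] by (auto elim: eventually_mono)
  qed (use S(2) lstep_left in fastforce)
qed

lemma ptI:
  assumes "bij l" "finite S" "lstep (\<lambda>x. l x - x) S" shows "pt l"
  using assms by (auto simp: pt_def)

lemma eventually_translate_left:
  "\<forall>\<^sub>F y in at_left (x + c). P y \<Longrightarrow> \<forall>\<^sub>F y in at_left x. P (y + c :: real)"
  unfolding eventually_at_left_field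
  by (metis add_less_cancel_right diff_add_cancel less_diff_eq)

lemma eventually_translate_right:
  "\<forall>\<^sub>F y in at_right (x + c). P y \<Longrightarrow> \<forall>\<^sub>F y in at_right x. P (y + c :: real)"
  unfolding eventually_at_right_field
  by (metis add_less_cancel_right diff_add_cancel less_diff_eq diff_less_eq)

lemma pt_pull_left:
  assumes "pt l" "\<forall>\<^sub>F y in at_left (l x). P y" shows "\<forall>\<^sub>F y in at_left x. P (l y)"
  using pt_left[OF assms(1), of x] eventually_translate_left[where x=x and c="l x - x" and P=P] assms(2)
  by (auto elim: eventually_elim2)

lemma pt_pull_right:
  assumes "pt l" "\<forall>\<^sub>F y in at_right (rgt l x). P y" shows "\<forall>\<^sub>F y in at_right x. P (l y)"
  using pt_right[OF assms(1), of x] eventually_translate_right[where x=x and c="rgt l x - x" and P=P] assms(2)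
  by (auto elim: eventually_elim2)

lemma pt_push_right:
  assumes "pt l" "\<forall>\<^sub>F y in at_right x. P (l y)" shows "\<forall>\<^sub>F y in at_right (rgt l x). P y"
proof -
  have "\<forall>\<^sub>F y in at_right x. P (y + (rgt l x - x))"
    using pt_right[OF assms(1), of x] assms(2) by eventually_elim simp
  then show ?thesis
    using eventually_translate_right[where x="rgt l x" and c="x - rgt l x" and P="\<lambda>y. P (y + (rgt l x - x))"] by simp
qed

lemma lstep_pull:
  assumes "pt l" "lstep f S"
  shows "lstep (\<lambda>x. f (l x)) (disc l \<union> {x. l x \<in> S})"
  unfolding lstep_def
proof (intro conjI allI impI)
  fix x
  show "\<forall>\<^sub>F y in at_left x. f (l y) = f (l x)"
    by (rule pt_pull_left[OF assms(1)]) (rule lstep_left[OF assms(2)])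
  assume "x \<notin> disc l \<union> {x. l x \<in> S}"
  then have "x \<notin> disc l" and S: "l x \<notin> S" by auto
  then have e: "rgt l x = l x" by (simp add: disc_def)
  show "\<forall>\<^sub>F y in at_right x. f (l y) = f (l x)"
    by (rule pt_pull_right[OF assms(1)]) (simp only: e lstep_right[OF assms(2) S])
qed

lemma rgt_comp:
  assumes "pt l" "pt m" shows "rgt (l \<circ> m) = rgt l \<circ> rgt m"
proof
  fix x
  have "\<forall>\<^sub>F y in at_right x. l (m y) = m y + (rgt l (rgt m x) - rgt m x)"
    by (rule pt_pull_right[OF assms(2)]) (rule pt_right[OF assms(1)])
  then have "\<forall>\<^sub>F y in at_right x. (l \<circ> m) y = y + ((rgt l \<circ> rgt m) x - x)"
    using pt_right[OF assms(2), of x] by eventually_elim simp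
  then show "rgt (l \<circ> m) x = (rgt l \<circ> rgt m) x" by (rule rgt_eqI)
qed

lemma rgt_id: "rgt id = id"
proof
  fix x show "rgt id x = id x" by (rule rgt_eqI) simp
qed

lemma pt_id: "pt id"
  by (rule ptI[of _ "{}"]) (auto simp: lstep_def)

lemma finite_bij_vimage: "bij l \<Longrightarrow> finite S \<Longrightarrow> finite {x. l x \<in> S}"
  using finite_vimageI[of S l] by (simp add: bij_def vimage_def)

lemma pt_comp:
  assumes "pt l" "pt m" shows "pt (l \<circ> m)"
proof (rule ptI)
  show "bij (l \<circ> m)" using assms by (intro bij_comp pt_bij)
  let ?S = "(disc m \<union> {x. m x \<in> disc l}) \<union> disc m"
  show "finite ?S" using pt_disc assms by (auto simp: finite_bij_vimage pt_bij)
  have "lstep (\<lambda>x. (l (m x) - m x) + (m x - x)) ?S"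
    by (rule lstep_map2[of _ _ _ _ "(+)"], rule lstep_pull[OF assms(2) pt_disc(2)[OF assms(1)]])
      (rule pt_disc(2)[OF assms(2)])
  then show "lstep (\<lambda>x. (l \<circ> m) x - x) ?S" by simp
qed

lemma pt_inv:
  assumes "pt l" shows "pt (inv' l)"
proof (rule ptI)
  have b: "bij l" by (rule pt_bij[OF assms])
  have inv': "inv' l (l x) = x" "l (inv' l x) = x" for x
    using b by (auto simp: bij_def surj_f_inv_f)
  show "bij (inv' l)" by (rule bij_imp_bij_inv[OF b])
  show "finite (l ` disc l)" using pt_disc(1)[OF assms] by simp
  show "lstep (\<lambda>x. inv' l x - x) (l ` disc l)"
    unfolding lstep_def
  proof safe
    fix y
    have "\<forall>\<^sub>F u in at_left y. l (u + (inv' l y - y)) = u + (inv' l y - y) + (l (inv' l y) - inv' l y)"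
      by (rule eventually_translate_left) (use pt_left[OF assms, of "inv' l y"] in simp)
    then show "\<forall>\<^sub>F u in at_left y. inv' l u - u = inv' l y - y"
    proof eventually_elim
      case (elim u)
      then have "l (u + (inv' l y - y)) = u" by (simp add: inv')
      then have "inv' l u = u + (inv' l y - y)" using inv'(1) by metis
      then show ?case by simp
    qed
  next
    fix y assume "y \<notin> l ` disc l"
    then have "inv' l y \<notin> disc l" by (metis image_eqI inv'(2))
    then have e: "rgt l (inv' l y) = y" by (simp add: disc_def inv')
    have "\<forall>\<^sub>F u in at_right y. l (u + (inv' l y - y)) = u + (inv' l y - y) + (y - inv' l y)"
      by (rule eventually_translate_right) (use pt_right[OF assms, of "inv' l y"] e in simp)
    then show "\<forall>\<^sub>F u in at_right y. inv' l u - u = inv' l y - y"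
    proof eventually_elim
      case (elim u)
      then have "l (u + (inv' l y - y)) = u" by simp
      then have "inv' l u = u + (inv' l y - y)" using inv'(1) by metis
      then show ?case by simp
    qed
  qed
qed

lemma pt_inv_simps:
  assumes "pt l"
  shows "inv' l (l x) = x" "l (inv' l x) = x" "rgt (inv' l) (rgt l x) = x" "rgt l (rgt (inv' l) x) = x"
    "inv' l \<circ> l = id" "l \<circ> inv' l = id"
proof -
  have b: "bij l" by (rule pt_bij[OF assms])
  show i: "inv' l (l x) = x" "l (inv' l x) = x" for x
    using b by (auto simp: bij_def surj_f_inv_f)
  show c: "inv' l \<circ> l = id" "l \<circ> inv' l = id" using i by auto
  show "rgt (inv' l) (rgt l x) = x" "rgt l (rgt (inv' l) x) = x"
    using rgt_comp[OF assms pt_inv[OF assms]] rgt_comp[OF pt_inv[OF assms] assms] c rgt_id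
    by (metis comp_apply id_apply)+
qed

lemma pt_eq_iff: "pt l \<Longrightarrow> l x = l y \<longleftrightarrow> x = y"
  by (metis pt_inv_simps(1))

lemma rgt_eq_iff: "pt l \<Longrightarrow> rgt l x = rgt l y \<longleftrightarrow> x = y"
  by (metis pt_inv_simps(3))

lemma pt_funpow: "pt l \<Longrightarrow> pt (l ^^ n)"
  by (induction n) (auto intro: pt_id pt_comp simp: pt_id[unfolded id_def])

lemma rgt_funpow: "pt l \<Longrightarrow> rgt (l ^^ n) = rgt l ^^ n"
  by (induction n) (auto simp: rgt_id[unfolded id_def] id_def rgt_comp pt_funpow)

lemma disc_comp:
  assumes "pt l" "pt m" shows "disc (l \<circ> m) \<subseteq> disc m \<union> {x. m x \<in> disc l}"
  by (auto simp: disc_def rgt_comp[OF assms])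

lemma disc_inv:
  assumes "pt l" shows "disc (inv' l) = l ` disc l"
proof -
  have *: "l x \<in> disc (inv' l) \<longleftrightarrow> x \<in> disc l" for x
  proof
    assume "l x \<in> disc (inv' l)"
    then have "rgt (inv' l) (l x) \<noteq> x" by (simp add: disc_def pt_inv_simps[OF assms])
    then show "x \<in> disc l" using pt_inv_simps(3)[OF assms, of x] by (auto simp: disc_def)
  next
    assume "x \<in> disc l"
    then have "rgt l x \<noteq> l x" by (simp add: disc_def)
    then show "l x \<in> disc (inv' l)"
      using pt_inv_simps(4)[OF assms, of "l x"] by (auto simp: disc_def pt_inv_simps(1)[OF assms])
  qed
  show ?thesis
  proof (intro Set.set_eqI)
    fix y
    have "y = l (inv' l y)" by (simp add: pt_inv_simps(2)[OF assms])
    then show "y \<in> disc (inv' l) \<longleftrightarrow> y \<in> l ` disc l"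
      using * by (metis image_iff pt_eq_iff[OF assms])
  qed
qed

lemma elem_pull:
  assumes "pt l" "elem V" shows "elem {x. l x \<in> V}"
proof -
  obtain S where S: "finite S" "lstep (\<lambda>x. x \<in> V) S" using assms(2) by (auto simp: elem_def)
  show ?thesis
  proof (rule lstep_imp_elem)
    show "finite (disc l \<union> {x. l x \<in> S})"
      using S pt_disc[OF assms(1)] pt_bij[OF assms(1)] by (simp add: finite_bij_vimage)
    show "lstep (\<lambda>x. x \<in> {x. l x \<in> V}) (disc l \<union> {x. l x \<in> S})"
      using lstep_pull[OF assms(1) S(2)] by simp
  qed
qed

lemma pt_image: "pt l \<Longrightarrow> l ` V = {x. inv' l x \<in> V}"
  by (auto simp: pt_inv_simps intro: image_eqI[OF sym[OF pt_inv_simps(2)]])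

lemma elem_image: "pt l \<Longrightarrow> elem V \<Longrightarrow> elem (l ` V)"
  by (simp add: pt_image elem_pull pt_inv)

lemma elem_fix: assumes "pt l" shows "elem {x. l x = x}"
  using elem_level[OF pt_disc(2)[OF assms] pt_disc(1)[OF assms], of "\<lambda>d. d = 0"] by simp

section \<open>Integer powers and infinite orbits\<close>

definition zp :: "('a \<Rightarrow> 'a) \<Rightarrow> int \<Rightarrow> 'a \<Rightarrow> 'a" where
  "zp f n = (if n \<ge> 0 then f ^^ nat n else inv' f ^^ nat (- n))"

lemma zp_0 [simp]: "zp f 0 = id"
  and zp_int: "zp f (int n) = f ^^ n"
  and zp_minus_int: "zp f (- int n) = inv' f ^^ n"
  by (auto simp: zp_def)

lemma zp_1 [simp]: "zp f 1 = f"
  using zp_int[of f 1] by simp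

lemma bij_cancel: "bij f \<Longrightarrow> f (inv' f x) = x" "bij f \<Longrightarrow> inv' f (f x) = x"
  by (auto simp: bij_def surj_f_inv_f)

lemma zp_succ: assumes "bij f" shows "zp f (n + 1) x = f (zp f n x)"
proof (cases "n \<ge> 0")
  case True
  then show ?thesis by (simp add: zp_def nat_add_distrib)
next
  case False
  then obtain m where "n = - int (Suc m)" by (metis not_le negD neg_int_cases zero_less_Suc gr0_implies_Suc)
  then have n: "n = - int (Suc m)" "n + 1 = - int m" by auto
  show ?thesis unfolding n(2) unfolding n(1) zp_minus_int by (simp add: bij_cancel[OF assms])
qed

lemma zp_pred: "bij f \<Longrightarrow> zp f (n - 1) x = inv' f (zp f n x)"
  using zp_succ[of f "n - 1" x] by (simp add: bij_cancel)

lemma int_step_induct: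
  fixes n :: int
  assumes "P 0" "\<And>n. P n \<Longrightarrow> P (n + 1)" "\<And>n. P n \<Longrightarrow> P (n - 1)" shows "P n"
  by (induction n rule: int_induct[where k=0]) (use assms in auto)

lemma zp_add: assumes "bij f" shows "zp f (m + n) x = zp f m (zp f n x)"
proof (induction m rule: int_step_induct)
  case (2 m)
  then show ?case
    using zp_succ[OF assms, of "m + n" x] zp_succ[OF assms, of m] by (simp add: algebra_simps)
next
  case (3 m)
  then show ?case
    using zp_pred[OF assms, of "m + n" x] zp_pred[OF assms, of m] by (simp add: algebra_simps)
qed simp

lemma zp_cancel [simp]:
  assumes "bij f" shows "zp f (- n) (zp f n x) = x" "zp f n (zp f (- n) x) = x"
  using zp_add[OF assms, of "- n" n x] zp_add[OF assms, of n "- n" x] by simp_all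

lemma bij_zp: "bij f \<Longrightarrow> bij (zp f n)"
  by (rule bij_betw_byWitness[where f'="zp f (- n)"]) simp_all

lemma zp_mult: assumes "bij f" shows "zp f (m * n) x = zp (zp f m) n x"
proof (induction n arbitrary: x rule: int_step_induct)
  case (2 n)
  then show ?case
    using zp_add[OF assms, of m "m * n" x] zp_succ[OF bij_zp[OF assms], of m n x]
    by (simp add: algebra_simps)
next
  case (3 n)
  have "zp f m (zp f (m * (n - 1)) x) = zp f (m * n) x"
    using zp_add[OF assms, of m "m * (n - 1)" x] by (simp add: algebra_simps)
  also have "\<dots> = zp f m (zp (zp f m) (n - 1) x)"
    using zp_succ[OF bij_zp[OF assms], of m "n - 1" x] 3 by simp
  finally show ?case using bij_is_inj[OF bij_zp[OF assms]] by (metis injD)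
qed simp

lemma zp_invariant:
  assumes "bij f" "f ` V = V" shows "zp f n x \<in> V \<longleftrightarrow> x \<in> V"
proof (induction n rule: int_step_induct)
  case (2 n)
  then show ?case using assms by (metis zp_succ bij_cancel(2) image_iff)
next
  case (3 n)
  then show ?case using assms by (metis zp_pred bij_cancel image_iff)
qed simp

lemma zp_intertwine_on:
  assumes "bij f" "bij g" "f ` W = W" "\<And>x. x \<in> W \<Longrightarrow> h (f x) = g (h x)" "x \<in> W"
  shows "h (zp f n x) = zp g n (h x)"
proof (induction n rule: int_step_induct)
  case (2 n)
  have "zp f n x \<in> W" using zp_invariant[OF assms(1,3)] assms(5) by blast
  from assms(4)[OF this] show ?case using 2 by (simp add: zp_succ assms(1,2))
next
  case (3 n)
  have "zp f (n - 1) x \<in> W" using zp_invariant[OF assms(1,3)] assms(5) by blast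
  from assms(4)[OF this] have "g (h (zp f (n - 1) x)) = h (zp f n x)"
    by (simp add: zp_pred assms(1) bij_cancel)
  then have "h (zp f (n - 1) x) = inv' g (h (zp f n x))" using bij_cancel[OF assms(2)] by metis
  then show ?case using 3 by (simp add: zp_pred assms(2))
qed simp

lemma zp_intertwine:
  assumes "bij f" "bij g" "\<And>x. h (f x) = g (h x)" shows "h (zp f n x) = zp g n (h x)"
  by (rule zp_intertwine_on[where W=UNIV and h=h, OF assms(1,2) bij_is_surj[OF assms(1)] assms(3)]) simp

lemma image_eq_mem: "bij f \<Longrightarrow> f ` V = V \<Longrightarrow> f x \<in> V \<longleftrightarrow> x \<in> V"
  using zp_invariant[of f V 1 x] by simp

lemma pt_zp: "pt z \<Longrightarrow> pt (zp z n)"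
  by (simp add: zp_def pt_funpow pt_inv)

definition aper :: "('a \<Rightarrow> 'a) \<Rightarrow> 'a set" where
  "aper z = {x. \<forall>k>0. (z ^^ k) x \<noteq> x}"

lemma zp_inj_aper:
  assumes "bij z" "x \<in> aper z" "zp z m x = zp z n x" shows "m = n"
proof (rule ccontr)
  assume "m \<noteq> n"
  have *: False if "i < j" "zp z i x = zp z j x" for i j
  proof -
    have "zp z (- i) (zp z j x) = x" using that(2) assms(1) by (metis zp_cancel(1))
    then have "(z ^^ nat (j - i)) x = x"
      using that(1) zp_add[OF assms(1), of "- i" j x] zp_int[of z "nat (j - i)"] by simp
    then show False using that(1) assms(2) by (auto simp: aper_def)
  qed
  show False using *[of m n] *[OF _ assms(3)[symmetric]] assms(3) \<open>m \<noteq> n\<close> by linarith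
qed

lemma aper_intertwine:
  assumes "bij b" "\<And>x. b (z x) = z' (b x)" shows "b x \<in> aper z' \<longleftrightarrow> x \<in> aper z"
proof -
  have "(z' ^^ k) (b x) = b ((z ^^ k) x)" for k
    by (induction k) (auto simp: assms(2))
  then show ?thesis using bij_is_inj[OF assms(1)] by (auto simp: aper_def inj_eq)
qed

lemma aper_inv: assumes "bij z" shows "aper (inv' z) = aper z"
proof -
  have "(inv' z ^^ k) x = x \<longleftrightarrow> (z ^^ k) x = x" for k x
    using zp_cancel[OF assms, of "int k" x] by (metis zp_int zp_minus_int)
  then show ?thesis by (simp add: aper_def)
qed

lemma finite_orbit_hits:
  assumes "bij z" "x \<in> aper z" "finite S" shows "finite {n. zp z n x \<in> S}"
proof -
  have "inj (\<lambda>n. zp z n x)" using zp_inj_aper[OF assms(1,2)] by (auto intro: injI)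
  from finite_vimageI[OF assms(3) this] show ?thesis by (simp add: vimage_def)
qed

lemma eventually_orbit_avoids:
  assumes "bij z" "x \<in> aper z" "finite S"
  shows "\<forall>\<^sub>F n in sequentially. (z ^^ n) x \<notin> S"
proof -
  have "inj (\<lambda>n::nat. (z ^^ n) x)"
    using zp_inj_aper[OF assms(1,2)] by (auto intro!: injI) (metis zp_int of_nat_eq_iff)
  from finite_vimageI[OF assms(3) this] have "finite {n. (z ^^ n) x \<in> S}" by (simp add: vimage_def)
  then show ?thesis by (auto simp: cofinite_eq_sequentially[symmetric] eventually_cofinite)
qed

section \<open>Orbit segments between discontinuities, periodic points and invariant sets\<close>

definition pass :: "(real \<Rightarrow> real) \<Rightarrow> real set" where
  "pass z = {x \<in> aper z. (\<exists>n\<ge>0. zp z n x \<in> disc z) \<and> (\<exists>n<0. zp z n x \<in> disc z)}"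

text \<open>An infinite orbit meets \<open>disc z\<close> finitely often. A point of
  \<open>pass z\<close> therefore comes at most \<open>Max (N s)\<close> steps after some
  discontinuity s on its orbit, and there are finitely many such s.\<close>

lemma finite_pass: assumes "pt z" shows "finite (pass z)"
proof -
  note b = pt_bij[OF assms]
  define N where "N s = {n. zp z n s \<in> disc z}" for s
  have fN: "finite (N s)" if "s \<in> aper z" for s
    using finite_orbit_hits[OF b that pt_disc(1)[OF assms]] by (simp add: N_def)
  have "pass z \<subseteq> (\<Union>s\<in>disc z \<inter> aper z. (\<lambda>k. zp z k s) ` {0..Max (N s)})"
  proof
    fix x assume "x \<in> pass z"
    then obtain m n where x: "x \<in> aper z" "m \<ge> 0" "zp z m x \<in> disc z" "n < 0" "zp z n x \<in> disc z"
      by (auto simp: pass_def)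
    let ?s = "zp z n x"
    have s: "?s \<in> aper z"
      using x(1) aper_intertwine[where b="zp z n" and z=z and z'=z, OF bij_zp[OF b]]
        zp_intertwine[OF b b, of z, symmetric] by simp
    have xs: "x = zp z (- n) ?s" using b by simp
    have "zp z (m - n) ?s = zp z m x" using zp_add[OF b, of "m - n" n x] by simp
    then have "m - n \<in> N ?s" using x by (simp add: N_def)
    then have "m - n \<le> Max (N ?s)" using fN[OF s] by simp
    then have "x \<in> (\<lambda>k. zp z k ?s) ` {0..Max (N ?s)}" using x xs by (intro image_eqI[of _ _ "- n"]) auto
    then show "x \<in> (\<Union>s\<in>disc z \<inter> aper z. (\<lambda>k. zp z k s) ` {0..Max (N s)})" using x s by blast
  qed
  moreover have "finite (\<Union>s\<in>disc z \<inter> aper z. (\<lambda>k. zp z k s) ` {0..Max (N s)})"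
    using pt_disc(1)[OF assms] by auto
  ultimately show ?thesis by (rule finite_subset)
qed

text \<open>As long as the forward orbit avoids \<open>disc z\<close>, left and right germs move
  together, so every iterate of x is again a right boundary point of V. The finite set
  \<open>bdry V\<close> cannot hold an infinite orbit.\<close>

lemma right_boundary_hits_disc:
  assumes "pt z" "elem V" "z ` V = V" "V \<subseteq> aper z" "x \<in> V" "\<forall>\<^sub>F y in at_right x. y \<notin> V"
  shows "\<exists>n. (z ^^ n) x \<in> disc z"
proof (rule ccontr)
  assume no: "\<nexists>n. (z ^^ n) x \<in> disc z"
  note b = pt_bij[OF assms(1)]
  have mem: "z y \<in> V \<longleftrightarrow> y \<in> V" for y by (rule image_eq_mem[OF b assms(3)])
  have *: "(z ^^ n) x \<in> V \<and> (\<forall>\<^sub>F y in at_right ((z ^^ n) x). y \<notin> V)" for n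
  proof (induction n)
    case (Suc n)
    let ?w = "(z ^^ n) x"
    have "rgt z ?w = z ?w" using no by (auto simp: disc_def)
    moreover have "\<forall>\<^sub>F y in at_right (rgt z ?w). y \<notin> V"
      by (rule pt_push_right[OF assms(1)]) (use Suc mem in simp)
    ultimately show ?case using Suc mem by simp
  qed (use assms in simp)
  have "(z ^^ n) x \<in> bdry V" for n
    unfolding bdry_def mem_Collect_eq
  proof
    assume "\<forall>\<^sub>F y in at_right ((z ^^ n) x). (y \<in> V) = ((z ^^ n) x \<in> V)"
    moreover have "\<forall>\<^sub>F y in at_right ((z ^^ n) x). y \<notin> V" using * by auto
    ultimately have "\<forall>\<^sub>F y in at_right ((z ^^ n) x). False"
      by eventually_elim (use * in auto)
    then show False by simp
  qed
  moreover have "x \<in> aper z" using assms by auto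
  ultimately show False
    using eventually_orbit_avoids[OF b _ elem_bdry(1)[OF assms(2)], of x]
    by (simp add: eventually_sequentially)
qed

lemma right_boundary_pass:
  assumes "pt z" "elem V" "z ` V = V" "V \<subseteq> aper z" "x \<in> V" "\<forall>\<^sub>F y in at_right x. y \<notin> V"
  shows "x \<in> pass z"
proof -
  note b = pt_bij[OF assms(1)]
  obtain n where "(z ^^ n) x \<in> disc z" using right_boundary_hits_disc[OF assms] ..
  then have 1: "zp z (int n) x \<in> disc z" by (simp add: zp_int)
  have "inv' z ` V = V" by (metis assms(3) b bij_def image_inv_f_f)
  from right_boundary_hits_disc[OF pt_inv[OF assms(1)] assms(2) this _ assms(5,6)]
  obtain m where "(inv' z ^^ m) x \<in> z ` disc z"
    using assms(4) by (auto simp: aper_inv[OF b] disc_inv[OF assms(1)])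
  then have "zp z (- int m) x \<in> z ` disc z" by (simp add: zp_minus_int)
  \<comment> \<open>Discontinuities of the inverse are images under z of those of z, so the exponent
    drops by one. This is the source of the strict inequality in \<open>pass\<close>.\<close>
  then have "zp z (- int m - 1) x \<in> disc z" by (auto simp: zp_pred[OF b] bij_cancel[OF b])
  with 1 show ?thesis using assms(4,5) unfolding pass_def
    by (intro CollectI conjI exI[of _ "int n"] exI[of _ "- int m - 1"]) auto
qed

text \<open>A jump of a fixed point set at x means that one germ at x is fixed by z^k and the other
  is not. Off the finite orbits of z and of \<open>rgt z\<close> through discontinuities, a periodic
  germ never parts from its partner, so the jumps for all k lie in one finite set.\<close>

lemma finite_periodic_family:
  assumes "pt z" shows "finite {V. \<exists>k>0. V = {x. (z ^^ k) x = x}}"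
proof -
  note b = pt_bij[OF assms]
  define Orb where "Orb f = (\<Union>s\<in>{s \<in> disc z. \<exists>k>0. (f ^^ k) s = s}. range (\<lambda>n. (f ^^ n) s))" for f :: "real \<Rightarrow> real"
  have finO: "finite (Orb f)" for f
    unfolding Orb_def
  proof (intro finite_UN_I)
    show "finite {s \<in> disc z. \<exists>k>0. (f ^^ k) s = s}" using pt_disc(1)[OF assms] by simp
    fix s assume "s \<in> {s \<in> disc z. \<exists>k>0. (f ^^ k) s = s}"
    then obtain k where k: "k > 0" "(f ^^ k) s = s" by auto
    have "range (\<lambda>n. (f ^^ n) s) \<subseteq> (\<lambda>n. (f ^^ n) s) ` {..<k}"
    proof safe
      fix n
      have "(f ^^ n) s = (f ^^ (n mod k)) s" using funpow_mod_eq[OF k(2), of n] by simp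
      then show "(f ^^ n) s \<in> (\<lambda>n. (f ^^ n) s) ` {..<k}" using k(1) by simp
    qed
    then show "finite (range (\<lambda>n. (f ^^ n) s))" by (rule finite_subset) simp
  qed
  have avoid: "(f ^^ i) x \<notin> disc z" if "x \<notin> Orb f" "k > 0" "(f ^^ k) x = x" for f :: "real \<Rightarrow> real" and x i k
  proof
    assume d: "(f ^^ i) x \<in> disc z"
    have "(f ^^ k) ((f ^^ i) x) = (f ^^ i) x"
      using that(3) by (metis add.commute comp_apply funpow_add)
    \<comment> \<open>Another i * k - i steps complete i full periods, so x lies on the orbit of the
      discontinuity just met.\<close>
    moreover have "(f ^^ (i * k - i)) ((f ^^ i) x) = x"
    proof -
      have "(f ^^ (i * k - i)) ((f ^^ i) x) = (f ^^ (i * k - i + i)) x" by (simp add: funpow_add)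
      also have "i * k - i + i = i * k" using that(2) by simp
      also have "(f ^^ (i * k)) x = x" using funpow_mod_eq[OF that(3), of "i * k"] by simp
      finally show ?thesis .
    qed
    ultimately have "x \<in> Orb f"
      unfolding Orb_def using d that(2)
      by (intro UN_I[of "(f ^^ i) x"] CollectI conjI exI[of _ k] range_eqI[of _ _ "i * k - i"]) simp_all
    then show False using that(1) by simp
  qed
  have "lstep (\<lambda>x. x \<in> {x. (z ^^ k) x = x}) (Orb z \<union> Orb (rgt z))" if k: "k > 0" for k
    unfolding lstep_def
  proof (intro conjI allI impI)
    note h = pt_funpow[OF assms, of k]
    fix x
    show "\<forall>\<^sub>F y in at_left x. (y \<in> {x. (z ^^ k) x = x}) = (x \<in> {x. (z ^^ k) x = x})"
      by (rule elem_left[OF elem_fix[OF h]])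
    assume x: "x \<notin> Orb z \<union> Orb (rgt z)"
    have "(z ^^ k) x = x \<longleftrightarrow> (rgt z ^^ k) x = x"
    proof
      assume *: "(z ^^ k) x = x"
      have "(rgt z ^^ i) x = (z ^^ i) x" for i
        by (induction i) (use avoid[of x z, OF _ k *] x in \<open>auto simp: disc_def\<close>)
      then show "(rgt z ^^ k) x = x" using * by simp
    next
      assume *: "(rgt z ^^ k) x = x"
      have "(z ^^ i) x = (rgt z ^^ i) x" for i
        by (induction i) (use avoid[of x "rgt z", OF _ k *] x in \<open>auto simp: disc_def\<close>)
      then show "(z ^^ k) x = x" using * by simp
    qed
    moreover have "\<forall>\<^sub>F y in at_right x. ((z ^^ k) y = y) = ((rgt z ^^ k) x = x)"
      using pt_right[OF h, of x] by eventually_elim (auto simp: rgt_funpow[OF assms])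
    ultimately show "\<forall>\<^sub>F y in at_right x. (y \<in> {x. (z ^^ k) x = x}) = (x \<in> {x. (z ^^ k) x = x})"
      by simp
  qed
  then have "{V. \<exists>k>0. V = {x. (z ^^ k) x = x}} \<subseteq> {V. lstep (\<lambda>x. x \<in> V) (Orb z \<union> Orb (rgt z))}"
    by blast
  then show ?thesis
    by (rule finite_subset) (intro finite_lstep_sets finite_UnI finO)
qed

text \<open>The finitely many fixed point sets supply finitely many exponents; their product is a
  period for every periodic point.\<close>

lemma uniform_period:
  assumes "pt z" shows "\<exists>K>0. \<forall>x. x \<notin> aper z \<longrightarrow> (z ^^ K) x = x"
proof -
  let ?F = "{V. \<exists>k>0. V = {x. (z ^^ k) x = x}}"
  have "\<forall>V\<in>?F. \<exists>k. k > 0 \<and> V = {x. (z ^^ k) x = x}" by blast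
  from bchoice[OF this] obtain k where "\<forall>V\<in>?F. k V > 0 \<and> V = {x. (z ^^ k V) x = x}"
    by (elim exE)
  then have k: "k V > 0" "V = {x. (z ^^ k V) x = x}" if "V \<in> ?F" for V
    using bspec[OF _ that] by blast+
  let ?K = "\<Prod>V\<in>?F. k V"
  have fin: "finite ?F" by (rule finite_periodic_family[OF assms])
  have "?K > 0" using k by (intro prod_pos) blast
  moreover have "(z ^^ ?K) x = x" if nx: "x \<notin> aper z" for x
  proof -
    obtain i where i: "i > 0" "(z ^^ i) x = x" using nx by (auto simp: aper_def)
    let ?V = "{x. (z ^^ i) x = x}"
    have V: "?V \<in> ?F" using i by blast
    then have "(z ^^ k ?V) x = x" using k[OF V] i by blast
    moreover have "k ?V dvd ?K" using fin V by (rule dvd_prodI)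
    ultimately show ?thesis using funpow_mod_eq[of "k ?V" z x ?K] by simp
  qed
  ultimately show ?thesis by blast
qed

lemma elem_aper: assumes "pt z" shows "elem (aper z)"
proof -
  obtain K where K: "K > 0" "\<And>x. x \<notin> aper z \<Longrightarrow> (z ^^ K) x = x" using uniform_period[OF assms] by blast
  then have "aper z = - {x. (z ^^ K) x = x}" by (auto simp: aper_def)
  then show ?thesis using elem_Compl[OF elem_fix[OF pt_funpow[OF assms]]] by simp
qed

text \<open>A jump of V at x, off \<open>bdry (aper z)\<close>, makes x a right boundary point of V
  or of its complement in \<open>aper z\<close>. Both sets are invariant, so x lies in
  \<open>pass z\<close>, whatever V is: all these sets share a finite jump set.\<close>

lemma finite_invariant_sets:
  assumes "pt z" shows "finite {V. elem V \<and> z ` V = V \<and> V \<subseteq> aper z}"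
proof (rule finite_subset)
  let ?P = "pass z \<union> bdry (aper z)"
  show "finite {V. lstep (\<lambda>x. x \<in> V) ?P}"
    by (intro finite_lstep_sets finite_UnI finite_pass[OF assms] elem_bdry(1) elem_aper[OF assms])
  note b = pt_bij[OF assms]
  show "{V. elem V \<and> z ` V = V \<and> V \<subseteq> aper z} \<subseteq> {V. lstep (\<lambda>x. x \<in> V) ?P}"
  proof safe
    fix V assume V: "elem V" "z ` V = V" "V \<subseteq> aper z"
    show "lstep (\<lambda>x. x \<in> V) ?P"
      unfolding lstep_def
    proof (intro conjI allI impI)
      fix x
      show "\<forall>\<^sub>F y in at_left x. (y \<in> V) = (x \<in> V)" by (rule elem_left[OF V(1)])
      assume x: "x \<notin> ?P"
      then have ap: "\<forall>\<^sub>F y in at_right x. y \<in> aper z \<longleftrightarrow> x \<in> aper z" by (auto simp: bdry_def)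
      consider "\<forall>\<^sub>F y in at_right x. y \<in> V" | "\<forall>\<^sub>F y in at_right x. y \<notin> V"
        using elem_right[OF V(1)] by blast
      then show "\<forall>\<^sub>F y in at_right x. (y \<in> V) = (x \<in> V)"
      proof cases
        case 1
        have "x \<in> V"
        proof (rule ccontr)
          assume "x \<notin> V"
          have "\<forall>\<^sub>F y in at_right x. x \<in> aper z" using 1 ap by eventually_elim (use V in auto)
          then have "x \<in> aper z - V" using \<open>x \<notin> V\<close> by simp
          moreover have "z ` (aper z - V) = aper z - V"
          proof -
            have "z y \<in> aper z - V \<longleftrightarrow> y \<in> aper z - V" for y
              using aper_intertwine[OF b, of z z y] image_eq_mem[OF b V(2)] by simp
            then show ?thesis using bij_cancel[OF b] by (metis (no_types, lifting) image_eqI image_subset_iff subsetI subset_antisym)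
          qed
          ultimately have "x \<in> pass z"
            using 1 by (intro right_boundary_pass[OF assms elem_Diff[OF elem_aper[OF assms] V(1)]])
              (auto elim: eventually_mono)
          then show False using x by simp
        qed
        with 1 show ?thesis by simp
      next
        case 2
        then have "x \<notin> V" using right_boundary_pass[OF assms V, of x] x by blast
        with 2 show ?thesis by simp
      qed
    qed
  qed
qed

section \<open>Mismatched orbits\<close>

text \<open>past z x is the right germ whose backward orbit eventually runs alongside that of the left
  germ x; the forward analogue is past (inv' z) x. Where the two differ, the iterates of z have
  linearly many discontinuities (Novak's dichotomy).\<close>

definition past :: "(real \<Rightarrow> real) \<Rightarrow> real \<Rightarrow> real" where
  "past z x = (THE v. \<forall>\<^sub>F n in sequentially. (rgt z ^^ n) ((inv' z ^^ n) x) = v)"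

definition mism :: "(real \<Rightarrow> real) \<Rightarrow> real set" where
  "mism z = {x \<in> aper z. past z x \<noteq> past (inv' z) x}"

text \<open>Far back the orbit of x avoids \<open>disc z\<close>, where z and \<open>rgt z\<close>
  agree, so going one step further back and forth again changes nothing.\<close>

lemma eventually_past:
  assumes "pt z" "x \<in> aper z"
  shows "\<forall>\<^sub>F n in sequentially. (rgt z ^^ n) ((inv' z ^^ n) x) = past z x"
proof -
  note b = pt_bij[OF assms(1)]
  let ?g = "\<lambda>n. (rgt z ^^ n) ((inv' z ^^ n) x)"
  have "\<forall>\<^sub>F n in sequentially. (inv' z ^^ n) x \<notin> disc z"
    using eventually_orbit_avoids[of "inv' z" x] assms pt_disc(1) pt_inv[THEN pt_bij] aper_inv[OF b] by auto
  then obtain N where N: "\<And>n. n \<ge> N \<Longrightarrow> (inv' z ^^ n) x \<notin> disc z" by (auto simp: eventually_sequentially)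
  have "?g (N + k) = ?g N" for k
  proof (induction k)
    case (Suc k)
    let ?y = "(inv' z ^^ (N + k)) x"
    have "rgt z (inv' z ?y) = z (inv' z ?y)" using N[of "Suc (N + k)"] by (simp add: disc_def)
    moreover have "?g (N + Suc k) = (rgt z ^^ (N + k)) (rgt z (inv' z ?y))"
      by (simp add: funpow_swap1[of "rgt z"])
    ultimately have "?g (N + Suc k) = ?g (N + k)" by (simp add: bij_cancel[OF b])
    then show ?case using Suc by simp
  qed simp
  then have "?g n = ?g N" if "n \<ge> N" for n
    using that \<open>\<And>k. ?g (N + k) = ?g N\<close>[of "n - N"] by simp
  then have *: "\<forall>\<^sub>F n in sequentially. ?g n = ?g N" unfolding eventually_sequentially by blast
  have "past z x = ?g N" unfolding past_def
  proof (rule the_equality)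
    show "\<forall>\<^sub>F n in sequentially. ?g n = ?g N" by (rule *)
    fix v assume "\<forall>\<^sub>F n in sequentially. ?g n = v"
    with * have "\<forall>\<^sub>F n::nat in sequentially. v = ?g N" by eventually_elim simp
    then show "v = ?g N" by simp
  qed
  then show ?thesis using * by simp
qed

lemma past_eqI:
  assumes "pt z" "x \<in> aper z" "\<forall>\<^sub>F n in sequentially. (rgt z ^^ n) ((inv' z ^^ n) x) = v"
  shows "past z x = v"
proof -
  have "\<forall>\<^sub>F n::nat in sequentially. past z x = v"
    using eventually_past[OF assms(1,2)] assms(3) by eventually_elim simp
  then show ?thesis by simp
qed

lemma funpow_intertwine: "(\<And>x. b (f x) = g (b x)) \<Longrightarrow> b ((f ^^ n) x) = (g ^^ n) (b x)"
  by (induction n) auto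

text \<open>The maps b and \<open>rgt b\<close> may differ at x, but they agree far back on its
  orbit, which eventually leaves the finite set \<open>disc b\<close>. Comparing them there and
  flowing forward gives the claim.\<close>

lemma past_intertwine:
  assumes "pt z" "pt z'" "pt b" "\<And>x. b (z x) = z' (b x)" "x \<in> aper z"
  shows "past z' (b x) = rgt b (past z x)"
proof (rule past_eqI[OF assms(2)])
  show "b x \<in> aper z'" using aper_intertwine[where b=b and z=z and z'=z', OF pt_bij[OF assms(3)] assms(4)] assms(5) by simp
  have "b \<circ> z = z' \<circ> b" using assms(4) by auto
  then have r: "rgt b (rgt z y) = rgt z' (rgt b y)" for y
    using rgt_comp[OF assms(3,1)] rgt_comp[OF assms(2,3)] by (metis comp_apply)
  have i: "b (inv' z y) = inv' z' (b y)" for y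
    using assms(4)[of "inv' z y"] pt_inv_simps[OF assms(1)] pt_inv_simps[OF assms(2)] by metis
  note bz = pt_bij[OF assms(1)]
  have "\<forall>\<^sub>F n in sequentially. (inv' z ^^ n) x \<notin> disc b"
    using eventually_orbit_avoids[of "inv' z" x] assms pt_disc(1) pt_inv[THEN pt_bij] aper_inv[OF bz] by auto
  with eventually_past[OF assms(1,5)]
  show "\<forall>\<^sub>F n in sequentially. (rgt z' ^^ n) ((inv' z' ^^ n) (b x)) = rgt b (past z x)"
  proof eventually_elim
    case (elim n)
    have "(inv' z' ^^ n) (b x) = b ((inv' z ^^ n) x)"
      using funpow_intertwine[of b "inv' z" "inv' z'", OF i] by simp
    also have "\<dots> = rgt b ((inv' z ^^ n) x)" using elim by (simp add: disc_def)
    finally show ?case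
      using funpow_intertwine[of "rgt b" "rgt z" "rgt z'", OF r] elim by metis
  qed
qed

lemma intertwine_inv:
  assumes "pt z" "pt z'" "\<And>x. b (z x) = z' (b x)" shows "b (inv' z x) = inv' z' (b x)"
  using assms(3)[of "inv' z x"] pt_inv_simps[OF assms(1)] pt_inv_simps[OF assms(2)] by metis

lemma mism_intertwine:
  assumes "pt z" "pt z'" "pt b" "\<And>x. b (z x) = z' (b x)" "x \<in> mism z"
  shows "b x \<in> mism z'"
proof -
  have x: "x \<in> aper z" "x \<in> aper (inv' z)" "past z x \<noteq> past (inv' z) x"
    using assms(5) aper_inv[OF pt_bij[OF assms(1)]] by (auto simp: mism_def)
  have "past (inv' z') (b x) = rgt b (past (inv' z) x)"
    by (rule past_intertwine[OF pt_inv[OF assms(1)] pt_inv[OF assms(2)] assms(3)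
          intertwine_inv[where b=b, OF assms(1,2)] x(2)]) (rule assms(4))
  then show ?thesis
    using past_intertwine[OF assms(1-4) x(1)] x(1,3) rgt_eq_iff[OF assms(3)]
      aper_intertwine[where b=b and z=z and z'=z', OF pt_bij[OF assms(3)] assms(4)] by (simp add: mism_def)
qed

lemma past_neq_hits:
  assumes "pt z" "x \<in> aper z" "past z x \<noteq> x"
  shows "\<exists>n<0. zp z n x \<in> disc z"
proof (rule ccontr)
  assume no: "\<not> ?thesis"
  note b = pt_bij[OF assms(1)]
  have nd: "(inv' z ^^ Suc n) x \<notin> disc z" for n
    using no zp_minus_int[of z "Suc n"] by (metis neg_less_0_iff_less of_nat_0_less_iff zero_less_Suc)
  have "(rgt z ^^ n) ((inv' z ^^ n) x) = x" for n
  proof (induction n)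
    case (Suc n)
    let ?y = "(inv' z ^^ n) x"
    have "rgt z (inv' z ?y) = z (inv' z ?y)"
      using nd[of n] by (simp add: disc_def)
    moreover have "(rgt z ^^ Suc n) ((inv' z ^^ Suc n) x) = (rgt z ^^ n) (rgt z (inv' z ?y))"
      by (simp add: funpow_swap1[of "rgt z"])
    ultimately show ?case using Suc by (simp add: bij_cancel[OF b])
  qed simp
  then have "past z x = x" by (intro past_eqI[OF assms(1,2)]) simp
  then show False using assms(3) by simp
qed

lemma past_inv_neq_hits:
  assumes "pt z" "x \<in> aper z" "past (inv' z) x \<noteq> x"
  shows "\<exists>n\<ge>0. zp z n x \<in> disc z"
proof -
  note b = pt_bij[OF assms(1)]
  have ii: "inv' (inv' z) = z" using b by (rule inv_inv_eq)
  obtain n where n: "n < 0" "zp (inv' z) n x \<in> disc (inv' z)"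
    using past_neq_hits[OF pt_inv[OF assms(1)] _ assms(3)] assms(2) aper_inv[OF b] by auto
  have "zp (inv' z) n x = zp z (- n) x" using n(1) by (simp add: zp_def ii)
  then have "zp z (- n) x \<in> z ` disc z" using n(2) disc_inv[OF assms(1)] by simp
  then have "zp z (- n - 1) x \<in> disc z" by (auto simp: zp_pred[OF b] bij_cancel[OF b])
  then show ?thesis using n(1) by (intro exI[of _ "- n - 1"]) auto
qed

lemma past_eq_self:
  assumes "pt z" "x \<in> aper z" "x \<notin> mism z" "x \<notin> pass z"
  shows "past z x = x" "past (inv' z) x = x"
  using past_neq_hits[OF assms(1,2)] past_inv_neq_hits[OF assms(1,2)] assms(2-4)
  by (auto simp: mism_def pass_def)

text \<open>Since z^m commutes with z, \<open>past\<close> is equivariant under it. Without mismatch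
  \<open>past z x = x\<close> holds off \<open>pass z\<close>; having this at both x and z^m x says
  that z^m and \<open>rgt (z ^^ m)\<close> agree at x. The exceptional set has at most 2 * card
  (pass z) points for every m.\<close>

lemma disc_funpow_no_mism:
  assumes "pt z" "z ` W = W" "W \<subseteq> aper z" "W \<inter> mism z = {}"
  shows "disc (z ^^ m) \<inter> W \<subseteq> pass z \<union> {x. (z ^^ m) x \<in> pass z}"
proof (rule subsetI, rule ccontr)
  fix x assume x: "x \<in> disc (z ^^ m) \<inter> W" and "x \<notin> pass z \<union> {x. (z ^^ m) x \<in> pass z}"
  then have np: "x \<notin> pass z" "(z ^^ m) x \<notin> pass z" by auto
  note b = pt_bij[OF assms(1)]
  have y: "(z ^^ m) x \<in> W" using zp_invariant[OF b assms(2), of "int m" x] x by (simp add: zp_int)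
  have "(z ^^ m) (z u) = z ((z ^^ m) u)" for u by (simp add: funpow_swap1)
  from past_intertwine[OF assms(1,1) pt_funpow[OF assms(1)] this, of x]
  have "past z ((z ^^ m) x) = rgt (z ^^ m) (past z x)" using x assms(3) by auto
  moreover have "past z x = x" using past_eq_self[OF assms(1), of x] np x assms(3,4) by auto
  moreover have "past z ((z ^^ m) x) = (z ^^ m) x"
    using past_eq_self[OF assms(1), of "(z ^^ m) x"] np y assms(3,4) by auto
  ultimately show False using x by (simp add: disc_def)
qed

text \<open>The z-orbit of a mismatched point meets the finite set \<open>disc z\<close>, and b maps
  mismatched points to mismatched points. So two of the points b^i x lie on one z-orbit, and the
  smaller power of b can be cancelled.\<close>

lemma mism_commuting_power:
  assumes "pt z" "pt b" "\<And>x. b (z x) = z (b x)" "x \<in> mism z"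
  shows "\<exists>k>0. \<exists>n. (b ^^ k) x = zp z n x"
proof -
  note bz = pt_bij[OF assms(1)] and bb = pt_bij[OF assms(2)]
  have mi: "(b ^^ i) x \<in> mism z" for i
    by (induction i) (use assms(4) mism_intertwine[OF assms(1,1,2,3)] in auto)
  have "\<exists>n. zp z n ((b ^^ i) x) \<in> disc z" for i
  proof -
    let ?y = "(b ^^ i) x"
    have "?y \<in> aper z" "past z ?y \<noteq> ?y \<or> past (inv' z) ?y \<noteq> ?y" using mi[of i] by (auto simp: mism_def)
    then show ?thesis using past_neq_hits[OF assms(1), of ?y] past_inv_neq_hits[OF assms(1), of ?y] by blast
  qed
  then obtain n where n: "\<And>i. zp z (n i) ((b ^^ i) x) \<in> disc z" by metis
  have "\<not> inj (\<lambda>i. zp z (n i) ((b ^^ i) x))"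
    using n pt_disc(1)[OF assms(1)] by (meson finite_subset image_subsetI infinite_UNIV_nat finite_imageD)
  then obtain i j where ij: "i \<noteq> j" "zp z (n i) ((b ^^ i) x) = zp z (n j) ((b ^^ j) x)" by (auto simp: inj_def)
  have *: "\<exists>k>0. \<exists>n. (b ^^ k) x = zp z n x"
    if lt: "i < j" and eq: "zp z (n i) ((b ^^ i) x) = zp z (n j) ((b ^^ j) x)" for i j
  proof -
    have c: "(b ^^ i) (zp z m y) = zp z m ((b ^^ i) y)" for m y
      using zp_intertwine[of z z "b ^^ i"] bz funpow_intertwine[of z b b, OF assms(3)[symmetric]] by metis
    have "zp z (- n j) (zp z (n i) ((b ^^ i) x)) = (b ^^ j) x" using eq bz by simp
    then have "(b ^^ i) (zp z (- n j + n i) x) = (b ^^ j) x"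
      by (simp only: c zp_add[OF bz])
    also have "\<dots> = (b ^^ i) ((b ^^ (j - i)) x)"
      using lt funpow_add[of i "j - i" b] by simp
    finally have "(b ^^ i) (zp z (- n j + n i) x) = (b ^^ i) ((b ^^ (j - i)) x)" .
    then have "zp z (- n j + n i) x = (b ^^ (j - i)) x" using pt_eq_iff[OF pt_funpow[OF assms(2)]] by simp
    then show ?thesis using lt by (metis zero_less_diff)
  qed
  show ?thesis using *[of i j] *[of j i] ij by (metis linorder_neqE_nat)
qed

text \<open>For N \<le> i \<le> m - N the point z^(-i) x is a discontinuity of z^m. There
  \<open>rgt z ^^ m\<close> gives the image of \<open>past z x\<close> under
  \<open>rgt z ^^ (m - i)\<close>, whereas z^m gives the image of \<open>past (inv' z) x\<close>
  under the same map. The constant 2 * N pays for the two ends of the range.\<close>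

lemma mism_linear_growth:
  assumes "pt z" "z ` W = W" "x \<in> mism z \<inter> W"
  shows "\<exists>C. \<forall>m. m \<le> card (disc (z ^^ m) \<inter> W) + C"
proof -
  note b = pt_bij[OF assms(1)]
  have x: "x \<in> aper z" "x \<in> aper (inv' z)" "past z x \<noteq> past (inv' z) x"
    using assms(3) aper_inv[OF b] by (auto simp: mism_def)
  have ii: "inv' (inv' z) = z" using b by (rule inv_inv_eq)
  have "\<forall>\<^sub>F n in sequentially. (rgt z ^^ n) ((inv' z ^^ n) x) = past z x
      \<and> (rgt (inv' z) ^^ n) ((z ^^ n) x) = past (inv' z) x"
    using eventually_past[OF assms(1) x(1)] eventually_past[OF pt_inv[OF assms(1)] x(2)]
    unfolding ii by eventually_elim simp
  then obtain N where N: "\<And>n. n \<ge> N \<Longrightarrow> (rgt z ^^ n) ((inv' z ^^ n) x) = past z x"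
      "\<And>n. n \<ge> N \<Longrightarrow> (rgt (inv' z) ^^ n) ((z ^^ n) x) = past (inv' z) x"
    by (auto simp: eventually_sequentially)
  have "m \<le> card (disc (z ^^ m) \<inter> W) + 2 * N" for m
  proof -
    have "(inv' z ^^ i) x \<in> disc (z ^^ m) \<inter> W" if i: "N \<le> i" "i + N \<le> m" for i
    proof
      show "(inv' z ^^ i) x \<in> W"
        using zp_invariant[OF b assms(2), of "- int i" x] assms(3) by (simp add: zp_minus_int)
      have e: "m = (m - i) + i" using i by simp
      let ?k = "m - i"
      have 1: "(rgt z ^^ m) ((inv' z ^^ i) x) = (rgt z ^^ ?k) (past z x)"
        using N(1)[OF i(1)] e by (metis comp_apply funpow_add)
      have "(z ^^ m) ((inv' z ^^ i) x) = (z ^^ ?k) ((z ^^ i) ((inv' z ^^ i) x))"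
        using e by (metis comp_apply funpow_add)
      also have "(z ^^ i) ((inv' z ^^ i) x) = x"
        using zp_cancel(2)[OF b, of "int i" x] by (simp add: zp_int zp_minus_int)
      finally have 2: "(z ^^ m) ((inv' z ^^ i) x) = (z ^^ ?k) x" .
      have "(rgt z ^^ ?k) ((rgt (inv' z) ^^ ?k) ((z ^^ ?k) x)) = (z ^^ ?k) x"
        using pt_inv_simps(4)[OF pt_funpow[OF assms(1), of ?k], of "(z ^^ ?k) x"]
          rgt_funpow[OF assms(1)] rgt_funpow[OF pt_inv[OF assms(1)]] by (metis inv_fn b)
      then have 3: "(z ^^ ?k) x = (rgt z ^^ ?k) (past (inv' z) x)" using N(2)[of ?k] i by simp
      have "(rgt z ^^ ?k) (past z x) \<noteq> (rgt z ^^ ?k) (past (inv' z) x)"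
        using x(3) rgt_eq_iff[OF pt_funpow[OF assms(1), of ?k]] rgt_funpow[OF assms(1)] by metis
      then show "(inv' z ^^ i) x \<in> disc (z ^^ m)"
        using 1 2 3 by (simp add: disc_def rgt_funpow[OF assms(1)])
    qed
    then have sub: "(\<lambda>i. (inv' z ^^ i) x) ` {N..m - N} \<subseteq> disc (z ^^ m) \<inter> W" if "m \<ge> 2 * N"
      using that by force
    have inj: "inj (\<lambda>i. (inv' z ^^ i) x)"
    proof (rule injI)
      fix i j assume "(inv' z ^^ i) x = (inv' z ^^ j) x"
      then have "zp z (- int i) x = zp z (- int j) x" by (simp add: zp_minus_int)
      from zp_inj_aper[OF b x(1) this] show "i = j" by simp
    qed
    show ?thesis
    proof (cases "m \<ge> 2 * N")
      case True
      have "card {N..m - N} = card ((\<lambda>i. (inv' z ^^ i) x) ` {N..m - N})"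
        by (rule card_image[symmetric]) (use inj in \<open>auto simp: inj_on_def\<close>)
      also have "\<dots> \<le> card (disc (z ^^ m) \<inter> W)"
        by (rule card_mono[OF _ sub[OF True]]) (use pt_disc(1)[OF pt_funpow[OF assms(1)]] in simp)
      finally show ?thesis by simp
    qed simp
  qed
  then show ?thesis by blast
qed

section \<open>Rational coordinates and flux\<close>

lemma common_denominator:
  "finite (Q :: rat set) \<Longrightarrow> \<exists>N::int. N > 0 \<and> (\<forall>q\<in>Q. \<exists>k::int. of_int N * q = of_int k)"
proof (induction Q rule: finite_induct)
  case (insert q Q)
  then obtain N :: int where N: "N > 0" "\<And>q. q \<in> Q \<Longrightarrow> \<exists>k::int. of_int N * q = of_int k" by blast
  obtain a b :: int where ab: "b > 0" "q = of_int a / of_int b"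
    by (cases q) (auto simp: Fract_of_int_quotient)
  have "\<exists>k::int. of_int (N * b) * p = of_int k" if p: "p \<in> insert q Q" for p
  proof (cases "p = q")
    case True
    then show ?thesis using ab by (intro exI[of _ "N * a"]) simp
  next
    case False
    then obtain k :: int where "of_int N * p = of_int k" using N(2)[of p] p by blast
    then show ?thesis by (intro exI[of _ "b * k"]) (simp add: algebra_simps)
  qed
  then show ?case using N(1) ab(1) by (intro exI[of _ "N * b"]) simp
qed (auto intro: exI[of _ 1])

text \<open>\<open>\<Psi>\<close> consists of the coordinates for a rational basis \<open>B\<close>
  of the span of \<open>D\<close>, and \<open>\<Lambda>\<close> of the vectors whose coordinates
  have one fixed denominator. Bounded coordinates then leave finitely many choices.\<close>

lemma rational_coordinates:
  assumes "finite (D :: real set)"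
  shows "\<exists>(\<Psi> :: (real \<Rightarrow> real) set) \<Lambda>. finite \<Psi> \<and> (\<forall>\<psi>\<in>\<Psi>. \<forall>x y. \<psi> (x + y) = \<psi> x + \<psi> y) \<and>
    D \<subseteq> \<Lambda> \<and> 0 \<in> \<Lambda> \<and> (\<forall>u\<in>\<Lambda>. \<forall>v\<in>\<Lambda>. u + v \<in> \<Lambda>) \<and>
    (\<forall>C. finite {v \<in> \<Lambda>. \<forall>\<psi>\<in>\<Psi>. \<bar>\<psi> v\<bar> \<le> (C \<psi> :: real)})"
proof -
  interpret rat: vector_space "\<lambda>(q::rat) (x::real). of_rat q * x"
    by standard (auto simp: algebra_simps of_rat_add of_rat_mult)
  obtain B where B: "B \<subseteq> D" "rat.independent B" "D \<subseteq> rat.span B"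
    using rat.maximal_independent_subset by blast
  have finB: "finite B" using B(1) assms by (rule finite_subset)
  \<comment> \<open>The basis is completed so that the coordinates are additive on all reals, in
    particular on displacements outside \<open>\<Lambda>\<close>.\<close>
  define E where "E = rat.extend_basis B"
  have E: "rat.independent E" "rat.span E = UNIV" "B \<subseteq> E"
    unfolding E_def using rat.independent_extend_basis[OF B(2)] rat.span_extend_basis[OF B(2)]
      rat.extend_basis_superset[OF B(2)] by auto
  define r where "r = rat.representation E"
  have r_add: "r (u + v) b = r u b + r v b" for u v b
    unfolding r_def by (subst rat.representation_add) (use E in auto)
  have r_0: "r 0 b = 0" for b using r_add[of 0 0 b] by simp
  have expand: "(\<Sum>b\<in>B. of_rat (r v b) * b) = v" if "v \<in> rat.span B" for v
    unfolding r_def rat.representation_extend[OF E(1) that E(3)]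
    by (rule rat.sum_representation_eq[OF B(2) that finB]) simp
  obtain N :: int where N: "N > 0" "\<And>q. q \<in> (\<lambda>(d, b). r d b) ` (D \<times> B) \<Longrightarrow> \<exists>k::int. of_int N * q = of_int k"
    using common_denominator[of "(\<lambda>(d, b). r d b) ` (D \<times> B)"] assms finB by blast
  define \<Lambda> where "\<Lambda> = {v \<in> rat.span B. \<forall>b\<in>B. \<exists>k::int. of_int N * r v b = of_int k}"
  define \<psi> where "\<psi> b v = (of_rat (r v b) :: real)" for b v
  have fin: "finite {v \<in> \<Lambda>. \<forall>f\<in>\<psi> ` B. \<bar>f v\<bar> \<le> C f}" for C
  proof -
    define Q where "Q b = {q. (\<exists>k::int. of_int N * q = of_int k) \<and> \<bar>of_rat q :: real\<bar> \<le> C (\<psi> b)}" for b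
    have "finite (Q b)" for b
    proof (rule finite_subset)
      let ?K = "\<lceil>of_int N * C (\<psi> b)\<rceil>"
      show "finite ((\<lambda>k::int. of_int k / of_int N :: rat) ` {- ?K..?K})" by simp
      show "Q b \<subseteq> (\<lambda>k::int. of_int k / of_int N) ` {- ?K..?K}"
      proof
        fix q assume "q \<in> Q b"
        then obtain k :: int where k: "of_int N * q = of_int k" "\<bar>of_rat q :: real\<bar> \<le> C (\<psi> b)"
          by (auto simp: Q_def)
        have "of_rat (of_int N * q) = (of_int k :: real)" using k(1) by simp
        then have e: "of_int N * of_rat q = (of_int k :: real)" by (simp add: of_rat_mult)
        have "\<bar>of_int N * of_rat q :: real\<bar> \<le> of_int N * C (\<psi> b)"
          using N(1) k(2) by (simp add: abs_mult)
        then have "\<bar>real_of_int k\<bar> \<le> of_int N * C (\<psi> b)" using e by simp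
        then have "k \<in> {- ?K..?K}" by (simp add: le_ceiling_iff minus_le_iff) linarith
        moreover have "q = of_int k / of_int N" using k(1) N(1) by (simp add: field_simps)
        ultimately show "q \<in> (\<lambda>k::int. of_int k / of_int N) ` {- ?K..?K}" by blast
      qed
    qed
    then have "finite (PiE B Q)" by (intro finite_PiE finB)
    moreover have "{v \<in> \<Lambda>. \<forall>f\<in>\<psi> ` B. \<bar>f v\<bar> \<le> C f} \<subseteq> (\<lambda>f. \<Sum>b\<in>B. of_rat (f b) * b) ` PiE B Q"
    proof
      fix v assume v: "v \<in> {v \<in> \<Lambda>. \<forall>f\<in>\<psi> ` B. \<bar>f v\<bar> \<le> C f}"
      then have "v \<in> rat.span B" by (simp add: \<Lambda>_def)
      from expand[OF this] have "v = (\<Sum>b\<in>B. of_rat (restrict (r v) B b) * b)" by simp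
      moreover have "restrict (r v) B \<in> PiE B Q" using v by (auto simp: Q_def \<Lambda>_def \<psi>_def)
      ultimately show "v \<in> (\<lambda>f. \<Sum>b\<in>B. of_rat (f b) * b) ` PiE B Q" by blast
    qed
    ultimately show ?thesis by (meson finite_imageI finite_subset)
  qed
  have "finite (\<psi> ` B)" using finB by simp
  moreover have "\<forall>f\<in>\<psi> ` B. \<forall>x y. f (x + y) = f x + f y"
    by (auto simp: \<psi>_def r_add of_rat_add)
  moreover have "D \<subseteq> \<Lambda>" unfolding \<Lambda>_def using B(3) N(2) by force
  moreover have "0 \<in> \<Lambda>" by (auto simp: \<Lambda>_def r_0 rat.span_zero intro: exI[of _ 0])
  moreover have "\<forall>u\<in>\<Lambda>. \<forall>v\<in>\<Lambda>. u + v \<in> \<Lambda>"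
  proof safe
    fix u v assume uv: "u \<in> \<Lambda>" "v \<in> \<Lambda>"
    have "\<exists>k::int. of_int N * r (u + v) b = of_int k" if b: "b \<in> B" for b
    proof -
      have "\<exists>i::int. of_int N * r u b = of_int i" "\<exists>j::int. of_int N * r v b = of_int j"
        using uv b by (auto simp: \<Lambda>_def)
      then obtain i j :: int where "of_int N * r u b = of_int i" "of_int N * r v b = of_int j"
        by blast
      then show ?thesis by (intro exI[of _ "i + j"]) (simp add: r_add distrib_left)
    qed
    then show "u + v \<in> \<Lambda>" using uv by (simp add: \<Lambda>_def rat.span_add)
  qed
  ultimately show ?thesis using fin by (intro exI[of _ "\<psi> ` B"] exI[of _ \<Lambda>]) blast
qed

section \<open>Invariance of Lebesgue measure, and the flux homomorphism\<close>

lemma integrable_lstep: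
  fixes f :: "real \<Rightarrow> real"
  assumes "lstep f S" "finite S" "\<And>x. x \<notin> {a..b} \<Longrightarrow> f x = 0"
  shows "integrable lborel f"
proof -
  have "finite (range f)" by (rule lstep_range(1)[OF assms(2,1)])
  then have "bounded (range f)" by (rule finite_imp_bounded)
  then obtain C where C: "\<And>x. norm (f x) \<le> C" by (auto simp: bounded_iff)
  show ?thesis
    by (rule integrableI_bounded_set[where A="{a..b}" and B=C])
      (use C assms(3) lstep_borel_measurable[OF assms(1,2)] in \<open>auto simp: emeasure_lborel_Icc_eq\<close>)
qed

text \<open>The finitely many displacements cut the line into pieces on which l is a translation.
  Translation invariance applies to each piece, and the images of the pieces partition the line
  again because l is bijective.\<close>

lemma integral_pt:
  fixes h :: "real \<Rightarrow> real"
  assumes "pt l" "integrable lborel h"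
  shows "(\<integral>x. h (l x) \<partial>lborel) = (\<integral>x. h x \<partial>lborel)"
proof -
  define C where "C = range (\<lambda>x. l x - x)"
  have finC: "finite C" unfolding C_def by (rule lstep_range(1)[OF pt_disc[OF assms(1)]])
  define P where "P c = {x. l x - x = c}" for c
  have Pb: "P c \<in> sets borel" for c
    unfolding P_def by (rule elem_borel[OF elem_level[OF pt_disc(2,1)[OF assms(1)]]])
  define k where "k c y = indicator (P c) (y - c) * h y" for c y
  have ki: "integrable lborel (k c)" for c
  proof -
    have [measurable]: "P c \<in> sets borel" by (rule Pb)
    have "integrable lborel (\<lambda>y. indicator {y. y - c \<in> P c} y *\<^sub>R h y)"
      by (rule integrable_mult_indicator[OF _ assms(2)]) measurable
    then show ?thesis unfolding k_def by (simp add: indicator_def of_bool_def)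
  qed
  have ki': "integrable lborel (\<lambda>x. k c (c + x))" for c
    using lborel_integrable_real_affine[OF ki[of c], of 1 c] by simp
  have split: "h (l x) = (\<Sum>c\<in>C. k c (c + x))" for x
  proof -
    have "(\<Sum>c\<in>C. k c (c + x)) = (\<Sum>c\<in>C. if c = l x - x then h (l x) else 0)"
      by (rule sum.cong) (auto simp: k_def P_def indicator_def)
    also have "\<dots> = h (l x)" using finC by (simp add: C_def)
    finally show ?thesis ..
  qed
  have join: "(\<Sum>c\<in>C. k c y) = h y" for y
  proof -
    have "indicator (P c) (y - c) = (if c = y - inv' l y then 1 else 0::real)" for c
    proof -
      have "y - c \<in> P c \<longleftrightarrow> l (y - c) = l (inv' l y)"
        by (simp add: P_def pt_inv_simps(2)[OF assms(1)])
      also have "\<dots> \<longleftrightarrow> c = y - inv' l y" using pt_eq_iff[OF assms(1)] by auto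
      finally show ?thesis by (simp add: indicator_def)
    qed
    then have "(\<Sum>c\<in>C. k c y) = (\<Sum>c\<in>C. if c = y - inv' l y then h y else 0)"
      by (intro sum.cong) (auto simp: k_def)
    also have "y - inv' l y \<in> C"
      unfolding C_def by (rule range_eqI[of _ _ "inv' l y"]) (simp add: pt_inv_simps(2)[OF assms(1)])
    then have "(\<Sum>c\<in>C. if c = y - inv' l y then h y else 0) = h y" using finC by simp
    finally show ?thesis .
  qed
  have "(\<integral>x. h (l x) \<partial>lborel) = (\<Sum>c\<in>C. \<integral>x. k c (c + x) \<partial>lborel)"
    unfolding split by (rule Bochner_Integration.integral_sum) (rule ki')
  also have "\<dots> = (\<Sum>c\<in>C. \<integral>y. k c y \<partial>lborel)"
    using lborel_integral_real_affine[of 1 "k _"] by (intro sum.cong) auto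
  also have "\<dots> = (\<integral>y. (\<Sum>c\<in>C. k c y) \<partial>lborel)"
    by (rule Bochner_Integration.integral_sum[symmetric]) (rule ki)
  finally show ?thesis unfolding join .
qed

lemma integrable_indicator_elem:
  assumes "elem W" "W \<subseteq> {a..b}" shows "integrable lborel (indicator W :: real \<Rightarrow> real)"
proof (rule integrable_lstep)
  show "lstep (indicator W :: real \<Rightarrow> real) (bdry W)"
    using lstep_map[OF elem_bdry(2)[OF assms(1)], of "\<lambda>b. if b then 1 else 0::real"]
    by (simp add: indicator_def[abs_def] of_bool_def)
  show "finite (bdry W)" by (rule elem_bdry(1)[OF assms(1)])
  show "\<And>x. x \<notin> {a..b} \<Longrightarrow> indicator W x = (0::real)" using assms(2) by (auto simp: indicator_def)
qed

lemma measure_pt_image: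
  assumes "pt l" "elem W" "l ` W \<subseteq> {a..b}"
  shows "measure lborel (l ` W) = measure lborel W"
proof -
  have e: "elem (l ` W)" by (rule elem_image[OF assms(1,2)])
  have "measure lborel (l ` W) = (\<integral>x. indicator (l ` W) x \<partial>lborel)"
    using elem_borel[OF e] by simp
  also have "\<dots> = (\<integral>x. indicator (l ` W) (l x) \<partial>lborel)"
    by (rule integral_pt[OF assms(1) integrable_indicator_elem[OF e assms(3)], symmetric])
  also have "(\<lambda>x. indicator (l ` W) (l x) :: real) = indicator W"
    using pt_eq_iff[OF assms(1)] by (auto simp: indicator_def fun_eq_iff)
  finally show ?thesis using elem_borel[OF assms(2)] by simp
qed

lemma measure_elem_pos:
  assumes "elem W" "x \<in> W" "W \<subseteq> {a..b}" shows "measure lborel W > 0"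
proof -
  have "\<forall>\<^sub>F y in at_left x. y \<in> W" using elem_left[OF assms(1), of x] assms(2) by simp
  then obtain c where c: "c < x" "\<And>y. c < y \<Longrightarrow> y < x \<Longrightarrow> y \<in> W" by (auto simp: eventually_at_left_field)
  have "emeasure lborel W \<le> emeasure lborel {a..b}" by (rule emeasure_mono[OF assms(3)]) simp
  also have "\<dots> < \<infinity>" by (simp add: emeasure_lborel_Icc_eq)
  finally have fin: "emeasure lborel W < \<infinity>" .
  have "0 < measure lborel {c<..<x}" using c(1) by simp
  also have "\<dots> \<le> measure lborel W"
    unfolding measure_def
    by (intro enn2real_mono emeasure_mono) (use c(2) elem_borel[OF assms(1)] fin in auto)
  finally show ?thesis .
qed

text \<open>For additive \<psi> and W invariant under g, this is the image of the Sah-Arnoux-Fathi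
  invariant of g on W, the sum of length \<otimes> translation over the pieces, under pairing the
  second factor with \<psi>.\<close>

definition flux :: "real set \<Rightarrow> (real \<Rightarrow> real) \<Rightarrow> (real \<Rightarrow> real) \<Rightarrow> real" where
  "flux W \<psi> g = (\<integral>x. (if x \<in> W then \<psi> (g x - x) else 0) \<partial>lborel)"

lemma flux_lstep:
  assumes "elem W" "pt g"
  shows "lstep (\<lambda>x. if x \<in> W then \<psi> (g x - x) else 0 :: real) (bdry W \<union> (disc g \<inter> W))"
  unfolding lstep_def
proof (intro conjI allI impI)
  fix x
  have "\<forall>\<^sub>F y in at_left x. g y - y = g x - x" by (rule lstep_left[OF pt_disc(2)[OF assms(2)]])
  with elem_left[OF assms(1), of x]
  show "\<forall>\<^sub>F y in at_left x. (if y \<in> W then \<psi> (g y - y) else 0) = (if x \<in> W then \<psi> (g x - x) else 0)"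
    by eventually_elim simp
  assume x: "x \<notin> bdry W \<union> (disc g \<inter> W)"
  then have e: "\<forall>\<^sub>F y in at_right x. y \<in> W \<longleftrightarrow> x \<in> W" by (auto simp: bdry_def)
  show "\<forall>\<^sub>F y in at_right x. (if y \<in> W then \<psi> (g y - y) else 0) = (if x \<in> W then \<psi> (g x - x) else 0)"
  proof (cases "x \<in> W")
    case True
    then have "\<forall>\<^sub>F y in at_right x. g y - y = g x - x"
      using x lstep_right[OF pt_disc(2)[OF assms(2)]] by blast
    with e show ?thesis by eventually_elim simp
  next
    case False
    from e show ?thesis by eventually_elim (use False in simp)
  qed
qed

lemma flux_integrable:
  assumes "elem W" "W \<subseteq> {a..b}" "pt g"
  shows "integrable lborel (\<lambda>x. if x \<in> W then \<psi> (g x - x) else 0 :: real)"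
  by (rule integrable_lstep[OF flux_lstep[OF assms(1,3)]])
    (use assms elem_bdry(1) pt_disc(1) in auto)

text \<open>Displacements add along the orbit: the one of the composition at x is that of g at h x
  plus that of h at x. Invariance of the integral removes the inner h, for which h must preserve
  W.\<close>

lemma flux_comp:
  assumes "\<And>x y. \<psi> (x + y) = \<psi> x + \<psi> y" "elem W" "W \<subseteq> {a..b}" "pt g" "pt h" "h ` W = W"
  shows "flux W \<psi> (g \<circ> h) = flux W \<psi> g + flux W \<psi> h"
proof -
  let ?G = "\<lambda>x. if x \<in> W then \<psi> (g x - x) else 0"
  let ?H = "\<lambda>x. if x \<in> W then \<psi> (h x - x) else 0"
  have e: "(if x \<in> W then \<psi> ((g \<circ> h) x - x) else 0) = ?G (h x) + ?H x" for x
    using assms(1)[of "g (h x) - h x" "h x - x"] image_eq_mem[OF pt_bij[OF assms(5)] assms(6)] by simp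
  have "integrable lborel (\<lambda>x. ?G (h x) + ?H x)"
    using flux_integrable[OF assms(2,3) pt_comp[OF assms(4,5)], of \<psi>] unfolding e .
  from Bochner_Integration.integrable_diff[OF this flux_integrable[OF assms(2,3,5), of \<psi>]]
  have "integrable lborel (\<lambda>x. ?G (h x))" by simp
  then have "flux W \<psi> (g \<circ> h) = (\<integral>x. ?G (h x) \<partial>lborel) + (\<integral>x. ?H x \<partial>lborel)"
    unfolding flux_def e by (rule Bochner_Integration.integral_add[OF _ flux_integrable[OF assms(2,3,5)]])
  also have "(\<integral>x. ?G (h x) \<partial>lborel) = (\<integral>x. ?G x \<partial>lborel)"
    by (rule integral_pt[OF assms(5) flux_integrable[OF assms(2-4)]])
  finally show ?thesis by (simp add: flux_def o_def)
qed

lemma flux_id: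
  assumes "\<And>x y. \<psi> (x + y) = \<psi> x + \<psi> y" shows "flux W \<psi> id = 0"
proof -
  have "(\<lambda>x. if x \<in> W then \<psi> (id x - x) else 0) = (\<lambda>_. 0)" using assms[of 0 0] by auto
  then show ?thesis by (simp add: flux_def)
qed

lemma flux_funpow_0:
  assumes "\<And>x y. \<psi> (x + y) = \<psi> x + \<psi> y" "elem W" "W \<subseteq> {a..b}" "pt z" "z ` W = W" "flux W \<psi> z = 0"
  shows "flux W \<psi> (z ^^ m) = 0"
proof (induction m)
  case 0
  then show ?case using flux_id[OF assms(1), of W] by (simp add: id_def)
next
  case (Suc m)
  have "flux W \<psi> ((z ^^ m) \<circ> z) = 0"
    using flux_comp[OF assms(1-3) pt_funpow[OF assms(4)] assms(4,5), of m] Suc assms(6) by simp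
  then show ?case by (simp only: funpow_Suc_right)
qed

lemma image_eqI_iff:
  assumes "bij f" "\<And>x. f x \<in> V \<longleftrightarrow> x \<in> V" shows "f ` V = V"
proof (intro equalityI subsetI)
  fix y assume "y \<in> V"
  then have "inv' f y \<in> V" using assms(2)[of "inv' f y"] unfolding bij_cancel(1)[OF assms(1)] by simp
  then have "f (inv' f y) \<in> f ` V" by (rule imageI)
  then show "y \<in> f ` V" unfolding bij_cancel(1)[OF assms(1)] .
qed (use assms(2) in auto)

lemma image_inv_eq: "bij f \<Longrightarrow> f ` V = V \<Longrightarrow> inv' f ` V = V"
  by (metis bij_def image_inv_f_f)

lemma flux_commutator:
  assumes "\<And>x y. \<psi> (x + y) = \<psi> x + \<psi> y" "elem W" "W \<subseteq> {a..b}" "pt g" "pt h" "g ` W = W" "h ` W = W"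
  shows "flux W \<psi> (g \<circ> h \<circ> inv' g \<circ> inv' h) = 0"
proof -
  note ig = pt_inv[OF assms(4)] and ih = pt_inv[OF assms(5)]
  note f = flux_comp[OF assms(1-3)]
  note Wg = image_inv_eq[OF pt_bij[OF assms(4)] assms(6)] and Wh = image_inv_eq[OF pt_bij[OF assms(5)] assms(7)]
  have "flux W \<psi> (g \<circ> inv' g) = 0" "flux W \<psi> (h \<circ> inv' h) = 0"
    using flux_id[OF assms(1)] by (simp_all add: pt_inv_simps assms(4,5))
  then have "flux W \<psi> g + flux W \<psi> (inv' g) = 0" "flux W \<psi> h + flux W \<psi> (inv' h) = 0"
    using f[OF assms(4) ig Wg] f[OF assms(5) ih Wh] by simp_all
  then show ?thesis
    using f[OF assms(4,5,7)] f[OF pt_comp[OF assms(4,5)] ig Wg]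
      f[OF pt_comp[OF pt_comp[OF assms(4,5)] ig] ih Wh] by simp
qed

text \<open>Otherwise each of the n windows from a + i * M (excluded) to a + (i + 1) * M (included)
  contains a point of V. Together with a itself these are n + 1 points.\<close>

lemma finite_set_gap:
  fixes V :: "real set" and M :: real
  assumes "finite V" "card V \<le> n" "a \<in> V" "b \<in> V" "b > a + n * M" "M > 0"
  shows "\<exists>t. a \<le> t \<and> t + M < b \<and> (\<forall>v\<in>V. v \<le> t \<or> v > t + M)"
proof (rule ccontr)
  assume no: "\<not> ?thesis"
  have "\<exists>v\<in>V. a + real i * M < v \<and> v \<le> a + real (Suc i) * M" if i: "i < n" for i
  proof (rule ccontr)
    assume "\<not> ?thesis"
    then have "\<forall>v\<in>V. v \<le> a + real i * M \<or> v > a + real i * M + M" by (auto simp: algebra_simps)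
    moreover have "a + real i * M + M < b"
    proof -
      have "real (Suc i) * M \<le> real n * M" using i assms(6) by (intro mult_right_mono) auto
      then show ?thesis using assms(5) by (simp add: algebra_simps)
    qed
    moreover have "a \<le> a + real i * M" using assms(6) by simp
    ultimately show False using no by blast
  qed
  then obtain f where f: "\<And>i. i < n \<Longrightarrow> f i \<in> V \<and> a + real i * M < f i \<and> f i \<le> a + real (Suc i) * M" by metis
  have lt: "f i < f j" if "i < j" "j < n" for i j
  proof -
    have "real (Suc i) * M \<le> real j * M" using that assms(6) by (intro mult_right_mono) auto
    then show ?thesis using f[of i] f[of j] that by linarith
  qed
  have "inj_on f {..<n}"
    by (rule inj_onI) (metis lt lessThan_iff less_irrefl linorder_neqE_nat)
  moreover have "a < f i" if "i < n" for i
  proof -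
    have "0 \<le> real i * M" using assms(6) by simp
    then show ?thesis using f[OF that] by linarith
  qed
  then have "a \<notin> f ` {..<n}" by force
  ultimately have "card (insert a (f ` {..<n})) = Suc n" by (simp add: card_image)
  moreover have "insert a (f ` {..<n}) \<subseteq> V" using f assms(3) by auto
  ultimately have "Suc n \<le> card V" using card_mono[OF assms(1), of "insert a (f ` {..<n})"] by simp
  then show False using assms(2) by simp
qed

text \<open>If z has no mismatch on W, its iterates have boundedly many discontinuities there, so the
  displacements of an iterate take boundedly many values on W. As b moves the displacement of a
  commuting iterate by a bounded amount, a large gap between values would cut off an invariant
  subset. With zero flux all displacements are therefore bounded, and orbits are finite.\<close>

lemma zero_flux_periodic:
  assumes "pt z" "elem W" "W \<subseteq> {lo..hi}" "W \<noteq> {}" "z ` W = W" "W \<subseteq> aper z" "W \<inter> mism z = {}"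
    and A: "finite A" "\<And>b. b \<in> A \<Longrightarrow> pt b \<and> b ` W = W \<and> (\<forall>x. b (z x) = z (b x))"
    and atom: "\<And>V. elem V \<Longrightarrow> V \<subseteq> W \<Longrightarrow> (\<And>b. b \<in> A \<Longrightarrow> b ` V = V) \<Longrightarrow> V = {} \<or> V = W"
    and fl: "\<And>\<psi>. (\<And>x y. \<psi> (x + y) = \<psi> x + \<psi> y) \<Longrightarrow> flux W \<psi> z = 0"
  shows False
proof -
  note bz = pt_bij[OF assms(1)]
  \<comment> \<open>Bounds the number of values on W of the displacement of any iterate: the jumps
    lie in \<open>bdry W\<close>, in \<open>pass z\<close> and in the preimage of
    \<open>pass z\<close>, and k jumps allow at most k + 1 values.\<close>
  define B where "B = card (bdry W) + 2 * card (pass z) + 1"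
  have bounded: "\<exists>C. \<forall>m. \<forall>x\<in>W. \<bar>\<psi> ((z ^^ m) x - x)\<bar> \<le> C"
    if add: "\<And>x y. \<psi> (x + y) = \<psi> x + \<psi> y" for \<psi> :: "real \<Rightarrow> real"
  proof -
    have diff: "\<psi> (x - y) = \<psi> x - \<psi> y" for x y using add[of "x - y" y] by simp
    have "finite (\<Union>b\<in>A. range (\<lambda>x. \<psi> (b x - x)))"
      using A by (intro finite_UN_I lstep_range(1)[OF pt_disc(1) lstep_map[OF pt_disc(2)]]) auto
    from finite_imp_bounded[OF this]
    obtain M0 where M0: "M0 > 0" "\<And>b x. b \<in> A \<Longrightarrow> \<bar>\<psi> (b x - x)\<bar> \<le> M0"
      unfolding bounded_pos by auto
    \<comment> \<open>Doubled because \<open>near\<close> compares the displacements of b at two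
      points.\<close>
    define M where "M = 2 * M0"
    have M: "M > 0" "\<And>b x y. b \<in> A \<Longrightarrow> \<bar>\<psi> (b x - x) - \<psi> (b y - y)\<bar> \<le> M"
    proof -
      fix b x y assume "b \<in> A"
      from M0(2)[OF this, of x] M0(2)[OF this, of y]
      show "\<bar>\<psi> (b x - x) - \<psi> (b y - y)\<bar> \<le> M" unfolding M_def by linarith
    qed (use M0(1) in \<open>simp add: M_def\<close>)
    have "\<bar>\<psi> ((z ^^ m) x - x)\<bar> \<le> B * M" if x: "x \<in> W" for m x
    proof -
      let ?g = "\<lambda>x. \<psi> ((z ^^ m) x - x)"
      let ?f = "\<lambda>x. if x \<in> W then ?g x else 0"
      let ?S = "bdry W \<union> (disc (z ^^ m) \<inter> W)"
      have ls: "lstep ?f ?S" by (rule flux_lstep[OF assms(2) pt_funpow[OF assms(1)]])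
      have finS: "finite ?S" using elem_bdry(1)[OF assms(2)] pt_disc(1)[OF pt_funpow[OF assms(1)]] by simp
      have cardS: "card ?S \<le> card (bdry W) + 2 * card (pass z)"
      proof -
        let ?T = "{x. (z ^^ m) x \<in> pass z}"
        have inj: "inj (z ^^ m)" using pt_bij[OF pt_funpow[OF assms(1)]] by (rule bij_is_inj)
        have fT: "finite ?T" using finite_vimageI[OF finite_pass[OF assms(1)] inj] by (simp add: vimage_def)
        have cT: "card ?T \<le> card (pass z)"
          by (rule card_inj_on_le[OF inj_on_subset[OF inj subset_UNIV] _ finite_pass[OF assms(1)]]) blast
        have "card (disc (z ^^ m) \<inter> W) \<le> card (pass z \<union> ?T)"
          by (rule card_mono[OF _ disc_funpow_no_mism[OF assms(1,5,6,7)]]) (use fT finite_pass[OF assms(1)] in simp)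
        also have "\<dots> \<le> card (pass z) + card ?T" by (rule card_Un_le)
        finally show ?thesis using cT card_Un_le[of "bdry W" "disc (z ^^ m) \<inter> W"] by linarith
      qed
      have V: "finite (?g ` W)" "card (?g ` W) \<le> B"
      proof -
        have sub: "?g ` W \<subseteq> range ?f"
        proof
          fix y assume "y \<in> ?g ` W"
          then obtain w where "w \<in> W" "y = ?g w" by blast
          then show "y \<in> range ?f" by (intro range_eqI[of _ _ w]) simp
        qed
        show "finite (?g ` W)" using sub lstep_range(1)[OF finS ls] by (rule finite_subset)
        have "card (?g ` W) \<le> card (range ?f)" by (rule card_mono[OF lstep_range(1)[OF finS ls] sub])
        then show "card (?g ` W) \<le> B" using lstep_range(2)[OF finS ls] cardS by (simp add: B_def)
      qed
      have spread: "?g v \<le> ?g u + B * M" if uv: "u \<in> W" "v \<in> W" for u v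
      proof (rule ccontr)
        assume "\<not> ?thesis"
        then obtain t where t: "?g u \<le> t" "t + M < ?g v" "\<And>w. w \<in> W \<Longrightarrow> ?g w \<le> t \<or> ?g w > t + M"
          using finite_set_gap[OF V, where a="?g u" and b="?g v" and M=M] uv M(1) by auto
        let ?L = "{w \<in> W. ?g w \<le> t}"
        have "elem ({w. ?f w \<le> t} \<inter> W)" by (rule elem_Int[OF elem_level[OF ls finS] assms(2)])
        also have "{w. ?f w \<le> t} \<inter> W = ?L" by auto
        finally have eL: "elem ?L" .
        have "b ` ?L = ?L" if b: "b \<in> A" for b
        proof -
          note Ab = A(2)[OF b]
          have bb: "bij b" using Ab pt_bij by blast
          have c: "b ((z ^^ m) w) = (z ^^ m) (b w)" for w
            using funpow_intertwine[of b z z m] Ab by metis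
          have near: "\<bar>?g (b w) - ?g w\<bar> \<le> M" for w
          proof -
            \<comment> \<open>The displacement from w to b (z^m w) is split along both sides of the
              commuting square.\<close>
            have "?g (b w) - ?g w = \<psi> (b ((z ^^ m) w) - (z ^^ m) w) - \<psi> (b w - w)"
              unfolding c diff by simp
            then show ?thesis using M(2)[OF b] by simp
          qed
          have mem: "b w \<in> W \<longleftrightarrow> w \<in> W" for w using image_eq_mem[OF bb] Ab by blast
          have iff: "b w \<in> ?L \<longleftrightarrow> w \<in> ?L" for w
          proof (cases "w \<in> W")
            case True
            then show ?thesis using t(3)[of w] t(3)[of "b w"] mem near[of w] by (auto; linarith)
          qed (use mem in auto)
          from image_eqI_iff[OF bb this] show ?thesis .
        qed
        from atom[OF eL _ this] have "?L = {} \<or> ?L = W" by blast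
        moreover have "u \<in> ?L" using t(1) uv by simp
        moreover have "v \<notin> ?L" using t(2) M(1) by simp
        ultimately show False using uv by blast
      qed
      \<comment> \<open>\<open>?g\<close> has mean zero on W, and by \<open>spread\<close> all its
        values lie within B * M of \<open>?g x\<close>. Integrating the two inequalities over W,
        which has positive measure, confines \<open>?g x\<close> itself.\<close>
      have int0: "(\<integral>y. ?f y \<partial>lborel) = 0"
        using flux_funpow_0[OF add assms(2,3,1,5) fl[OF add], of m] by (simp add: flux_def)
      have fi: "integrable lborel ?f" by (rule flux_integrable[OF assms(2,3) pt_funpow[OF assms(1)]])
      have ii: "integrable lborel (indicator W :: real \<Rightarrow> real)" by (rule integrable_indicator_elem[OF assms(2,3)])
      have Wm: "(\<integral>y. indicator W y * c \<partial>lborel) = c * measure lborel W" for c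
        using elem_borel[OF assms(2)] by simp
      have pos: "measure lborel W > 0" by (rule measure_elem_pos[OF assms(2) x assms(3)])
      have "(\<integral>y. indicator W y * (?g x - B * M) \<partial>lborel) \<le> (\<integral>y. ?f y \<partial>lborel)"
        by (rule integral_mono[OF _ fi]) (use ii spread[OF _ x] in \<open>auto simp: algebra_simps\<close>)
      then have "(?g x - B * M) * measure lborel W \<le> 0" unfolding Wm int0 .
      moreover have "(\<integral>y. ?f y \<partial>lborel) \<le> (\<integral>y. indicator W y * (?g x + B * M) \<partial>lborel)"
        by (rule integral_mono[OF fi]) (use ii spread[OF x] in \<open>auto simp: algebra_simps\<close>)
      then have "0 \<le> (?g x + B * M) * measure lborel W" unfolding Wm int0 .
      ultimately have "?g x - B * M \<le> 0" "0 \<le> ?g x + B * M"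
        using pos by (simp_all only: mult_le_0_iff zero_le_mult_iff) linarith+
      then show ?thesis by linarith
    qed
    then show ?thesis by blast
  qed
  \<comment> \<open>Displacements of iterates are sums of elements of \<open>?D\<close>, so they
    stay in \<open>\<Lambda>\<close>. Being bounded in every coordinate they are finite in number,
    which an infinite orbit rules out.\<close>
  let ?D = "range (\<lambda>x. z x - x)"
  have "finite ?D" by (rule lstep_range(1)[OF pt_disc[OF assms(1)]])
  from rational_coordinates[OF this] obtain \<Psi> :: "(real \<Rightarrow> real) set" and \<Lambda>
    where L0: "(\<forall>\<psi>\<in>\<Psi>. \<forall>x y. \<psi> (x + y) = \<psi> x + \<psi> y) \<and> ?D \<subseteq> \<Lambda> \<and> 0 \<in> \<Lambda> \<and>
      (\<forall>u\<in>\<Lambda>. \<forall>v\<in>\<Lambda>. u + v \<in> \<Lambda>) \<and> (\<forall>C. finite {v \<in> \<Lambda>. \<forall>\<psi>\<in>\<Psi>. \<bar>\<psi> v\<bar> \<le> C \<psi>})"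
    by (elim exE conjE) blast
  then have L: "\<And>\<psi>. \<psi> \<in> \<Psi> \<Longrightarrow> (\<forall>x y. \<psi> (x + y) = \<psi> x + \<psi> y)" "?D \<subseteq> \<Lambda>" "0 \<in> \<Lambda>"
    "\<And>u v. u \<in> \<Lambda> \<Longrightarrow> v \<in> \<Lambda> \<Longrightarrow> u + v \<in> \<Lambda>"
    "\<And>C. finite {v \<in> \<Lambda>. \<forall>\<psi>\<in>\<Psi>. \<bar>\<psi> v\<bar> \<le> C \<psi>}"
    by blast+
  obtain x where x: "x \<in> W" using assms(4) by blast
  have "\<exists>C. \<forall>m. \<bar>\<psi> ((z ^^ m) x - x)\<bar> \<le> C" if "\<psi> \<in> \<Psi>" for \<psi>
    using bounded[of \<psi>] L(1)[OF that] x by blast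
  then obtain C where C: "\<And>\<psi> m. \<psi> \<in> \<Psi> \<Longrightarrow> \<bar>\<psi> ((z ^^ m) x - x)\<bar> \<le> C \<psi>" by metis
  have "(z ^^ m) x - x \<in> \<Lambda>" for m
  proof (induction m)
    case (Suc m)
    have "z ((z ^^ m) x) - (z ^^ m) x \<in> \<Lambda>" using L(2) by blast
    from L(4)[OF this Suc] show ?case by simp
  qed (use L(3) in simp)
  then have "range (\<lambda>m. (z ^^ m) x - x) \<subseteq> {v \<in> \<Lambda>. \<forall>\<psi>\<in>\<Psi>. \<bar>\<psi> v\<bar> \<le> C \<psi>}" using C by blast
  then have fin: "finite (range (\<lambda>m. (z ^^ m) x - x))" using L(5) by (rule finite_subset)
  have "inj (\<lambda>m. (z ^^ m) x - x)"
  proof (rule injI)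
    fix i j assume "(z ^^ i) x - x = (z ^^ j) x - x"
    then have "zp z (int i) x = zp z (int j) x" by (simp add: zp_int)
    with zp_inj_aper[OF bz _ this] x assms(6) show "i = j" by auto
  qed
  then show False using fin finite_imageD infinite_UNIV_nat by blast
qed

section \<open>Invariant atoms of a normal abelian subgroup\<close>

text \<open>The assumption G_disc replaces finite generation, as it passes to subgroups of finite index.\<close>

locale pt_group =
  fixes G :: "(real \<Rightarrow> real) set" and T :: real and \<Sigma> :: "real set"
  assumes G_pt: "g \<in> G \<Longrightarrow> pt g"
    and G_id: "id \<in> G"
    and G_comp: "g \<in> G \<Longrightarrow> h \<in> G \<Longrightarrow> g \<circ> h \<in> G"
    and G_inv: "g \<in> G \<Longrightarrow> inv' g \<in> G"
    and G_supp: "g \<in> G \<Longrightarrow> x \<notin> {0..T} \<Longrightarrow> g x = x"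
    and G_torsion_free: "g \<in> G \<Longrightarrow> k > 0 \<Longrightarrow> g ^^ k = id \<Longrightarrow> g = id"
    and finite_\<Sigma>: "finite \<Sigma>"
    and G_disc: "g \<in> G \<Longrightarrow> q \<in> disc g \<Longrightarrow> \<exists>h\<in>G. \<exists>s\<in>\<Sigma>. q = h s"

definition nsub :: "(real \<Rightarrow> real) set \<Rightarrow> (real \<Rightarrow> real) set \<Rightarrow> bool" where
  "nsub N G \<longleftrightarrow> N \<subseteq> G \<and> id \<in> N \<and> (\<forall>a\<in>N. \<forall>b\<in>N. a \<circ> b \<in> N) \<and> (\<forall>a\<in>N. inv' a \<in> N) \<and>
    (\<forall>g\<in>G. \<forall>a\<in>N. g \<circ> a \<circ> inv' g \<in> N)"

locale pt_group_normal = pt_group +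
  fixes A :: "(real \<Rightarrow> real) set"
  assumes A_nsub: "nsub A G" and A_comm: "a \<in> A \<Longrightarrow> b \<in> A \<Longrightarrow> a \<circ> b = b \<circ> a"
begin

lemma A_G: "a \<in> A \<Longrightarrow> a \<in> G" and A_id: "id \<in> A"
  and A_comp: "a \<in> A \<Longrightarrow> b \<in> A \<Longrightarrow> a \<circ> b \<in> A" and A_inv: "a \<in> A \<Longrightarrow> inv' a \<in> A"
  and A_conj: "g \<in> G \<Longrightarrow> a \<in> A \<Longrightarrow> g \<circ> a \<circ> inv' g \<in> A"
  using A_nsub by (auto simp: nsub_def)

lemma A_pt: "a \<in> A \<Longrightarrow> pt a" using A_G G_pt by blast

lemma G_bij: "g \<in> G \<Longrightarrow> bij g" using G_pt pt_bij by blast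

lemma A_bij: "a \<in> A \<Longrightarrow> bij a" using A_G G_bij by blast

lemma A_commD: "a \<in> A \<Longrightarrow> b \<in> A \<Longrightarrow> a (b x) = b (a x)"
  using A_comm by (metis comp_apply)

definition inv_elem :: "real set \<Rightarrow> bool" where
  "inv_elem V \<longleftrightarrow> elem V \<and> (\<forall>a\<in>A. a ` V = V)"

definition Xinf :: "real set" where "Xinf = (\<Union>a\<in>A. aper a)"

definition atom :: "real \<Rightarrow> real set" where
  "atom x = \<Inter>{V. inv_elem V \<and> x \<in> V}"

definition atoms :: "real set set" where "atoms = atom ` Xinf"

lemma inv_elem_mem: "inv_elem V \<Longrightarrow> a \<in> A \<Longrightarrow> a x \<in> V \<longleftrightarrow> x \<in> V"
  using image_eq_mem[OF A_bij] by (auto simp: inv_elem_def)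

lemma inv_elemI: "elem V \<Longrightarrow> (\<And>a x. a \<in> A \<Longrightarrow> a x \<in> V \<longleftrightarrow> x \<in> V) \<Longrightarrow> inv_elem V"
  using image_eqI_iff[OF A_bij] by (auto simp: inv_elem_def)

lemma inv_elem_aper: assumes "a \<in> A" shows "inv_elem (aper a)"
proof (rule inv_elemI[OF elem_aper[OF A_pt[OF assms]]])
  fix b x assume b: "b \<in> A"
  show "b x \<in> aper a \<longleftrightarrow> x \<in> aper a"
    by (rule aper_intertwine[where b=b and z=a and z'=a, OF A_bij[OF b]]) (rule A_commD[OF b assms])
qed

lemma inv_elem_Int: "inv_elem V \<Longrightarrow> inv_elem W \<Longrightarrow> inv_elem (V \<inter> W)"
  by (rule inv_elemI) (auto simp: inv_elem_mem inv_elem_def[THEN iffD1, THEN conjunct1] elem_Int)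

lemma inv_elem_Diff: "inv_elem V \<Longrightarrow> inv_elem W \<Longrightarrow> inv_elem (V - W)"
  by (rule inv_elemI) (auto simp: inv_elem_mem inv_elem_def[THEN iffD1, THEN conjunct1] elem_Diff)

lemma atom_minimal: "inv_elem V \<Longrightarrow> x \<in> V \<Longrightarrow> atom x \<subseteq> V"
  by (auto simp: atom_def)

lemma mem_atom: "x \<in> atom x"
  by (auto simp: atom_def)

text \<open>The intersection may be restricted to sets inside a single \<open>aper a\<close>; by
  \<open>finite_invariant_sets\<close> there are finitely many, so \<open>elem\<close>
  survives.\<close>

lemma inv_elem_atom: assumes "x \<in> Xinf" shows "inv_elem (atom x)"
proof -
  obtain a where a: "a \<in> A" "x \<in> aper a" using assms by (auto simp: Xinf_def)
  let ?F = "{V. inv_elem V \<and> x \<in> V \<and> V \<subseteq> aper a}"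
  have fin: "finite ?F"
    by (rule finite_subset[OF _ finite_invariant_sets[OF A_pt[OF a(1)]]])
      (use a(1) in \<open>auto simp: inv_elem_def\<close>)
  have e: "atom x = \<Inter>?F"
  proof
    show "atom x \<subseteq> \<Inter>?F" by (auto simp: atom_def)
    show "\<Inter>?F \<subseteq> atom x"
    proof
      fix y assume y: "y \<in> \<Inter>?F"
      show "y \<in> atom x" unfolding atom_def
      proof safe
        fix V assume "inv_elem V" "x \<in> V"
        then have "V \<inter> aper a \<in> ?F" using inv_elem_Int inv_elem_aper a by auto
        then show "y \<in> V" using y by blast
      qed
    qed
  qed
  show ?thesis
  proof (rule inv_elemI)
    show "elem (atom x)" unfolding e by (rule elem_INT[OF fin]) (auto simp: inv_elem_def)
    show "b y \<in> atom x \<longleftrightarrow> y \<in> atom x" if "b \<in> A" for b y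
      unfolding e using inv_elem_mem[OF _ that] by blast
  qed
qed

lemma atom_aper: "x \<in> aper a \<Longrightarrow> a \<in> A \<Longrightarrow> atom x \<subseteq> aper a"
  by (rule atom_minimal[OF inv_elem_aper])

lemma atom_Xinf: "x \<in> Xinf \<Longrightarrow> y \<in> atom x \<Longrightarrow> y \<in> Xinf"
  using atom_aper by (auto simp: Xinf_def)

text \<open>If x were outside \<open>atom y\<close>, then \<open>atom x - atom y\<close> would be an
  invariant set around x smaller than \<open>atom x\<close>.\<close>

lemma atom_eq: assumes "x \<in> Xinf" "y \<in> atom x" shows "atom y = atom x"
proof
  have y: "y \<in> Xinf" by (rule atom_Xinf[OF assms])
  show "atom y \<subseteq> atom x" by (rule atom_minimal[OF inv_elem_atom[OF assms(1)] assms(2)])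
  have "x \<in> atom y"
  proof (rule ccontr)
    assume "x \<notin> atom y"
    then have "atom x \<subseteq> atom x - atom y"
      by (intro atom_minimal[OF inv_elem_Diff] inv_elem_atom assms(1) y) (use mem_atom in blast)
    then show False using assms(2) mem_atom[of y] by blast
  qed
  then show "atom x \<subseteq> atom y" by (rule atom_minimal[OF inv_elem_atom[OF y]])
qed

lemma atoms_eqI: "W \<in> atoms \<Longrightarrow> W' \<in> atoms \<Longrightarrow> x \<in> W \<Longrightarrow> x \<in> W' \<Longrightarrow> W = W'"
  unfolding atoms_def using atom_eq by blast

lemma atoms_inv_elem: "W \<in> atoms \<Longrightarrow> inv_elem W"
  and atoms_nonempty: "W \<in> atoms \<Longrightarrow> W \<noteq> {}"
  unfolding atoms_def using inv_elem_atom mem_atom by blast+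

lemma atoms_eq_atom: "W \<in> atoms \<Longrightarrow> x \<in> W \<Longrightarrow> W = atom x"
  unfolding atoms_def using atom_eq by blast

lemma atoms_minimal: "W \<in> atoms \<Longrightarrow> inv_elem V \<Longrightarrow> x \<in> V \<Longrightarrow> x \<in> W \<Longrightarrow> W \<subseteq> V"
  using atoms_eq_atom[of W x] atom_minimal[of V x] by simp

lemma atoms_elem: "W \<in> atoms \<Longrightarrow> elem W" and atoms_A: "W \<in> atoms \<Longrightarrow> a \<in> A \<Longrightarrow> a ` W = W"
  using atoms_inv_elem by (auto simp: inv_elem_def)

lemma aper_supp: assumes "g \<in> G" shows "aper g \<subseteq> {0..T}"
proof
  fix x assume "x \<in> aper g"
  then have "\<forall>k>0. (g ^^ k) x \<noteq> x" by (simp add: aper_def)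
  from this[rule_format, of 1] have "g x \<noteq> x" by simp
  then show "x \<in> {0..T}" using G_supp[OF assms, of x] by auto
qed

lemma atoms_aper: assumes "W \<in> atoms" obtains a where "a \<in> A" "W \<subseteq> aper a"
  using assms atom_aper by (auto simp: atoms_def Xinf_def)

lemma atoms_supp: "W \<in> atoms \<Longrightarrow> W \<subseteq> {0..T}"
  using atoms_aper aper_supp A_G by (metis order_trans)

lemma inv_elem_image: assumes "g \<in> G" "inv_elem V" shows "inv_elem (g ` V)"
proof (rule inv_elemI)
  show "elem (g ` V)" using elem_image[OF G_pt[OF assms(1)]] assms(2) by (simp add: inv_elem_def)
  fix a x assume a: "a \<in> A"
  note s = pt_inv_simps[OF G_pt[OF assms(1)]]
  have c: "inv' g \<circ> a \<circ> g \<in> A"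
    using A_conj[OF G_inv[OF assms(1)] a] inv_inv_eq[OF G_bij[OF assms(1)]] by simp
  have "inv' g (a x) = (inv' g \<circ> a \<circ> g) (inv' g x)" by (simp add: s)
  then show "a x \<in> g ` V \<longleftrightarrow> x \<in> g ` V"
    using inv_elem_mem[OF assms(2) c] by (simp add: pt_image[OF G_pt[OF assms(1)]])
qed

lemma G_Xinf: assumes "g \<in> G" "x \<in> Xinf" shows "g x \<in> Xinf"
proof -
  obtain a where a: "a \<in> A" "x \<in> aper a" using assms(2) by (auto simp: Xinf_def)
  have "g x \<in> aper (g \<circ> a \<circ> inv' g)"
    using aper_intertwine[where b=g and z=a and z'="g \<circ> a \<circ> inv' g", OF G_bij[OF assms(1)]] a(2)
    by (simp add: pt_inv_simps[OF G_pt[OF assms(1)]])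
  then show ?thesis using A_conj[OF assms(1) a(1)] by (auto simp: Xinf_def)
qed

lemma image_atom: assumes "g \<in> G" "x \<in> Xinf" shows "g ` atom x = atom (g x)"
proof
  note s = pt_inv_simps[OF G_pt[OF assms(1)]]
  show "atom (g x) \<subseteq> g ` atom x"
    by (rule atom_minimal[OF inv_elem_image[OF assms(1) inv_elem_atom[OF assms(2)]]]) (use mem_atom in blast)
  have "atom x \<subseteq> inv' g ` atom (g x)"
    by (rule atom_minimal[OF inv_elem_image[OF G_inv[OF assms(1)] inv_elem_atom[OF G_Xinf[OF assms]]]])
      (use mem_atom[of "g x"] s(1) in \<open>metis image_eqI\<close>)
  then show "g ` atom x \<subseteq> atom (g x)" using s(2) by force
qed

lemma image_atoms: "g \<in> G \<Longrightarrow> W \<in> atoms \<Longrightarrow> g ` W \<in> atoms"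
  using image_atom G_Xinf by (auto simp: atoms_def)

section \<open>Finiteness of the set of atoms\<close>

lemma elem_right_boundary:
  assumes "elem W" "x \<in> W" "W \<subseteq> {lo..hi}" shows "\<exists>p\<in>W. \<forall>\<^sub>F y in at_right p. y \<notin> W"
proof -
  let ?P = "bdry W"
  note P = elem_bdry[OF assms(1)]
  have "?P \<inter> {x..} \<noteq> {}"
  proof
    assume e: "?P \<inter> {x..} = {}"
    have "x \<le> hi + 1" using assms by force
    from lstep_const[OF P(2) this] have "hi + 1 \<in> W" using e assms(2) by fastforce
    then show False using assms(3) by force
  qed
  then have p: "rep ?P x \<in> ?P" using Min_in[of "?P \<inter> {x..}"] P(1) by (auto simp: rep_def)
  have "rep ?P x \<in> W" using lstep_rep[OF P, of x] assms(2) by simp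
  moreover have "\<not> (\<forall>\<^sub>F y in at_right (rep ?P x). y \<in> W)"
    using p \<open>rep ?P x \<in> W\<close> by (simp add: bdry_def)
  ultimately show ?thesis using elem_right[OF assms(1)] by blast
qed

text \<open>Some a in A moves a right boundary point of W, inside W, to a discontinuity q of a.
  \<open>G_disc\<close> writes q as \<open>h s\<close>, and \<open>inv' h\<close> then carries W
  onto the atom of s. In particular only finitely many measures of atoms occur.\<close>

lemma atom_translate_of_\<Sigma>:
  assumes "W \<in> atoms" shows "\<exists>s\<in>\<Sigma>. measure lborel W = measure lborel (atom s)"
proof -
  obtain a where a: "a \<in> A" "W \<subseteq> aper a" using atoms_aper[OF assms] .
  obtain x where x: "x \<in> W" using atoms_nonempty[OF assms] by blast
  obtain p where p: "p \<in> W" "\<forall>\<^sub>F y in at_right p. y \<notin> W"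
    using elem_right_boundary[OF atoms_elem[OF assms] x atoms_supp[OF assms]] by blast
  obtain n where n: "(a ^^ n) p \<in> disc a"
    using right_boundary_hits_disc[OF A_pt[OF a(1)] atoms_elem[OF assms] atoms_A[OF assms a(1)] a(2) p] ..
  let ?q = "(a ^^ n) p"
  have q: "?q \<in> W"
    using zp_invariant[OF A_bij[OF a(1)] atoms_A[OF assms a(1)], of "int n" p] p(1) by (simp add: zp_int)
  have qX: "?q \<in> Xinf" using q a by (auto simp: Xinf_def)
  have Wq: "W = atom ?q" using assms q by (auto simp: atoms_def dest: atom_eq)
  obtain h s where h: "h \<in> G" "s \<in> \<Sigma>" "?q = h s" using G_disc[OF A_G[OF a(1)] n] by blast
  have s: "inv' h ?q = s" using h(3) pt_inv_simps(1)[OF G_pt[OF h(1)]] by simp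
  have "inv' h ` W = atom s" unfolding Wq using image_atom[OF G_inv[OF h(1)] qX] s by simp
  moreover have "measure lborel (inv' h ` W) = measure lborel W"
    using atoms_supp[OF image_atoms[OF G_inv[OF h(1)] assms]]
    by (rule measure_pt_image[OF pt_inv[OF G_pt[OF h(1)]] atoms_elem[OF assms]])
  ultimately show ?thesis using h(2) by (intro bexI[of _ s]) simp_all
qed

text \<open>Atoms of one given measure are disjoint subsets of the interval from 0 to T, all of the
  same positive size; and finitely many measures occur.\<close>

lemma finite_atoms: "finite atoms"
proof -
  have "finite {W \<in> atoms. measure lborel W = m}" for m
  proof (rule ccontr)
    assume inf: "infinite {W \<in> atoms. measure lborel W = m}"
    then obtain W0 where W0: "W0 \<in> atoms" "measure lborel W0 = m" using not_finite_existsD by auto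
    obtain x where "x \<in> W0" using atoms_nonempty[OF W0(1)] by blast
    then have m: "m > 0" using measure_elem_pos[OF atoms_elem[OF W0(1)] _ atoms_supp[OF W0(1)]] W0(2) by blast
    obtain k :: nat where k: "real k * m > measure lborel {0..T}" using reals_Archimedean3[OF m] by blast
    obtain F where F: "F \<subseteq> {W \<in> atoms. measure lborel W = m}" "finite F" "card F = k"
      using infinite_arbitrarily_large[OF inf] by blast
    have "real k * m = (\<Sum>W\<in>F. measure lborel W)" using F by (simp add: subset_iff)
    also have "\<dots> = measure lborel (\<Union>W\<in>F. W)"
    proof (rule measure_finite_Union[symmetric, OF F(2)])
      show "(\<lambda>W. W) ` F \<subseteq> sets lborel" using F(1) atoms_elem elem_borel by auto
      show "disjoint_family_on (\<lambda>W. W) F"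
        unfolding disjoint_family_on_def using F(1) atoms_eqI by blast
      fix W assume "W \<in> F"
      then have "emeasure lborel W \<le> emeasure lborel {0..T}"
        using F(1) atoms_supp by (intro emeasure_mono) auto
      then show "emeasure lborel W \<noteq> \<infinity>" by (auto simp: emeasure_lborel_Icc_eq top_unique)
    qed
    also have "\<dots> \<le> measure lborel {0..T}"
    proof (rule measure_mono_fmeasurable)
      show "(\<Union>W\<in>F. W) \<subseteq> {0..T}" using F(1) atoms_supp by blast
      show "(\<Union>W\<in>F. W) \<in> sets lborel"
        by (rule sets.finite_UN[OF F(2)]) (use F(1) atoms_elem elem_borel in auto)
      show "{0..T} \<in> fmeasurable lborel" by (rule fmeasurableI) (simp_all add: emeasure_lborel_Icc_eq)
    qed
    finally show False using k by simp
  qed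
  moreover have "atoms \<subseteq> (\<Union>s\<in>\<Sigma>. {W \<in> atoms. measure lborel W = measure lborel (atom s)})"
    using atom_translate_of_\<Sigma> by blast
  ultimately show ?thesis using finite_\<Sigma> by (meson finite_UN finite_subset)
qed

text \<open>Because h commutes with A, its fixed points form an invariant set, and minimality of the
  atom makes this all or nothing.\<close>

lemma fixes_atom:
  assumes "pt h" "\<And>a x. a \<in> A \<Longrightarrow> h (a x) = a (h x)" "W \<in> atoms" "x \<in> W" "h x = x" "y \<in> W"
  shows "h y = y"
proof -
  have "inv_elem {y. h y = y}"
    by (rule inv_elemI[OF elem_fix[OF assms(1)]]) (simp add: assms(2) pt_eq_iff[OF A_pt])
  from atoms_minimal[OF assms(3) this _ assms(4)] show ?thesis using assms(5,6) by blast
qed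

text \<open>\<open>aper a\<close> contains the whole atom of each of its points, so it is empty
  here. \<open>uniform_period\<close> then turns a into a torsion element.\<close>

lemma trivial_if_periodic_on_atoms:
  assumes "a \<in> A" "\<And>W. W \<in> atoms \<Longrightarrow> \<exists>x\<in>W. \<exists>k>0. (a ^^ k) x = x" shows "a = id"
proof -
  have "aper a = {}"
  proof (rule ccontr)
    assume "aper a \<noteq> {}"
    then obtain x where x: "x \<in> aper a" by blast
    then have "atom x \<in> atoms" using assms(1) by (auto simp: atoms_def Xinf_def)
    from assms(2)[OF this] atom_aper[OF x assms(1)] show False by (auto simp: aper_def)
  qed
  then obtain K where "K > 0" "\<And>x. (a ^^ K) x = x" using uniform_period[OF A_pt[OF assms(1)]] by blast
  then show ?thesis using G_torsion_free[OF A_G[OF assms(1)], of K] by (auto simp: fun_eq_iff)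
qed

text \<open>\<open>zero_flux_periodic\<close> takes only finitely many commuting maps. On an
  aperiodic W there are finitely many z-invariant \<open>elem\<close> subsets, and one element of A
  for each of them that is not A-invariant is enough to keep W minimal.\<close>

lemma commutator_periodic_on_atom:
  assumes "W \<in> atoms" "g \<in> G" "h \<in> G" "g ` W = W" "h ` W = W"
    "z \<in> A" "z = g \<circ> h \<circ> inv' g \<circ> inv' h" "W \<inter> mism z = {}"
  shows "\<exists>x\<in>W. \<exists>k>0. (z ^^ k) x = x"
proof (rule ccontr)
  assume "\<not> ?thesis"
  then have Wz: "W \<subseteq> aper z" unfolding aper_def by blast
  let ?F = "{V. elem V \<and> z ` V = V \<and> V \<subseteq> W}"
  have finF: "finite ?F"
    by (rule finite_subset[OF _ finite_invariant_sets[OF A_pt[OF assms(6)]]]) (use Wz in auto)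
  define b where "b V = (SOME b. b \<in> A \<and> b ` V \<noteq> V)" for V
  have b: "b V \<in> A \<and> b V ` V \<noteq> V" if "elem V" "\<not> inv_elem V" for V
  proof -
    have "\<exists>b. b \<in> A \<and> b ` V \<noteq> V" using that by (simp add: inv_elem_def) blast
    from someI_ex[OF this] show ?thesis unfolding b_def .
  qed
  have finb: "finite (b ` {V \<in> ?F. \<not> inv_elem V})" by (rule finite_imageI, rule finite_subset[OF _ finF]) blast
  let ?A0 = "insert z (b ` {V \<in> ?F. \<not> inv_elem V})"
  show False
  proof (rule zero_flux_periodic[where A="?A0", OF A_pt[OF assms(6)] atoms_elem[OF assms(1)] atoms_supp[OF assms(1)]
        atoms_nonempty[OF assms(1)] atoms_A[OF assms(1,6)] Wz assms(8)])
    show "finite ?A0" using finb by simp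
    fix c assume "c \<in> ?A0"
    then have "c \<in> A" using b assms(6) by auto
    then show "pt c \<and> c ` W = W \<and> (\<forall>x. c (z x) = z (c x))"
      using A_pt atoms_A[OF assms(1)] A_commD assms(6) by auto
  next
    fix V assume V: "elem V" "V \<subseteq> W" and inv': "\<And>c. c \<in> ?A0 \<Longrightarrow> c ` V = V"
    have VF: "V \<in> ?F" using V inv'[of z] by auto
    have "inv_elem V"
    proof (rule ccontr)
      assume n: "\<not> inv_elem V"
      then have "b V \<in> ?A0" using VF by blast
      then show False using b[OF V(1) n] inv' by blast
    qed
    then show "V = {} \<or> V = W" using atoms_minimal[OF assms(1)] V(2) by blast
  next
    fix \<psi> :: "real \<Rightarrow> real" assume "\<And>x y. \<psi> (x + y) = \<psi> x + \<psi> y"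
    from flux_commutator[OF this atoms_elem[OF assms(1)] atoms_supp[OF assms(1)] G_pt[OF assms(2)] G_pt[OF assms(3)] assms(4,5)]
    show "flux W \<psi> z = 0" unfolding assms(7) .
  qed
qed

text \<open>A power of b agrees with a power of z at one mismatched point;
  \<open>fixes_atom\<close>, applied to z^(-n) b^k, spreads the agreement over the atom.\<close>

lemma power_on_mismatched_atom:
  assumes "W \<in> atoms" "z \<in> A" "x \<in> W \<inter> mism z" "pt b" "\<And>a y. a \<in> A \<Longrightarrow> b (a y) = a (b y)"
  shows "\<exists>k>0. \<exists>n. \<forall>y\<in>W. (b ^^ k) y = zp z n y"
proof -
  note bz = A_bij[OF assms(2)]
  obtain k n where k: "k > 0" "(b ^^ k) x = zp z n x"
    using mism_commuting_power[OF A_pt[OF assms(2)] assms(4) assms(5)[OF assms(2)], of x] assms(3) by blast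
  let ?h = "zp z (- n) \<circ> (b ^^ k)"
  have zA: "a (zp z m y) = zp z m (a y)" if "a \<in> A" for a m y
    by (rule zp_intertwine[OF bz bz]) (rule A_commD[OF that assms(2)])
  have bA: "(b ^^ k) (a y) = a ((b ^^ k) y)" if "a \<in> A" for a y
    using funpow_intertwine[of a b b k y] assms(5)[OF that] by metis
  have "?h y = y" if "y \<in> W" for y
  proof (rule fixes_atom[OF _ _ assms(1) _ _ that])
    show "pt ?h" by (intro pt_comp pt_zp pt_funpow A_pt assms)
    show "?h (a y) = a (?h y)" if "a \<in> A" for a y using zA[OF that] bA[OF that] by simp
    show "x \<in> W" using assms(3) by blast
    show "?h x = x" using k(2) zp_cancel[OF bz] by simp
  qed
  then have "(b ^^ k) y = zp z n y" if "y \<in> W" for y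
    using that zp_cancel(2)[OF bz, of n "(b ^^ k) y"] by simp
  then show ?thesis using k(1) by blast
qed

end

section \<open>The sign of a conjugation on a mismatched atom\<close>

lemma card_disc_comp:
  assumes "pt l" "pt m" "m ` W = W"
  shows "card (disc (l \<circ> m) \<inter> W) \<le> card (disc l \<inter> W) + card (disc m \<inter> W)"
proof -
  let ?T = "{x. m x \<in> disc l \<inter> W}"
  have inj: "inj m" using pt_bij[OF assms(2)] by (rule bij_is_inj)
  have fl: "finite (disc l \<inter> W)" "finite (disc m \<inter> W)" using pt_disc(1) assms by blast+
  have fT: "finite ?T" using finite_vimageI[OF fl(1) inj] by (simp add: vimage_def)
  have cT: "card ?T \<le> card (disc l \<inter> W)"
    by (rule card_inj_on_le[OF inj_on_subset[OF inj subset_UNIV] _ fl(1)]) blast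
  have "disc (l \<circ> m) \<inter> W \<subseteq> ?T \<union> (disc m \<inter> W)"
    using disc_comp[OF assms(1,2)] image_eq_mem[OF pt_bij[OF assms(2)] assms(3)] by auto
  then have "card (disc (l \<circ> m) \<inter> W) \<le> card (?T \<union> (disc m \<inter> W))"
    using fT fl by (intro card_mono) auto
  also have "\<dots> \<le> card ?T + card (disc m \<inter> W)" by (rule card_Un_le)
  finally show ?thesis using cT by simp
qed

lemma card_disc_inv:
  assumes "pt l" "l ` W = W" shows "card (disc (inv' l) \<inter> W) = card (disc l \<inter> W)"
proof -
  have inj: "inj l" using pt_bij[OF assms(1)] by (rule bij_is_inj)
  have "disc (inv' l) \<inter> W = l ` (disc l \<inter> W)"
    unfolding disc_inv[OF assms(1)] using image_Int[OF inj, of "disc l" W] assms(2) by simp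
  then show ?thesis using card_image[OF inj_on_subset[OF inj subset_UNIV]] by metis
qed

text \<open>Agreement on W determines the right germ at every point of W that has right neighbours
  in W, that is, off \<open>bdry W\<close>.\<close>

lemma card_disc_agree:
  assumes "pt l" "pt m" "elem W" "\<And>x. x \<in> W \<Longrightarrow> l x = m x"
  shows "card (disc l \<inter> W) \<le> card (disc m \<inter> W) + card (bdry W)"
proof -
  have "disc l \<inter> W \<subseteq> (disc m \<inter> W) \<union> bdry W"
  proof
    fix x assume x: "x \<in> disc l \<inter> W"
    show "x \<in> (disc m \<inter> W) \<union> bdry W"
    proof (cases "x \<in> bdry W")
      case False
      then have "\<forall>\<^sub>F y in at_right x. y \<in> W" using x by (auto simp: bdry_def)
      with pt_right[OF assms(2), of x] have "\<forall>\<^sub>F y in at_right x. l y = y + (rgt m x - x)"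
        by eventually_elim (simp add: assms(4))
      then have "rgt l x = rgt m x" by (rule rgt_eqI)
      then show ?thesis using x assms(4) by (auto simp: disc_def)
    qed simp
  qed
  then have "card (disc l \<inter> W) \<le> card ((disc m \<inter> W) \<union> bdry W)"
    using pt_disc(1)[OF assms(2)] elem_bdry(1)[OF assms(3)] by (intro card_mono) auto
  also have "\<dots> \<le> card (disc m \<inter> W) + card (bdry W)" by (rule card_Un_le)
  finally show ?thesis .
qed

text \<open>The growth of f is linear, but only pinched between slopes 1 and c, so a single
  comparison would give j \<le> c * k at best. Iterating it a times replaces j and k by their a-th
  powers at the additive cost a * C, and the factor c is negligible for large a.\<close>

lemma growth_compare:
  fixes f :: "nat \<Rightarrow> nat"
  assumes up: "\<And>m. f m \<le> m * c" and low: "\<And>m. m \<le> f m + D" and cmp: "\<And>m. f (j * m) \<le> f (k * m) + C"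
  shows "j \<le> k"
proof -
  have it: "f (j ^ a * m) \<le> f (k ^ a * m) + a * C" for a m
  proof (induction a arbitrary: m)
    case (Suc a)
    have "f (j ^ Suc a * m) = f (j ^ a * (j * m))" by (simp add: ac_simps)
    also have "\<dots> \<le> f (k ^ a * (j * m)) + a * C" by (rule Suc)
    also have "f (k ^ a * (j * m)) = f (j * (k ^ a * m))" by (simp add: ac_simps)
    also have "\<dots> \<le> f (k * (k ^ a * m)) + C" by (rule cmp)
    finally show ?case by (simp add: ac_simps)
  qed simp
  have pw: "j ^ a \<le> k ^ a * c" for a
  proof (rule ccontr)
    assume "\<not> ?thesis"
    then have lt: "k ^ a * c + 1 \<le> j ^ a" by simp
    \<comment> \<open>Chosen larger than the accumulated error a * C + D, which the excess of at
      least one unit per step must beat.\<close>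
    let ?m = "a * C + D + 1"
    have "j ^ a * ?m \<le> k ^ a * ?m * c + a * C + D"
      using low[of "j ^ a * ?m"] it[of a ?m] up[of "k ^ a * ?m"] by linarith
    moreover have "(k ^ a * c + 1) * ?m \<le> j ^ a * ?m" using lt by (rule mult_right_mono) simp
    ultimately show False by (simp add: algebra_simps)
  qed
  show ?thesis
  proof (rule ccontr)
    assume "\<not> j \<le> k"
    then have jk: "k < j" by simp
    show False
    proof (cases "k = 0")
      case True
      then show False using pw[of 1] jk by simp
    next
      case False
      then have "1 < real j / real k" using jk by simp
      then obtain a where "real c < (real j / real k) ^ a" using real_arch_pow by blast
      then have "real c * real k ^ a < real j ^ a" using False by (simp add: power_divide field_simps)
      moreover have "real (j ^ a) \<le> real (k ^ a * c)" using pw[of a] by (simp only: of_nat_le_iff)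
      ultimately show False by (simp add: mult.commute)
    qed
  qed
qed

lemma zp_nat_abs: "zp z (n :: int) = (if n \<ge> 0 then z ^^ nat \<bar>n\<bar> else inv' z ^^ nat \<bar>n\<bar>)"
  by (simp add: zp_def)

lemma funpow_mult_agree:
  assumes "bij z" "z ` W = W" "\<And>y. y \<in> W \<Longrightarrow> (a ^^ k) y = zp z n y" "y \<in> W"
  shows "(a ^^ (k * m)) y = zp z (n * int m) y"
proof (induction m)
  case (Suc m)
  have "zp z (n * int m) y \<in> W" using zp_invariant[OF assms(1,2)] assms(4) by blast
  then have "(a ^^ k) (zp z (n * int m) y) = zp z n (zp z (n * int m) y)" by (rule assms(3))
  moreover have "(a ^^ (k * Suc m)) y = (a ^^ k) ((a ^^ (k * m)) y)" by (simp add: funpow_add)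
  ultimately have "(a ^^ (k * Suc m)) y = zp z n (zp z (n * int m) y)" using Suc by simp
  also have "\<dots> = zp z (n + n * int m) y" by (rule zp_add[OF assms(1), symmetric])
  also have "n + n * int m = n * int (Suc m)" by (simp add: algebra_simps)
  finally show ?case .
qed simp

context pt_group_normal
begin

text \<open>The conjugate z' lies in A, so z'^k = z^n on W. Conjugation by g changes discontinuity
  counts on W by at most 2 * c; hence the counts of z^(k m) and z^(|n| m) differ by a bounded
  amount. The mismatch makes these counts grow linearly, and \<open>growth_compare\<close> used in
  both directions gives |n| = k.\<close>

lemma conj_sign:
  assumes W: "W \<in> atoms" and z: "z \<in> A" and x: "x \<in> W \<inter> mism z" and g: "g \<in> G" "g ` W = W"
  shows "\<exists>e\<in>{1,-1}. \<exists>k>0. \<forall>y\<in>W. g ((z ^^ k) y) = zp z (e * int k) (g y)"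
proof -
  let ?z' = "g \<circ> z \<circ> inv' g"
  note s = pt_inv_simps[OF G_pt[OF g(1)]]
  note ptz = A_pt[OF z] and bz = A_bij[OF z] and zW = atoms_A[OF W z]
  have z': "?z' \<in> A" by (rule A_conj[OF g(1) z])
  note ptz' = A_pt[OF z'] and bz' = A_bij[OF z']
  obtain k n where kn: "k > 0" "\<And>y. y \<in> W \<Longrightarrow> (?z' ^^ k) y = zp z n y"
    using power_on_mismatched_atom[OF W z x ptz' A_commD[OF z']] by metis
  have pow: "?z' ^^ m = g \<circ> (z ^^ m) \<circ> inv' g" for m
    by (induction m) (auto simp: s fun_eq_iff)
  have pow': "z ^^ m = inv' g \<circ> (?z' ^^ m) \<circ> g" for m
    unfolding pow by (auto simp: s fun_eq_iff)
  define f where "f m = card (disc (z ^^ m) \<inter> W)" for m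
  define c where "c = card (disc g \<inter> W)"
  define C where "C = 2 * c + card (bdry W)"
  let ?N = "nat \<bar>n\<bar>"
  have igW: "inv' g ` W = W" by (rule image_inv_eq[OF G_bij[OF g(1)] g(2)])
  have ci: "card (disc (inv' g) \<inter> W) = c" unfolding c_def by (rule card_disc_inv[OF G_pt[OF g(1)] g(2)])
  note pg = G_pt[OF g(1)] and pig = pt_inv[OF G_pt[OF g(1)]]
  have up: "f m \<le> m * f 1" for m
  proof (induction m)
    case (Suc m)
    have "f (Suc m) \<le> f m + f 1"
      unfolding f_def funpow_Suc_right using card_disc_comp[OF pt_funpow[OF ptz] ptz zW] by simp
    then show ?case using Suc by simp
  qed (simp add: f_def disc_def rgt_id[unfolded id_def] id_def)
  obtain D where low: "\<And>m. m \<le> f m + D"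
    using mism_linear_growth[OF ptz zW, of x] x by (auto simp: f_def)
  have conj1: "card (disc (?z' ^^ m) \<inter> W) \<le> f m + 2 * c" for m
  proof -
    have "card (disc (g \<circ> (z ^^ m) \<circ> inv' g) \<inter> W) \<le> card (disc (g \<circ> (z ^^ m)) \<inter> W) + c"
      using card_disc_comp[OF pt_comp[OF pg pt_funpow[OF ptz]] pig igW] ci by simp
    moreover have "card (disc (g \<circ> (z ^^ m)) \<inter> W) \<le> c + f m"
      unfolding f_def c_def using zp_invariant[OF bz zW, of "int m"]
      by (intro card_disc_comp[OF pg pt_funpow[OF ptz]] image_eqI_iff pt_bij pt_funpow ptz) (simp add: zp_int)
    ultimately show ?thesis unfolding pow by simp
  qed
  have conj2: "f m \<le> card (disc (?z' ^^ m) \<inter> W) + 2 * c" for m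
  proof -
    have "f m = card (disc (inv' g \<circ> (?z' ^^ m) \<circ> g) \<inter> W)" unfolding f_def pow'[of m] ..
    also have "\<dots> \<le> card (disc (inv' g \<circ> (?z' ^^ m)) \<inter> W) + c"
      unfolding c_def by (rule card_disc_comp[OF pt_comp[OF pig pt_funpow[OF ptz']] pg g(2)])
    also have "card (disc (inv' g \<circ> (?z' ^^ m)) \<inter> W) \<le> c + card (disc (?z' ^^ m) \<inter> W)"
      unfolding ci[symmetric] using zp_invariant[OF bz' atoms_A[OF W z'], of "int m"]
      by (intro card_disc_comp[OF pig pt_funpow[OF ptz']] image_eqI_iff pt_bij pt_funpow ptz') (simp add: zp_int)
    finally show ?thesis by simp
  qed
  have fN: "card (disc (zp z (n * int m)) \<inter> W) = f (?N * m)" for m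
  proof -
    have e: "nat \<bar>n * int m\<bar> = ?N * m" by (simp add: abs_mult nat_mult_distrib)
    have "(z ^^ (?N * m)) ` W = W"
      using zp_invariant[OF bz zW, of "int (?N * m)"]
      by (intro image_eqI_iff pt_bij pt_funpow ptz) (simp only: zp_int)
    from card_disc_inv[OF pt_funpow[OF ptz] this]
    show ?thesis unfolding zp_nat_abs e f_def by (auto simp: inv_fn[OF bz])
  qed
  note agree = funpow_mult_agree[OF bz zW kn(2)]
  have "f (?N * m) \<le> f (k * m) + C" for m
  proof -
    have "card (disc (zp z (n * int m)) \<inter> W) \<le> card (disc (?z' ^^ (k * m)) \<inter> W) + card (bdry W)"
      by (rule card_disc_agree[OF pt_zp[OF ptz] pt_funpow[OF ptz'] atoms_elem[OF W]]) (rule agree[symmetric])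
    then show ?thesis using conj1[of "k * m"] fN[of m] unfolding C_def by linarith
  qed
  moreover have "f (k * m) \<le> f (?N * m) + C" for m
  proof -
    have "card (disc (?z' ^^ (k * m)) \<inter> W) \<le> card (disc (zp z (n * int m)) \<inter> W) + card (bdry W)"
      by (rule card_disc_agree[OF pt_funpow[OF ptz'] pt_zp[OF ptz] atoms_elem[OF W]]) (rule agree)
    then show ?thesis using conj2[of "k * m"] fN[of m] unfolding C_def by linarith
  qed
  ultimately have "?N = k" using growth_compare[of f, OF up low] by (metis le_antisym)
  then have n: "n = int k \<or> n = - int k" by auto
  have "g ((z ^^ k) y) = zp z n (g y)" if "y \<in> W" for y
  proof -
    have "(?z' ^^ k) (g y) = g ((z ^^ k) y)" unfolding pow by (simp add: s)
    moreover have "g y \<in> W" using that g(2) by blast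
    ultimately show ?thesis using kn(2) by metis
  qed
  then show ?thesis using n kn(1) by auto
qed

lemma sign_multiple:
  assumes "W \<in> atoms" "z \<in> A" "\<forall>y\<in>W. g ((z ^^ k) y) = zp z (e * int k) (g y)" "y \<in> W"
  shows "g ((z ^^ (k * i)) y) = zp z (e * int (k * i)) (g y)"
proof (induction i)
  case (Suc i)
  note bz = A_bij[OF assms(2)]
  have "(z ^^ (k * i)) y \<in> W"
    using zp_invariant[OF bz atoms_A[OF assms(1,2)], of "int (k * i)" y] assms(4)
    unfolding zp_int by simp
  then have "g ((z ^^ k) ((z ^^ (k * i)) y)) = zp z (e * int k) (zp z (e * int (k * i)) (g y))"
    using assms(3) Suc by metis
  also have "\<dots> = zp z (e * int k + e * int (k * i)) (g y)" by (rule zp_add[OF bz, symmetric])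
  also have "e * int k + e * int (k * i) = e * int (k * Suc i)" by (simp add: algebra_simps)
  finally show ?case by (simp add: funpow_add)
qed simp

text \<open>At the common multiple k * l both g and h turn z^(k l) into z^(e k l), and this cancels
  in \<open>inv' g \<circ> h\<close>.\<close>

lemma same_sign_commute_power:
  assumes "W \<in> atoms" "z \<in> A" "g \<in> G" "h \<in> G" "g ` W = W" "h ` W = W" "k > 0" "l > 0"
    "\<forall>y\<in>W. g ((z ^^ k) y) = zp z (e * int k) (g y)" "\<forall>y\<in>W. h ((z ^^ l) y) = zp z (e * int l) (h y)"
  shows "\<exists>K>0. \<forall>y\<in>W. (inv' g \<circ> h) ((z ^^ K) y) = (z ^^ K) ((inv' g \<circ> h) y)"
proof (intro exI[of _ "k * l"] conjI ballI)
  fix y assume y: "y \<in> W"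
  let ?K = "k * l" and ?w = "inv' g (h y)"
  note s = pt_inv_simps[OF G_pt[OF assms(3)]]
  have w: "?w \<in> W" using y assms(6) image_inv_eq[OF G_bij[OF assms(3)] assms(5)] by blast
  have "h ((z ^^ ?K) y) = zp z (e * int ?K) (h y)"
    using sign_multiple[OF assms(1,2,10) y, of k] by (simp add: mult.commute)
  also have "\<dots> = zp z (e * int ?K) (g ?w)" by (simp add: s)
  also have "\<dots> = g ((z ^^ ?K) ?w)" using sign_multiple[OF assms(1,2,9) w, of l] by simp
  finally show "(inv' g \<circ> h) ((z ^^ ?K) y) = (z ^^ ?K) ((inv' g \<circ> h) y)" by (simp add: s)
qed (use assms in simp)

end

section \<open>Centralizers of finite index\<close>

definition fin_index :: "('a \<Rightarrow> 'a) set \<Rightarrow> ('a \<Rightarrow> 'a) set \<Rightarrow> bool" where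
  "fin_index K G \<longleftrightarrow> (\<exists>F. finite F \<and> F \<subseteq> G \<and> (\<forall>g\<in>G. \<exists>t\<in>F. inv' t \<circ> g \<in> K))"

lemma fin_index_fibers:
  assumes "finite (\<phi> ` G)" "\<And>g h. g \<in> G \<Longrightarrow> h \<in> G \<Longrightarrow> \<phi> g = \<phi> h \<Longrightarrow> inv' g \<circ> h \<in> K"
  shows "fin_index K G"
proof -
  define r where "r v = (SOME g. g \<in> G \<and> \<phi> g = v)" for v
  have r: "r (\<phi> g) \<in> G \<and> \<phi> (r (\<phi> g)) = \<phi> g" if "g \<in> G" for g
    unfolding r_def by (rule someI[of "\<lambda>x. x \<in> G \<and> \<phi> x = \<phi> g" g]) (simp add: that)
  show ?thesis
    unfolding fin_index_def
  proof (intro exI[of _ "r ` \<phi> ` G"] conjI ballI)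
    show "finite (r ` \<phi> ` G)" using assms(1) by (rule finite_imageI)
    show "r ` \<phi> ` G \<subseteq> G" using r by blast
    fix g assume g: "g \<in> G"
    then have "inv' (r (\<phi> g)) \<circ> g \<in> K" using assms(2)[of "r (\<phi> g)" g] r[OF g] by simp
    then show "\<exists>t\<in>r ` \<phi> ` G. inv' t \<circ> g \<in> K" using g by blast
  qed
qed

lemma fin_index_trans:
  assumes "fin_index K H" "fin_index H G" "H \<subseteq> G"
    "\<And>g h. g \<in> G \<Longrightarrow> h \<in> G \<Longrightarrow> g \<circ> h \<in> G" "\<And>g. g \<in> G \<Longrightarrow> bij g"
  shows "fin_index K G"
proof -
  obtain E where E: "finite E" "E \<subseteq> H" "\<And>g. g \<in> H \<Longrightarrow> \<exists>t\<in>E. inv' t \<circ> g \<in> K"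
    using assms(1) by (auto simp: fin_index_def)
  obtain F where F: "finite F" "F \<subseteq> G" "\<And>g. g \<in> G \<Longrightarrow> \<exists>t\<in>F. inv' t \<circ> g \<in> H"
    using assms(2) by (auto simp: fin_index_def)
  show ?thesis
    unfolding fin_index_def
  proof (intro exI[of _ "(\<lambda>(t, s). t \<circ> s) ` (F \<times> E)"] conjI ballI)
    show "finite ((\<lambda>(t, s). t \<circ> s) ` (F \<times> E))" using E F by simp
    show "(\<lambda>(t, s). t \<circ> s) ` (F \<times> E) \<subseteq> G"
      using E(2) F(2) assms(3) by (auto intro!: assms(4))
    fix g assume "g \<in> G"
    then obtain t where t: "t \<in> F" "inv' t \<circ> g \<in> H" using F by blast
    then obtain s where s: "s \<in> E" "inv' s \<circ> (inv' t \<circ> g) \<in> K" using E by blast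
    have "bij t" "bij s" using t s E F assms(3,5) by auto
    then have "inv' (t \<circ> s) \<circ> g = inv' s \<circ> (inv' t \<circ> g)" by (simp add: o_inv_distrib o_assoc)
    then show "\<exists>u\<in>(\<lambda>(t, s). t \<circ> s) ` (F \<times> E). inv' u \<circ> g \<in> K" using t(1) s by force
  qed
qed

lemma funpow_commuting_factor:
  assumes "\<And>x. w (a x) = a (w x)" "\<And>x. b x = w (a x)"
  shows "(b ^^ n) x = (w ^^ n) ((a ^^ n) x)"
proof (induction n)
  case (Suc n)
  have "(b ^^ Suc n) x = b ((b ^^ n) x)" by simp
  also have "\<dots> = w (a ((b ^^ n) x))" by (rule assms(2))
  also have "(b ^^ n) x = (w ^^ n) ((a ^^ n) x)" by (rule Suc)
  also have "a ((w ^^ n) ((a ^^ n) x)) = (w ^^ n) (a ((a ^^ n) x))"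
    by (rule funpow_intertwine) (rule assms(1)[symmetric])
  finally show ?case by simp
qed simp

context pt_group_normal
begin

definition Stab :: "(real \<Rightarrow> real) set" where
  "Stab = {g \<in> G. \<forall>W\<in>atoms. g ` W = W}"

definition Cen :: "(real \<Rightarrow> real) set" where
  "Cen = {g \<in> Stab. \<forall>a\<in>A. \<forall>x. g (a x) = a (g x)}"

lemma Stab_inv_comp:
  assumes "g \<in> G" "h \<in> G" "\<And>W. W \<in> atoms \<Longrightarrow> g ` W = h ` W" shows "inv' g \<circ> h \<in> Stab"
proof -
  have "(inv' g \<circ> h) ` W = W" if "W \<in> atoms" for W
  proof -
    have "(inv' g \<circ> h) ` W = inv' g ` (g ` W)" using assms(3)[OF that] by (simp add: image_comp)
    then show ?thesis using G_bij[OF assms(1)] by (simp add: bij_def image_inv_f_f)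
  qed
  then show ?thesis using G_comp[OF G_inv] assms(1,2) by (simp add: Stab_def)
qed

lemma fin_index_Stab: "fin_index Stab G"
proof (rule fin_index_fibers[where \<phi>="\<lambda>g. restrict (image g) atoms"])
  show "finite ((\<lambda>g. restrict (image g) atoms) ` G)"
  proof (rule finite_subset[OF _ finite_PiE[OF finite_atoms finite_atoms]])
    show "(\<lambda>g. restrict (image g) atoms) ` G \<subseteq> atoms \<rightarrow>\<^sub>E atoms"
    proof
      fix f assume "f \<in> (\<lambda>g. restrict (image g) atoms) ` G"
      then obtain g where "g \<in> G" "f = restrict (image g) atoms" by blast
      then show "f \<in> atoms \<rightarrow>\<^sub>E atoms" using image_atoms[of g] by simp
    qed
  qed
  fix g h assume *: "g \<in> G" "h \<in> G" "restrict (image g) atoms = restrict (image h) atoms"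
  have "g ` W = h ` W" if "W \<in> atoms" for W using fun_cong[OF *(3), of W] that by simp
  then show "inv' g \<circ> h \<in> Stab" by (rule Stab_inv_comp[OF *(1,2)])
qed

text \<open>By normality the commutator w of u and a lies in A. On an atom where w has no mismatch,
  zero flux gives a periodic point. Otherwise a power of a is a power of z on W, so u commutes there
  with a^P for a suitable P; but u a u^-1 = w a with w and a commuting, so comparing P-th powers
  leaves a point fixed by w^P.\<close>

lemma commutes_with_A:
  assumes u: "u \<in> Stab"
    and sg: "\<And>W z. W \<in> atoms \<Longrightarrow> z \<in> A \<Longrightarrow> W \<inter> mism z \<noteq> {} \<Longrightarrow>
      \<exists>z'\<in>A. W \<inter> mism z' \<noteq> {} \<and> (\<exists>K>0. \<forall>y\<in>W. u ((z' ^^ K) y) = (z' ^^ K) (u y))"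
    and a: "a \<in> A"
  shows "u (a x) = a (u x)"
proof -
  let ?b = "u \<circ> a \<circ> inv' u" and ?w = "u \<circ> a \<circ> inv' u \<circ> inv' a"
  have uG: "u \<in> G" and uW: "\<And>W. W \<in> atoms \<Longrightarrow> u ` W = W" using u by (auto simp: Stab_def)
  note s = pt_inv_simps[OF G_pt[OF uG]] and sa = pt_inv_simps[OF A_pt[OF a]]
  have b: "?b \<in> A" by (rule A_conj[OF uG a])
  have w: "?w \<in> A" by (rule A_comp[OF b A_inv[OF a]])
  have "?w = id"
  proof (rule trivial_if_periodic_on_atoms[OF w])
    fix W assume W: "W \<in> atoms"
    show "\<exists>x\<in>W. \<exists>k>0. (?w ^^ k) x = x"
    proof (cases "W \<inter> mism ?w = {}")
      case True
      show ?thesis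
        by (rule commutator_periodic_on_atom[OF W uG A_G[OF a] uW[OF W] atoms_A[OF W a] w refl True])
    next
      case False
      from sg[OF W w this] obtain z K where z: "z \<in> A" "W \<inter> mism z \<noteq> {}" "K > 0"
        "\<And>y. y \<in> W \<Longrightarrow> u ((z ^^ K) y) = (z ^^ K) (u y)" by blast
      note bz = A_bij[OF z(1)] and zW = atoms_A[OF W z(1)]
      obtain x0 where x0: "x0 \<in> W \<inter> mism z" using z(2) by blast
      obtain k n where k: "k > 0" "\<And>y. y \<in> W \<Longrightarrow> (a ^^ k) y = zp z n y"
        using power_on_mismatched_atom[OF W z(1) x0 A_pt[OF a] A_commD[OF a]] by metis
      have agree: "(a ^^ (k * m)) y = zp z (n * int m) y" if "y \<in> W" for y m
        by (rule funpow_mult_agree[OF bz zW k(2) that])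
      have bzK: "bij (z ^^ K)" using bij_zp[OF bz, of "int K"] by (simp add: zp_int)
      have zKW: "(z ^^ K) ` W = W"
        by (rule image_eqI_iff[OF bzK]) (use zp_invariant[OF bz zW, of "int K"] in \<open>simp add: zp_int\<close>)
      have zz: "zp (z ^^ K) n y = zp z (n * int K) y" for y
        using zp_mult[OF bz, of "int K" n y] by (simp add: zp_int mult.commute)
      let ?P = "k * K" and ?v = "(a ^^ (k * K)) (u x0)"
      have ux: "u x0 \<in> W" using uW[OF W] x0 by blast
      have "(?b ^^ ?P) (u x0) = u ((a ^^ ?P) x0)"
        by (rule funpow_intertwine[symmetric]) (simp add: s)
      also have "(a ^^ ?P) x0 = zp (z ^^ K) n x0" using agree[of x0 K] x0 zz by auto
      also have "u \<dots> = zp (z ^^ K) n (u x0)"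
        by (rule zp_intertwine_on[where h=u, OF bzK bzK zKW z(4)]) (use x0 in auto)
      also have "\<dots> = ?v" using agree[OF ux, of K] zz by simp
      finally have "(?b ^^ ?P) (u x0) = ?v" .
      moreover have "(?b ^^ ?P) (u x0) = (?w ^^ ?P) ?v"
      proof (rule funpow_commuting_factor[where w="?w" and a=a and b="?b"])
        show "?w (a x) = a (?w x)" for x by (rule A_commD[OF w a])
        show "?b x = ?w (a x)" for x by (simp add: sa)
      qed
      moreover have "?v \<in> W"
        using zp_invariant[OF A_bij[OF a] atoms_A[OF W a], of "int ?P" "u x0"] ux unfolding zp_int by simp
      ultimately show ?thesis using k(1) z(3) by (intro bexI[of _ ?v] exI[of _ ?P]) simp_all
    qed
  qed
  then have "?w (a (u x)) = a (u x)" by simp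
  then show ?thesis by (simp add: s sa)
qed

text \<open>One mismatched element \<open>zz W\<close> is fixed per atom and every g gets a sign on
  it. Equal signs make \<open>inv' g \<circ> h\<close> commute with a power of \<open>zz W\<close>,
  which is what \<open>commutes_with_A\<close> asks for. Recording the atoms of sign 1 suffices,
  since failing sign 1 forces sign -1.\<close>

lemma fin_index_Cen_Stab: "fin_index Cen Stab"
proof -
  define zz where "zz W = (SOME z. z \<in> A \<and> W \<inter> mism z \<noteq> {})" for W
  have zz: "zz W \<in> A \<and> W \<inter> mism (zz W) \<noteq> {}" if "z \<in> A" "W \<inter> mism z \<noteq> {}" for W z
    unfolding zz_def by (rule someI[of "\<lambda>z. z \<in> A \<and> W \<inter> mism z \<noteq> {}" z]) (use that in simp)
  define sgn where "sgn W g e \<longleftrightarrow> (\<exists>k>0. \<forall>y\<in>W. g ((zz W ^^ k) y) = zp (zz W) (e * int k) (g y))"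
    for W g and e :: int
  have sgn: "sgn W g 1 \<or> sgn W g (- 1)"
    if W: "W \<in> atoms" and z: "z \<in> A" "W \<inter> mism z \<noteq> {}" and g: "g \<in> Stab" for W z g
  proof -
    note Z = zz[OF z]
    obtain x where x: "x \<in> W \<inter> mism (zz W)" using Z by blast
    have "g \<in> G" "g ` W = W" using g W by (auto simp: Stab_def)
    from conj_sign[OF W conjunct1[OF Z] x this] show ?thesis unfolding sgn_def by auto
  qed
  show ?thesis
  proof (rule fin_index_fibers[where \<phi>="\<lambda>g. {W \<in> atoms. sgn W g 1}"])
    show "finite ((\<lambda>g. {W \<in> atoms. sgn W g 1}) ` Stab)"
      by (rule finite_subset[of _ "Pow atoms"]) (use finite_atoms in auto)
    fix g h assume g: "g \<in> Stab" and h: "h \<in> Stab"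
      and eq: "{W \<in> atoms. sgn W g 1} = {W \<in> atoms. sgn W h 1}"
    have W: "g ` W = W" "h ` W = W" if "W \<in> atoms" for W
      using g h that by (auto simp: Stab_def)
    have G: "g \<in> G" "h \<in> G" using g h by (auto simp: Stab_def)
    have u: "inv' g \<circ> h \<in> Stab" by (rule Stab_inv_comp[OF G]) (simp add: W)
    have "(inv' g \<circ> h) (a x) = a ((inv' g \<circ> h) x)" if a: "a \<in> A" for a x
    proof (rule commutes_with_A[OF u _ a])
      fix V z assume V: "V \<in> atoms" and z: "z \<in> A" "V \<inter> mism z \<noteq> {}"
      have "\<exists>e. sgn V g e \<and> sgn V h e"
      proof (cases "sgn V g 1")
        case True
        then have "V \<in> {W \<in> atoms. sgn W h 1}" using V unfolding eq[symmetric] by simp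
        then show ?thesis using True by blast
      next
        case False
        then have "V \<notin> {W \<in> atoms. sgn W h 1}" using V unfolding eq[symmetric] by simp
        then have "\<not> sgn V h 1" using V by simp
        then show ?thesis using False sgn[OF V z g] sgn[OF V z h] by blast
      qed
      then obtain e k l where "k > 0" "l > 0"
        "\<forall>y\<in>V. g ((zz V ^^ k) y) = zp (zz V) (e * int k) (g y)"
        "\<forall>y\<in>V. h ((zz V ^^ l) y) = zp (zz V) (e * int l) (h y)"
        unfolding sgn_def by blast
      from same_sign_commute_power[OF V conjunct1[OF zz[OF z]] G W(1)[OF V] W(2)[OF V] this]
      show "\<exists>z'\<in>A. V \<inter> mism z' \<noteq> {} \<and> (\<exists>K>0. \<forall>y\<in>V. (inv' g \<circ> h) ((z' ^^ K) y) = (z' ^^ K) ((inv' g \<circ> h) y))"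
        using zz[OF z] by blast
    qed
    then show "inv' g \<circ> h \<in> Cen" using u by (simp add: Cen_def)
  qed
qed

lemma fin_index_Cen: "fin_index Cen G"
  by (rule fin_index_trans[OF fin_index_Cen_Stab fin_index_Stab])
    (use G_comp G_bij in \<open>auto simp: Stab_def\<close>)

lemma Cen_G: "g \<in> Cen \<Longrightarrow> g \<in> G" and Cen_A: "g \<in> Cen \<Longrightarrow> a \<in> A \<Longrightarrow> g (a x) = a (g x)"
  and Cen_atoms: "g \<in> Cen \<Longrightarrow> W \<in> atoms \<Longrightarrow> g ` W = W"
  by (auto simp: Cen_def Stab_def)

lemma Cen_group: "id \<in> Cen" "g \<in> Cen \<Longrightarrow> h \<in> Cen \<Longrightarrow> g \<circ> h \<in> Cen" "g \<in> Cen \<Longrightarrow> inv' g \<in> Cen"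
proof -
  show "id \<in> Cen" using G_id by (auto simp: Cen_def Stab_def)
  show "g \<circ> h \<in> Cen" if "g \<in> Cen" "h \<in> Cen"
  proof -
    have "(g \<circ> h) ` W = W" if "W \<in> atoms" for W
      unfolding image_comp[symmetric] Cen_atoms[OF \<open>h \<in> Cen\<close> that] by (rule Cen_atoms[OF \<open>g \<in> Cen\<close> that])
    then show ?thesis using that G_comp by (auto simp: Cen_def Stab_def)
  qed
  show "inv' g \<in> Cen" if g: "g \<in> Cen"
  proof -
    have "inv' g (a x) = a (inv' g x)" if a: "a \<in> A" for a x
      by (rule intertwine_inv[where b=a, OF G_pt[OF Cen_G[OF g]] G_pt[OF Cen_G[OF g]], symmetric])
        (rule Cen_A[OF g a, symmetric])
    then show ?thesis
      using g G_inv image_inv_eq[OF G_bij] by (auto simp: Cen_def Stab_def)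
  qed
qed

text \<open>The commutator z of b and c is central for both, as in a Heisenberg group: b^m c = z^m c
  b^m. On an atom where z is mismatched, b^k is a power of z and so commutes with c, which forces
  z^k to fix a point. Elsewhere zero flux applies.\<close>

lemma Cen_commute_if_commutator_in_A:
  assumes "b \<in> Cen" "c \<in> Cen" "b \<circ> c \<circ> inv' b \<circ> inv' c \<in> A"
  shows "b \<circ> c = c \<circ> b"
proof -
  define z where "z = b \<circ> c \<circ> inv' b \<circ> inv' c"
  have zA: "z \<in> A" using assms(3) by (simp add: z_def)
  note sb = pt_inv_simps[OF G_pt[OF Cen_G[OF assms(1)]]] and sc = pt_inv_simps[OF G_pt[OF Cen_G[OF assms(2)]]]
  have zbc: "z (c (b x)) = b (c x)" for x by (simp add: z_def sb sc)
  have "z = id"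
  proof (rule trivial_if_periodic_on_atoms[OF zA])
    fix W assume W: "W \<in> atoms"
    note bW = Cen_atoms[OF assms(1) W] and cW = Cen_atoms[OF assms(2) W]
    show "\<exists>x\<in>W. \<exists>k>0. (z ^^ k) x = x"
    proof (cases "W \<inter> mism z = {}")
      case True
      show ?thesis
        by (rule commutator_periodic_on_atom[OF W Cen_G[OF assms(1)] Cen_G[OF assms(2)] bW cW zA z_def True])
    next
      case False
      then obtain x where x: "x \<in> W \<inter> mism z" by blast
      obtain k n where k: "k > 0" "\<And>y. y \<in> W \<Longrightarrow> (b ^^ k) y = zp z n y"
        using power_on_mismatched_atom[OF W zA x G_pt[OF Cen_G[OF assms(1)]] Cen_A[OF assms(1)]] by metis
      have zb: "z (b y) = b (z y)" and zc: "z (c y) = c (z y)" for y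
        using Cen_A[OF assms(1) zA] Cen_A[OF assms(2) zA] by simp_all
      have pw: "(b ^^ m) (c y) = (z ^^ m) (c ((b ^^ m) y))" for m y
      proof (induction m)
        case (Suc m)
        have "(b ^^ Suc m) (c y) = b ((z ^^ m) (c ((b ^^ m) y)))"
          by (simp only: funpow.simps(2) comp_apply Suc)
        also have "\<dots> = (z ^^ m) (b (c ((b ^^ m) y)))"
          by (rule funpow_intertwine) (rule zb[symmetric])
        also have "b (c ((b ^^ m) y)) = z (c (b ((b ^^ m) y)))" by (rule zbc[symmetric])
        finally show ?case by (simp add: funpow_swap1)
      qed simp
      let ?v = "c ((b ^^ k) x)"
      have xW: "x \<in> W" using x by blast
      then have cx: "c x \<in> W" using cW by blast
      have bij: "bij z" by (rule A_bij[OF zA])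
      have "?v = c (zp z n x)" using k(2)[OF xW] by simp
      also have "\<dots> = zp z n (c x)" by (rule zp_intertwine[OF bij bij]) (rule zc[symmetric])
      also have "\<dots> = (b ^^ k) (c x)" using k(2)[OF cx] by simp
      also have "\<dots> = (z ^^ k) ?v" by (rule pw)
      finally have "(z ^^ k) ?v = ?v" ..
      moreover have "?v \<in> W"
        using zp_invariant[OF G_bij[OF Cen_G[OF assms(1)]] bW, of "int k" x] xW cW unfolding zp_int by blast
      ultimately show ?thesis using k(1) by blast
    qed
  qed
  then have "b (c x) = c (b x)" for x using zbc[of x] by simp
  then show ?thesis by auto
qed

text \<open>A discontinuity h s is rewritten as (h t) (t^-1 s), where t represents the left coset of
  h^-1, so that h t is in \<open>Cen\<close>. Only the finite set \<open>\<Sigma>\<close> has to be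
  enlarged.\<close>

lemma Cen_pt_group: "\<exists>\<Sigma>'. pt_group Cen T \<Sigma>'"
proof -
  obtain F where F: "finite F" "F \<subseteq> G" "\<And>g. g \<in> G \<Longrightarrow> \<exists>t\<in>F. inv' t \<circ> g \<in> Cen"
    using fin_index_Cen by (auto simp: fin_index_def)
  have "pt_group Cen T (\<Union>t\<in>F. inv' t ` \<Sigma>)"
  proof
    show "finite (\<Union>t\<in>F. inv' t ` \<Sigma>)" using F(1) finite_\<Sigma> by simp
    fix g q assume "g \<in> Cen" "q \<in> disc g"
    then obtain h s where h: "h \<in> G" "s \<in> \<Sigma>" "q = h s" using G_disc Cen_G by blast
    obtain t where t: "t \<in> F" "inv' t \<circ> inv' h \<in> Cen" using F(3)[OF G_inv[OF h(1)]] by blast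
    have bt: "bij t" "bij h" using t(1) F(2) h(1) G_bij by auto
    have "inv' (inv' t \<circ> inv' h) = h \<circ> t"
      using bt by (simp add: o_inv_distrib bij_imp_bij_inv inv_inv_eq)
    then have "h \<circ> t \<in> Cen" using Cen_group(3)[OF t(2)] by simp
    moreover have "q = (h \<circ> t) (inv' t s)" using h(3) bij_cancel(1)[OF bt(1)] by simp
    ultimately show "\<exists>k\<in>Cen. \<exists>s\<in>\<Union>t\<in>F. inv' t ` \<Sigma>. q = k s" using t(1) h(2) by blast
  next
    show "g x = x" if "g \<in> Cen" "x \<notin> {0..T}" for g x
      by (rule G_supp[OF Cen_G[OF that(1)] that(2)])
  next
    show "pt g" if "g \<in> Cen" for g by (rule G_pt[OF Cen_G[OF that]])
    show "g = id" if "g \<in> Cen" "k > 0" "g ^^ k = id" for g k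
      by (rule G_torsion_free[OF Cen_G[OF that(1)] that(2,3)])
  qed (rule Cen_group; assumption)+
  then show ?thesis ..
qed

end

section \<open>Solvable groups of piecewise translations\<close>

definition derived_chain :: "nat \<Rightarrow> (nat \<Rightarrow> (real \<Rightarrow> real) set) \<Rightarrow> (real \<Rightarrow> real) set \<Rightarrow> bool" where
  "derived_chain d N G \<longleftrightarrow> N 0 = G \<and> N d = {id} \<and> (\<forall>i\<le>d. nsub (N i) G) \<and>
    (\<forall>i<d. \<forall>a\<in>N i. \<forall>b\<in>N i. a \<circ> b \<circ> inv' a \<circ> inv' b \<in> N (Suc i))"

lemma commute_if_commutator_id:
  assumes "bij a" "bij b" "a \<circ> b \<circ> inv' a \<circ> inv' b = id" shows "a \<circ> b = b \<circ> a"
proof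
  fix x
  have "(a \<circ> b \<circ> inv' a \<circ> inv' b) (b (a x)) = b (a x)" using assms(3) by simp
  then show "(a \<circ> b) x = (b \<circ> a) x" by (simp add: bij_cancel assms(1,2))
qed

definition comm_fin_index :: "(real \<Rightarrow> real) set \<Rightarrow> (real \<Rightarrow> real) set \<Rightarrow> bool" where
  "comm_fin_index K G \<longleftrightarrow> K \<subseteq> G \<and> id \<in> K \<and> (\<forall>a\<in>K. \<forall>b\<in>K. a \<circ> b \<in> K) \<and> (\<forall>a\<in>K. inv' a \<in> K) \<and>
    (\<forall>a\<in>K. \<forall>b\<in>K. a \<circ> b = b \<circ> a) \<and> fin_index K G"

lemma comm_fin_index_self:
  assumes "pt_group G T \<Sigma>" "\<And>a b. a \<in> G \<Longrightarrow> b \<in> G \<Longrightarrow> a \<circ> b = b \<circ> a"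
  shows "comm_fin_index G G"
proof -
  interpret pt_group G T \<Sigma> by fact
  have "fin_index G G"
    by (rule fin_index_fibers[where \<phi>="\<lambda>_. ()"]) (use G_comp G_inv in auto)
  then show ?thesis using assms(2) G_id G_comp G_inv by (auto simp: comm_fin_index_def)
qed

text \<open>Passing to the centralizer of the last term A of the chain makes the term before it commute.\<close>

theorem pt_group_virtually_commutative:
  "pt_group G T \<Sigma> \<Longrightarrow> derived_chain d N G \<Longrightarrow> \<exists>K. comm_fin_index K G"
proof (induction d arbitrary: G \<Sigma> N)
  case 0
  have "N 0 = G" "N 0 = {id}" using 0(2) unfolding derived_chain_def by blast+
  then have "G = {id}" by metis
  then have "comm_fin_index G G" by (intro comm_fin_index_self[OF 0(1)]) simp
  then show ?case ..
next
  case (Suc d)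
  interpret pt_group G T \<Sigma> by fact
  have N: "N 0 = G" "N (Suc d) = {id}" "\<And>i. i \<le> Suc d \<Longrightarrow> nsub (N i) G"
    "\<And>i a b. i < Suc d \<Longrightarrow> a \<in> N i \<Longrightarrow> b \<in> N i \<Longrightarrow> a \<circ> b \<circ> inv' a \<circ> inv' b \<in> N (Suc i)"
    using Suc.prems(2) by (auto simp: derived_chain_def)
  have last: "a \<circ> b = b \<circ> a" if ab: "a \<in> N d" "b \<in> N d" for a b
  proof (rule commute_if_commutator_id)
    show "bij a" "bij b" using ab N(3)[of d] G_pt pt_bij by (auto simp: nsub_def)
    show "a \<circ> b \<circ> inv' a \<circ> inv' b = id" using N(4)[of d a b] N(2) ab by simp
  qed
  show ?case
  \<comment> \<open>For d = 0 the last nontrivial term is G itself. Otherwise a term remains before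
    A, so the shortened chain can still start at \<open>Cen\<close>.\<close>
  proof (cases d)
    case 0
    have "comm_fin_index G G"
      by (rule comm_fin_index_self[OF Suc.prems(1)]) (use last 0 N(1) in simp)
    then show ?thesis ..
  next
    case (Suc d')
    interpret pt_group_normal G T \<Sigma> "N d"
    proof
      show "nsub (N d) G" by (rule N(3)) simp
    qed (rule last)
    obtain \<Sigma>' where S': "pt_group Cen T \<Sigma>'" using Cen_pt_group by blast
    \<comment> \<open>The term A is dropped. Commutators from the term before it fall into A, hence
      vanish inside \<open>Cen\<close>, so that term may be followed directly by the
      identity.\<close>
    define N' where "N' i = (if i < d then Cen \<inter> N i else {id})" for i
    have ns: "nsub (Cen \<inter> N i) Cen" if "i \<le> d" for i
      using N(3)[of i] that Cen_G Cen_group unfolding nsub_def by auto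
    have "derived_chain d N' Cen"
      unfolding derived_chain_def
    proof (intro conjI allI impI ballI)
      show "N' 0 = Cen" using Suc N(1) Cen_G by (auto simp: N'_def)
      show "N' d = {id}" by (simp add: N'_def)
      show "nsub (N' i) Cen" for i
      proof (cases "i < d")
        case False
        have "g \<circ> inv' g = id" if "g \<in> Cen" for g using pt_inv_simps(6)[OF G_pt[OF Cen_G[OF that]]] .
        then show ?thesis using False Cen_group(1) by (simp add: N'_def nsub_def inv_id)
      qed (simp add: N'_def ns)
      fix i a b assume i: "i < d" and ab: "a \<in> N' i" "b \<in> N' i"
      then have a: "a \<in> Cen" "a \<in> N i" and b: "b \<in> Cen" "b \<in> N i" by (auto simp: N'_def)
      let ?z = "a \<circ> b \<circ> inv' a \<circ> inv' b"
      have z: "?z \<in> N (Suc i)" using N(4)[of i a b] a b i by simp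
      show "?z \<in> N' (Suc i)"
      proof (cases "Suc i < d")
        case True
        have "?z \<in> Cen" using a b Cen_group(2,3) by blast
        then show ?thesis using z True by (simp add: N'_def)
      next
        case False
        then have d: "Suc i = d" using i by simp
        have "a \<circ> b = b \<circ> a" using Cen_commute_if_commutator_in_A[OF a(1) b(1)] z d by simp
        then have "?z = b \<circ> (a \<circ> inv' a) \<circ> inv' b" by (simp add: o_assoc)
        then have "?z = id"
          by (simp add: pt_inv_simps(6)[OF G_pt[OF Cen_G[OF a(1)]]] pt_inv_simps(6)[OF G_pt[OF Cen_G[OF b(1)]]])
        then show ?thesis using d by (simp add: N'_def)
      qed
    qed
    from Suc.IH[OF S' this] obtain K where K: "comm_fin_index K Cen" ..
    have "fin_index K G"
      by (rule fin_index_trans[OF _ fin_index_Cen]) (use K Cen_G G_comp G_bij in \<open>auto simp: comm_fin_index_def\<close>)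
    moreover have "Cen \<subseteq> G" using Cen_G by blast
    ultimately have "comm_fin_index K G" using K unfolding comm_fin_index_def by blast
    then show ?thesis ..
  qed
qed

section \<open>Left limits of almost everywhere piecewise translations\<close>

text \<open>After gluing, the first point of an interval component acquires left neighbours from the
  previous component, so left-continuity can fail there. This class allows finitely many such bad
  points; \<open>llim\<close> repairs the values at them.\<close>

definition ptae :: "(real \<Rightarrow> real) \<Rightarrow> bool" where
  "ptae F \<longleftrightarrow> bij F \<and> (\<exists>S. finite S \<and> (\<forall>x. x \<notin> S \<longrightarrow> (\<forall>\<^sub>F y in at x. F y = y + (F x - x))))"

definition llim :: "(real \<Rightarrow> real) \<Rightarrow> real \<Rightarrow> real" where
  "llim F y = y + (THE v. \<forall>\<^sub>F u in at_left y. F u - u = v)"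

lemma llim_eqI:
  assumes "\<forall>\<^sub>F u in at_left y. F u = u + (v - y)" shows "llim F y = v"
proof -
  have *: "\<forall>\<^sub>F u in at_left y. F u - u = v - y"
    using assms by eventually_elim simp
  have "(THE w. \<forall>\<^sub>F u in at_left y. F u - u = w) = v - y"
  proof (rule the_equality)
    show "\<forall>\<^sub>F u in at_left y. F u - u = v - y" by (rule *)
    fix w assume "\<forall>\<^sub>F u in at_left y. F u - u = w"
    with * have "\<forall>\<^sub>F u in at_left y. w = v - y" by eventually_elim simp
    then show "w = v - y" by simp
  qed
  then show ?thesis by (simp add: llim_def)
qed

lemma translation_const:
  assumes "\<And>x. a < x \<Longrightarrow> x < b \<Longrightarrow> \<forall>\<^sub>F y in at x. F y = y + (F x - x :: real)"
    "a < u" "u < b" "a < v" "v < b"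
  shows "F u - u = F v - v"
proof -
  have "\<forall>\<^sub>F y in at x within {a<..<b}. F x - x = F y - y" if "x \<in> {a<..<b}" for x
  proof -
    have "\<forall>\<^sub>F y in at x. F x - x = F y - y"
      using assms(1)[of x] that by (auto elim: eventually_mono)
    then show ?thesis by (rule filter_leD[OF at_le, rotated]) simp
  qed
  then show ?thesis
    using connected_local_const[of "{a<..<b}" u v "\<lambda>x. F x - x"] assms(2-5) by simp
qed

lemma llim_left:
  assumes "ptae F" shows "\<forall>\<^sub>F u in at_left y. F u = u + (llim F y - y) \<and> llim F u = u + (llim F y - y)"
proof -
  obtain S where S: "finite S" "\<And>x. x \<notin> S \<Longrightarrow> \<forall>\<^sub>F y in at x. F y = y + (F x - x)"
    using assms by (auto simp: ptae_def)
  obtain a where a: "a < y" "\<And>x. a < x \<Longrightarrow> x < y \<Longrightarrow> x \<notin> S"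
    using finite_avoids_at_left[OF S(1), of y] by (auto simp: eventually_at_left_field)
  let ?c = "(a + y) / 2"
  define c where "c = F ?c - ?c"
  have F: "F u = u + c" if "a < u" "u < y" for u
    using translation_const[of a y F u ?c] S(2) a that by (simp add: c_def field_simps)
  have near: "\<forall>\<^sub>F w in at_left u. F w = w + c" if "a < u" "u \<le> y" for u
    unfolding eventually_at_left_field using F that by (intro exI[of _ a]) auto
  have L: "llim F u = u + c" if "a < u" "u \<le> y" for u
    by (rule llim_eqI) (use near[OF that] in simp)
  show ?thesis
    unfolding eventually_at_left_field using F L a(1) by (intro exI[of _ a]) auto
qed

lemma llim_generic:
  assumes "ptae F" shows "\<exists>S. finite S \<and> (\<forall>x. x \<notin> S \<longrightarrow> llim F x = F x \<and>
    (\<forall>\<^sub>F u in at_right x. llim F u = u + (llim F x - x)))"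
proof -
  obtain S where S: "finite S" "\<And>x. x \<notin> S \<Longrightarrow> \<forall>\<^sub>F y in at x. F y = y + (F x - x)"
    using assms by (auto simp: ptae_def)
  have eq: "llim F x = F x" if "x \<notin> S" for x
    by (rule llim_eqI) (use S(2)[OF that] in \<open>simp add: eventually_at_split\<close>)
  have "\<forall>\<^sub>F u in at_right x. llim F u = u + (llim F x - x)" if "x \<notin> S" for x
  proof -
    have "\<forall>\<^sub>F u in at_right x. F u = u + (F x - x)" using S(2)[OF that] by (simp add: eventually_at_split)
    with finite_avoids_at_right[OF S(1), of x] show ?thesis
      by eventually_elim (simp add: eq that)
  qed
  with eq S(1) show ?thesis by blast
qed

text \<open>Left germs compose at every point, including exceptional ones, so \<open>llim\<close> is
  multiplicative without further corrections.\<close>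

lemma llim_comp:
  assumes "ptae F" "ptae K" shows "llim (F \<circ> K) = llim F \<circ> llim K"
proof
  fix y
  have "\<forall>\<^sub>F u in at_left (y + (llim K y - y)). F u = u + (llim F (llim K y) - llim K y)"
    using llim_left[OF assms(1), of "llim K y"] by (auto elim: eventually_mono)
  then have "\<forall>\<^sub>F u in at_left y. F (u + (llim K y - y)) = u + (llim K y - y) + (llim F (llim K y) - llim K y)"
    by (rule eventually_translate_left)
  with llim_left[OF assms(2), of y]
  have "\<forall>\<^sub>F u in at_left y. (F \<circ> K) u = u + ((llim F \<circ> llim K) y - y)"
    by eventually_elim simp
  then show "llim (F \<circ> K) y = (llim F \<circ> llim K) y" by (rule llim_eqI)
qed

lemma llim_id: "llim id = id"
proof
  fix y :: real show "llim id y = id y" by (rule llim_eqI) simp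
qed

text \<open>Changing finitely many values could destroy bijectivity; it is recovered by applying
  \<open>llim\<close> to a two-sided inverse in the same class.\<close>

lemma pt_llim:
  assumes "ptae F" "ptae F'" "F \<circ> F' = id" "F' \<circ> F = id" shows "pt (llim F)"
proof -
  have "llim F \<circ> llim F' = id" "llim F' \<circ> llim F = id"
    using llim_comp[OF assms(1,2)] llim_comp[OF assms(2,1)] assms(3,4) llim_id by simp_all
  then have b: "bij (llim F)" by (rule o_bij[rotated])
  obtain S where S: "finite S" "\<And>x. x \<notin> S \<Longrightarrow> \<forall>\<^sub>F u in at_right x. llim F u = u + (llim F x - x)"
    using llim_generic[OF assms(1)] by blast
  have "lstep (\<lambda>x. llim F x - x) S"
    unfolding lstep_def
  proof (intro conjI allI impI)
    fix x
    show "\<forall>\<^sub>F u in at_left x. llim F u - u = llim F x - x"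
      using llim_left[OF assms(1), of x] by (auto elim: eventually_mono)
    show "\<forall>\<^sub>F u in at_right x. llim F u - u = llim F x - x" if "x \<notin> S"
      using S(2)[OF that] by (auto elim: eventually_mono)
  qed
  then show ?thesis by (rule ptI[OF b S(1)])
qed

section \<open>Interval exchanges as piecewise translations of the line\<close>

lemma eventually_avoids_Icc:
  assumes "y \<notin> {a..b::real}" shows "\<forall>\<^sub>F u in at y. u \<notin> {a..b}"
proof -
  have "\<forall>\<^sub>F u in nhds y. u \<in> - {a..b}"
    by (rule eventually_nhds_in_open) (use assms in \<open>auto intro: open_Compl closed_atLeastAtMost\<close>)
  then show ?thesis unfolding eventually_nhds_conv_at by simp
qed

locale iet_domain =
  fixes n :: nat and L :: "nat \<Rightarrow> real" and circ :: "nat \<Rightarrow> bool"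
  assumes dom: "domain_ok n L"
begin

definition off :: "nat \<Rightarrow> real" where "off i = (\<Sum>j<i. L j)"

definition cat :: "nat \<times> real \<Rightarrow> real" where "cat p = off (fst p) + snd p"

definition uncat :: "real \<Rightarrow> nat \<times> real" where "uncat = inv_into (dom_pts n L) cat"

definition line :: "(nat \<times> real \<Rightarrow> nat \<times> real) \<Rightarrow> real \<Rightarrow> real" where
  "line f y = (if y \<in> {0..<off n} then cat (f (uncat y)) else y)"

lemma L_pos: "i < n \<Longrightarrow> L i > 0" using dom by (simp add: domain_ok_def)

lemma off_Suc: "off (Suc i) = off i + L i" by (simp add: off_def)

lemma off_mono: "i \<le> j \<Longrightarrow> j \<le> n \<Longrightarrow> off i \<le> off j"
  unfolding off_def by (rule sum_mono2) (auto intro: less_imp_le[OF L_pos])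

lemma off_0: "off 0 = 0" by (simp add: off_def)

lemma cat_inj: "inj_on cat (dom_pts n L)"
proof (rule inj_onI)
  fix p q assume pq: "p \<in> dom_pts n L" "q \<in> dom_pts n L" and eq: "cat p = cat q"
  have *: False if "p \<in> dom_pts n L" "q \<in> dom_pts n L" "cat p = cat q" "fst p < fst q" for p q
  proof -
    have "off (Suc (fst p)) \<le> off (fst q)" by (rule off_mono) (use that in \<open>auto simp: dom_pts_def\<close>)
    then show False using that by (auto simp: dom_pts_def cat_def off_Suc)
  qed
  have "fst p = fst q" using *[OF pq eq] *[OF pq(2,1) eq[symmetric]] nat_neq_iff by blast
  then show "p = q" using eq by (simp add: cat_def prod_eq_iff)
qed

lemma cat_range: assumes "p \<in> dom_pts n L" shows "cat p \<in> {0..<off n}"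
proof -
  have "off 0 \<le> off (fst p)" "off (Suc (fst p)) \<le> off n"
    using assms by (auto intro!: off_mono simp: dom_pts_def)
  then show ?thesis using assms by (auto simp: cat_def dom_pts_def off_0 off_Suc)
qed

lemma cat_image: "cat ` dom_pts n L = {0..<off n}"
proof
  show "cat ` dom_pts n L \<subseteq> {0..<off n}" using cat_range by blast
  have "m \<le> n \<Longrightarrow> 0 \<le> y \<Longrightarrow> y < off m \<Longrightarrow> \<exists>i<m. off i \<le> y \<and> y < off (Suc i)" for y m
  proof (induction m)
    case (Suc m)
    then show ?case
    proof (cases "y < off m")
      case True
      then show ?thesis using Suc by (meson Suc_leD less_SucI)
    qed (use Suc in auto)
  qed (simp add: off_0)
  from this[of n] have "\<exists>i<n. off i \<le> y \<and> y < off (Suc i)" if "y \<in> {0..<off n}" for y using that by simp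
  then show "{0..<off n} \<subseteq> cat ` dom_pts n L"
  proof (intro subsetI)
    fix y assume "y \<in> {0..<off n}"
    then obtain i where i: "i < n" "off i \<le> y" "y < off (Suc i)"
      using \<open>\<And>y. y \<in> {0..<off n} \<Longrightarrow> \<exists>i<n. off i \<le> y \<and> y < off (Suc i)\<close> by blast
    then have "(i, y - off i) \<in> dom_pts n L" by (simp add: dom_pts_def off_Suc)
    moreover have "y = cat (i, y - off i)" by (simp add: cat_def)
    ultimately show "y \<in> cat ` dom_pts n L" by blast
  qed
qed

lemma uncat_cat: "p \<in> dom_pts n L \<Longrightarrow> uncat (cat p) = p"
  unfolding uncat_def by (rule inv_into_f_f[OF cat_inj])

lemma cat_uncat: "y \<in> {0..<off n} \<Longrightarrow> cat (uncat y) = y"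
  and uncat_dom: "y \<in> {0..<off n} \<Longrightarrow> uncat y \<in> dom_pts n L"
  unfolding uncat_def cat_image[symmetric] by (auto intro: f_inv_into_f inv_into_into)

lemma line_cat: "p \<in> dom_pts n L \<Longrightarrow> line f (cat p) = cat (f p)"
  using cat_range uncat_cat by (simp add: line_def)

lemma shift_dom:
  assumes "(i, x) \<in> dom_pts n L" "0 \<le> x + t" "x + t < L i"
  shows "shift L circ (i, x) t = (i, x + t)" "(i, x + t) \<in> dom_pts n L"
proof -
  have Li: "L i > 0" using assms(1) by (auto simp: dom_pts_def intro: L_pos)
  then have "0 \<le> (x + t) / L i" "(x + t) / L i < 1" using assms by auto
  then have "\<lfloor>(x + t) / L i\<rfloor> = 0" by (simp add: floor_eq_iff)
  then show "shift L circ (i, x) t = (i, x + t)" by (simp add: shift_def)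
  show "(i, x + t) \<in> dom_pts n L" using assms by (auto simp: dom_pts_def)
qed

lemma IET_bij: assumes "is_IET n L circ f" shows "bij f"
proof -
  have b: "bij_betw f (dom_pts n L) (dom_pts n L)" and o: "\<And>p. p \<notin> dom_pts n L \<Longrightarrow> f p = p"
    using assms by (auto simp: is_IET_def)
  have "bij_betw f (- dom_pts n L) (- dom_pts n L)"
    by (rule bij_betw_cong[THEN iffD2, OF _ bij_betw_id]) (simp add: o)
  with b have "bij_betw f (dom_pts n L \<union> - dom_pts n L) (dom_pts n L \<union> - dom_pts n L)"
    by (rule bij_betw_combine) auto
  then show ?thesis by simp
qed

lemma IET_dom: assumes "is_IET n L circ f" shows "f p \<in> dom_pts n L \<longleftrightarrow> p \<in> dom_pts n L"
  using assms unfolding is_IET_def by (metis bij_betwE)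

lemma line_bij: assumes "is_IET n L circ f" shows "bij (line f)"
proof -
  have b: "bij_betw f (dom_pts n L) (dom_pts n L)" using assms by (simp add: is_IET_def)
  have c: "bij_betw cat (dom_pts n L) {0..<off n}" using cat_inj cat_image by (simp add: bij_betw_def)
  have u: "bij_betw uncat {0..<off n} (dom_pts n L)" unfolding uncat_def by (rule bij_betw_inv_into[OF c])
  have "bij_betw (line f) {0..<off n} {0..<off n}"
    using bij_betw_trans[OF bij_betw_trans[OF u b] c]
    by (rule bij_betw_cong[THEN iffD1, rotated]) (simp add: line_def)
  moreover have "bij_betw (line f) (- {0..<off n}) (- {0..<off n})"
    by (rule bij_betw_cong[THEN iffD2, OF _ bij_betw_id]) (auto simp: line_def)
  ultimately have "bij_betw (line f) ({0..<off n} \<union> - {0..<off n}) ({0..<off n} \<union> - {0..<off n})"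
    by (rule bij_betw_combine) auto
  then show ?thesis by simp
qed

lemma line_comp:
  assumes "is_IET n L circ g" shows "line (f \<circ> g) = line f \<circ> line g"
proof
  fix y
  show "line (f \<circ> g) y = (line f \<circ> line g) y"
  proof (cases "y \<in> {0..<off n}")
    case True
    then have "g (uncat y) \<in> dom_pts n L" using uncat_dom IET_dom[OF assms] by blast
    from line_cat[OF this, of f] show ?thesis using True by (simp add: line_def[of _ y])
  qed (auto simp: line_def)
qed

lemma line_id: "line id = id"
  by (auto simp: line_def fun_eq_iff cat_uncat)

text \<open>The exceptional points are the ends of components, their preimages, and
  \<open>S\<close>. Everywhere else both the point and its image are interior to components, and
  within the radius \<open>e\<close> no shift wraps round a circle or leaves an interval.\<close>

lemma line_ptae: assumes f: "is_IET n L circ f" shows "ptae (line f)"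
proof -
  obtain S where S0: "finite S"
    "\<forall>p\<in>dom_pts n L. \<exists>e>0. \<forall>t. 0 \<le> t \<and> t < e \<and> shift L circ p (-t) \<in> dom_pts n L
       \<longrightarrow> f (shift L circ p (-t)) = shift L circ (f p) (-t)"
    "\<forall>p\<in>dom_pts n L - S. \<exists>e>0. \<forall>t. 0 \<le> t \<and> t < e \<and> shift L circ p t \<in> dom_pts n L
       \<longrightarrow> f (shift L circ p t) = shift L circ (f p) t"
    using f unfolding is_IET_def by (elim conjE exE) (rule that)
  note S = S0(1) bspec[OF S0(2)] bspec[OF S0(3)]
  note b = line_bij[OF f]
  let ?O = "off ` {..n}"
  let ?S = "?O \<union> cat ` S \<union> {y. line f y \<in> ?O}"
  have "finite {y. line f y \<in> ?O}" by (rule finite_bij_vimage[OF b]) simp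
  then have finS: "finite ?S" using S(1) by simp
  have tr: "\<forall>\<^sub>F u in at y. line f u = u + (line f y - y)" if y: "y \<notin> ?S" for y
  proof (cases "y \<in> {0..<off n}")
    case False
    have "0 \<in> ?O" "off n \<in> ?O" using off_0 by force+
    then have "y < 0 \<or> off n < y" using y False by force
    then have "\<forall>\<^sub>F u in at y. u \<notin> {0..off n}" by (intro eventually_avoids_Icc) auto
    then show ?thesis by eventually_elim (use False in \<open>auto simp: line_def\<close>)
  next
    case True
    obtain i x where ix: "uncat y = (i, x)" by (cases "uncat y")
    obtain j x' where jx: "f (i, x) = (j, x')" by (cases "f (i, x)")
    have p: "(i, x) \<in> dom_pts n L" using uncat_dom[OF True] ix by simp
    have q: "(j, x') \<in> dom_pts n L" using IET_dom[OF f, of "(i, x)"] p jx by simp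
    have cy: "cat (i, x) = y" using cat_uncat[OF True] ix by simp
    have Fy: "line f y = cat (j, x')" using line_cat[OF p, of f] cy jx by simp
    have ij: "i < n" "j < n" using p q by (auto simp: dom_pts_def)
    have pS: "(i, x) \<notin> S" using y cy by force
    have "y \<noteq> off i" "line f y \<noteq> off j" using y ij by auto
    then have pos: "0 < x" "x < L i" "0 < x'" "x' < L j"
      using p q cy Fy by (auto simp: dom_pts_def cat_def)
    obtain e1 where e1: "e1 > 0" "\<And>t. 0 \<le> t \<Longrightarrow> t < e1 \<Longrightarrow> shift L circ (i, x) (-t) \<in> dom_pts n L
       \<Longrightarrow> f (shift L circ (i, x) (-t)) = shift L circ (j, x') (-t)" using S(2)[OF p] jx by auto
    obtain e2 where e2: "e2 > 0" "\<And>t. 0 \<le> t \<Longrightarrow> t < e2 \<Longrightarrow> shift L circ (i, x) t \<in> dom_pts n L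
       \<Longrightarrow> f (shift L circ (i, x) t) = shift L circ (j, x') t" using S(3)[of "(i, x)"] p pS jx by auto
    define e where "e = min (min e1 e2) (min (min x (L i - x)) (min x' (L j - x')))"
    have e: "e > 0" "e \<le> e1" "e \<le> e2" "e \<le> x" "e \<le> L i - x" "e \<le> x'" "e \<le> L j - x'"
      unfolding e_def using pos e1(1) e2(1) by simp_all
    have *: "line f (y + t) = line f y + t" if t: "\<bar>t\<bar> < e" for t
    proof -
      have s1: "shift L circ (i, x) t = (i, x + t)" "(i, x + t) \<in> dom_pts n L"
        by (rule shift_dom[OF p]; use t e in linarith)+
      have s2: "shift L circ (j, x') t = (j, x' + t)"
        by (rule shift_dom[OF q]; use t e in linarith)
      have "f (i, x + t) = (j, x' + t)"
      proof (cases "t \<ge> 0")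
        case True
        then show ?thesis using e2(2)[of t] s1 s2 t e by simp
      next
        case False
        then show ?thesis using e1(2)[of "- t"] s1 s2 t e by simp
      qed
      then have "line f (cat (i, x + t)) = cat (j, x' + t)" using line_cat[OF s1(2)] by simp
      then show ?thesis using cy Fy by (simp add: cat_def algebra_simps)
    qed
    show ?thesis
      unfolding eventually_at
    proof (intro exI[of _ e] conjI ballI impI)
      fix u assume "u \<noteq> y \<and> dist u y < e"
      then show "line f u = u + (line f y - y)" using *[of "u - y"] by (simp add: dist_real_def)
    qed (rule e(1))
  qed
  show ?thesis
    unfolding ptae_def by (intro conjI exI[of _ ?S] allI impI b finS tr)
qed

text \<open>A point without left neighbours can only be the image of such a point, and there are finitely
  many of them, so f permutes them; hence left continuity passes to the inverse.\<close>

lemma IET_inv: assumes f: "is_IET n L circ f" shows "is_IET n L circ (inv' f)"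
proof -
  obtain S where S0: "finite S"
    "\<forall>p\<in>dom_pts n L. \<exists>e>0. \<forall>t. 0 \<le> t \<and> t < e \<and> shift L circ p (-t) \<in> dom_pts n L
       \<longrightarrow> f (shift L circ p (-t)) = shift L circ (f p) (-t)"
    "\<forall>p\<in>dom_pts n L - S. \<exists>e>0. \<forall>t. 0 \<le> t \<and> t < e \<and> shift L circ p t \<in> dom_pts n L
       \<longrightarrow> f (shift L circ p t) = shift L circ (f p) t"
    using f unfolding is_IET_def by (elim conjE exE) (rule that)
  note S = S0(1) bspec[OF S0(2)] bspec[OF S0(3)]
  note b = IET_bij[OF f]
  note c = bij_cancel[OF b]
  have D: "inv' f q \<in> dom_pts n L \<longleftrightarrow> q \<in> dom_pts n L" for q
    using IET_dom[OF f, of "inv' f q"] c by simp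
  define Z where "Z = {(i, 0::real) | i. i < n \<and> \<not> circ i}"
  have "Z \<subseteq> (\<lambda>i. (i, 0)) ` {..<n}" by (auto simp: Z_def)
  then have finZ: "finite Z" by (rule finite_subset) simp
  have Zdom: "Z \<subseteq> dom_pts n L" using L_pos by (auto simp: Z_def dom_pts_def)
  have left: "\<exists>e>0. \<forall>t. 0 \<le> t \<and> t < e \<longrightarrow> shift L circ p (- t) \<in> dom_pts n L"
    if p: "p \<in> dom_pts n L" "p \<notin> Z" for p
  proof -
    obtain i x where ix: "p = (i, x)" by (cases p)
    have i: "i < n" "0 \<le> x" "x < L i" using p ix by (auto simp: dom_pts_def)
    show ?thesis
    proof (cases "circ i")
      case True
      have "shift L circ p (- t) \<in> dom_pts n L" for t
      proof -
        have Li: "L i > 0" using i by simp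
        let ?r = "(x - t) / L i"
        have "x - t = L i * ?r" using Li by simp
        moreover have "of_int \<lfloor>?r\<rfloor> \<le> ?r" "?r < of_int \<lfloor>?r\<rfloor> + 1" by linarith+
        then have "L i * of_int \<lfloor>?r\<rfloor> \<le> L i * ?r" "L i * ?r < L i * (of_int \<lfloor>?r\<rfloor> + 1)"
          using Li by (simp_all only: mult_le_cancel_left_pos mult_less_cancel_left_pos)
        ultimately have "0 \<le> x - t - L i * of_int \<lfloor>?r\<rfloor>" "x - t - L i * of_int \<lfloor>?r\<rfloor> < L i"
          by (simp_all add: algebra_simps)
        then show ?thesis using True i ix by (simp add: shift_def dom_pts_def)
      qed
      then show ?thesis by (intro exI[of _ 1]) simp
    next
      case False
      then have "x > 0" using p ix i by (cases "x = 0") (auto simp: Z_def)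
      then show ?thesis using False i ix by (intro exI[of _ x]) (auto simp: shift_def dom_pts_def)
    qed
  qed
  have invZ: "inv' f ` Z \<subseteq> Z"
  proof
    fix p assume "p \<in> inv' f ` Z"
    then have fp: "f p \<in> Z" using c by auto
    have p: "p \<in> dom_pts n L" using fp Zdom IET_dom[OF f] by blast
    show "p \<in> Z"
    proof (rule ccontr)
      assume "p \<notin> Z"
      then obtain e where e: "e > 0" "\<And>t. 0 \<le> t \<Longrightarrow> t < e \<Longrightarrow> shift L circ p (- t) \<in> dom_pts n L"
        using left[OF p] by blast
      obtain e' where e': "e' > 0" "\<And>t. 0 \<le> t \<Longrightarrow> t < e' \<Longrightarrow> shift L circ p (- t) \<in> dom_pts n L
        \<Longrightarrow> f (shift L circ p (-t)) = shift L circ (f p) (-t)" using S(2)[OF p] by blast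
      let ?t = "min e e' / 2"
      have t: "?t > 0" "?t < e" "?t < e'" using e(1) e'(1) by auto
      then have "shift L circ p (- ?t) \<in> dom_pts n L" using e(2) by simp
      then have "shift L circ (f p) (- ?t) \<in> dom_pts n L"
        using e'(2)[of ?t] t IET_dom[OF f, of "shift L circ p (- ?t)"] by simp
      then show False using fp t(1) by (auto simp: Z_def shift_def dom_pts_def)
    qed
  qed
  have "inj (inv' f)" using bij_imp_bij_inv[OF b] by (rule bij_is_inj)
  then have Zeq: "inv' f ` Z = Z"
    using endo_inj_surj[OF finZ invZ] inj_on_subset by blast
  have Zf: "f q \<in> Z" if q: "q \<in> Z" for q
  proof -
    obtain r where "r \<in> Z" "q = inv' f r" using q Zeq by blast
    then show ?thesis using c by simp
  qed
  have shift0: "shift L circ p 0 = p" if "p \<in> dom_pts n L" for p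
    using shift_dom(1)[of "fst p" "snd p" 0] that by (auto simp: dom_pts_def)
  have Zshift: "t = 0" if "q \<in> Z" "0 \<le> t" "shift L circ q (- t) \<in> dom_pts n L" for q t
    using that by (auto simp: Z_def shift_def dom_pts_def)
  show ?thesis
    unfolding is_IET_def
  proof (intro conjI allI impI exI[of _ "f ` S"] ballI)
    show "bij_betw (inv' f) (dom_pts n L) (dom_pts n L)"
      by (rule bij_betw_byWitness[where f'=f]) (use D c IET_dom[OF f] in auto)
    show "inv' f p = p" if "p \<notin> dom_pts n L" for p
      using that f c unfolding is_IET_def by metis
    show "finite (f ` S)" using S(1) by simp
  next
    fix q assume q: "q \<in> dom_pts n L"
    let ?p = "inv' f q"
    have p: "?p \<in> dom_pts n L" using D q by simp
    show "\<exists>e>0. \<forall>t. 0 \<le> t \<and> t < e \<and> shift L circ q (- t) \<in> dom_pts n L \<longrightarrow>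
        inv' f (shift L circ q (- t)) = shift L circ ?p (- t)"
    proof (cases "q \<in> Z")
      case True
      have "inv' f (shift L circ q (- t)) = shift L circ ?p (- t)"
        if "0 \<le> t" "shift L circ q (- t) \<in> dom_pts n L" for t
        using Zshift[OF True that] shift0[OF q] shift0[OF p] by simp
      then show ?thesis by (intro exI[of _ 1]) simp
    next
      case False
      then have "?p \<notin> Z" using Zf[of ?p] c by auto
      then obtain e where e: "e > 0" "\<And>t. 0 \<le> t \<Longrightarrow> t < e \<Longrightarrow> shift L circ ?p (- t) \<in> dom_pts n L"
        using left[OF p] by blast
      obtain e' where e': "e' > 0" "\<And>t. 0 \<le> t \<Longrightarrow> t < e' \<Longrightarrow> shift L circ ?p (- t) \<in> dom_pts n L
        \<Longrightarrow> f (shift L circ ?p (-t)) = shift L circ (f ?p) (-t)" using S(2)[OF p] by blast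
      have "inv' f (shift L circ q (- t)) = shift L circ ?p (- t)" if "0 \<le> t" "t < min e e'" for t
      proof -
        have "f (shift L circ ?p (- t)) = shift L circ q (- t)" using e(2)[of t] e'(2)[of t] that c by simp
        then show ?thesis using c by metis
      qed
      then show ?thesis using e(1) e'(1) by (intro exI[of _ "min e e'"]) auto
    qed
  next
    fix q assume q: "q \<in> dom_pts n L - f ` S"
    let ?p = "inv' f q"
    have "?p \<notin> S"
    proof
      assume "?p \<in> S"
      then have "f ?p \<in> f ` S" by (rule imageI)
      then show False using q c by simp
    qed
    then have p: "?p \<in> dom_pts n L - S" using D q by simp
    obtain i x where ix: "?p = (i, x)" by (cases ?p)
    have i: "(i, x) \<in> dom_pts n L" "0 \<le> x" "x < L i" using p ix by (auto simp: dom_pts_def)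
    obtain e where e: "e > 0" "\<And>t. 0 \<le> t \<Longrightarrow> t < e \<Longrightarrow> shift L circ ?p t \<in> dom_pts n L
        \<Longrightarrow> f (shift L circ ?p t) = shift L circ (f ?p) t" using S(3)[OF p] by blast
    \<comment> \<open>Components are open on the right, so every point has right neighbours up to
      distance L i - x.\<close>
    have "inv' f (shift L circ q t) = shift L circ ?p t" if t: "0 \<le> t" "t < min e (L i - x)" for t
    proof -
      have "shift L circ ?p t \<in> dom_pts n L"
        unfolding ix using shift_dom[OF i(1), of t] i t by simp
      then have "f (shift L circ ?p t) = shift L circ q t" using e(2)[of t] t c by simp
      then show ?thesis using c by metis
    qed
    then show "\<exists>e>0. \<forall>t. 0 \<le> t \<and> t < e \<and> shift L circ q t \<in> dom_pts n L \<longrightarrow>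
        inv' f (shift L circ q t) = shift L circ ?p t"
      using e(1) i(3) by (intro exI[of _ "min e (L i - x)"]) auto
  qed
qed

section \<open>The homomorphism from interval exchanges to piecewise translations\<close>

definition germ :: "(nat \<times> real \<Rightarrow> nat \<times> real) \<Rightarrow> real \<Rightarrow> real" where
  "germ f = llim (line f)"

lemma germ_comp: "is_IET n L circ f \<Longrightarrow> is_IET n L circ g \<Longrightarrow> germ (f \<circ> g) = germ f \<circ> germ g"
  unfolding germ_def by (simp add: line_comp llim_comp line_ptae)

lemma germ_id: "germ id = id"
  by (simp add: germ_def line_id llim_id)

lemma inv_comp_id: "bij (f :: 'c \<Rightarrow> 'c) \<Longrightarrow> f \<circ> inv' f = id" "bij f \<Longrightarrow> inv' f \<circ> f = id"
  by (simp_all add: fun_eq_iff bij_cancel[of f])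

lemma germ_pt: assumes "is_IET n L circ f" shows "pt (germ f)"
  unfolding germ_def
proof (rule pt_llim[OF line_ptae[OF assms] line_ptae[OF IET_inv[OF assms]]])
  show "line f \<circ> line (inv' f) = id" "line (inv' f) \<circ> line f = id"
    using line_comp[OF IET_inv[OF assms], of f] line_comp[OF assms, of "inv' f"] line_id
      inv_comp_id[OF IET_bij[OF assms]] by simp_all
qed

lemma germ_inv: assumes "is_IET n L circ f" shows "germ (inv' f) = inv' (germ f)"
proof (rule inv_unique_comp[symmetric])
  show "germ f \<circ> germ (inv' f) = id" "germ (inv' f) \<circ> germ f = id"
    using germ_comp[OF assms IET_inv[OF assms]] germ_comp[OF IET_inv[OF assms] assms]
      inv_comp_id[OF IET_bij[OF assms]] germ_id by simp_all
qed

lemma germ_supp: assumes "y \<notin> {0..off n}" shows "germ f y = y"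
  unfolding germ_def
proof (rule llim_eqI)
  have "\<forall>\<^sub>F u in at_left y. u \<notin> {0..off n}"
    using eventually_avoids_Icc[OF assms] by (simp add: eventually_at_split)
  then show "\<forall>\<^sub>F u in at_left y. line f u = u + (y - y)" by eventually_elim (auto simp: line_def)
qed

text \<open>A trivial germ means that \<open>line f\<close> fixes all but finitely many points, so f
  has finite support. Under torsion-freeness the kernel of \<open>germ\<close> is therefore
  trivial.\<close>

lemma germ_id_torsion:
  assumes f: "is_IET n L circ f" and g: "germ f = id" shows "\<exists>k>0. f ^^ k = id"
proof -
  obtain S where S: "finite S" "\<And>x. x \<notin> S \<Longrightarrow> llim (line f) x = line f x"
    using llim_generic[OF line_ptae[OF f]] by blast
  have "{p. f p \<noteq> p} \<subseteq> uncat ` S"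
  proof
    fix p assume "p \<in> {p. f p \<noteq> p}"
    then have fp: "f p \<noteq> p" by simp
    then have p: "p \<in> dom_pts n L" using f unfolding is_IET_def by blast
    then have "cat (f p) \<noteq> cat p" using fp inj_onD[OF cat_inj, of "f p" p] IET_dom[OF f, of p] by blast
    then have "line f (cat p) \<noteq> cat p" by (simp add: line_cat[OF p])
    then have "cat p \<in> S" using S(2)[of "cat p"] g by (auto simp: germ_def)
    then show "p \<in> uncat ` S" using uncat_cat[OF p] by force
  qed
  then have "finite {p. f p \<noteq> p}" using S(1) by (meson finite_imageI finite_subset)
  then have "permutation f" using IET_bij[OF f] by (simp add: permutation)
  then show ?thesis using permutation_is_nilpotent[of f] by metis
qed

end

section \<open>The theorem\<close>

lemma (in group) exp_of_derived_normal:
  "(derived G ^^ i) (carrier G) \<lhd> G"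
proof (induction i)
  case 0
  show ?case by (simp add: normal_inv_iff subgroup_self)
next
  case (Suc i)
  then show ?case using derived_is_normal by simp
qed

locale iet_subgroup = iet_domain +
  fixes H :: "(nat \<times> real \<Rightarrow> nat \<times> real) set"
  assumes sub: "subgroup H (IET_group n L circ)"
begin

abbreviation GH :: "(nat \<times> real \<Rightarrow> nat \<times> real) monoid" where
  "GH \<equiv> (IET_group n L circ)\<lparr>carrier := H\<rparr>"

lemma H_IET: "f \<in> H \<Longrightarrow> is_IET n L circ f"
  using subgroup.subset[OF sub] by (auto simp: IET_group_def)

lemma H_comp: "f \<in> H \<Longrightarrow> g \<in> H \<Longrightarrow> f \<circ> g \<in> H"
  using subgroup.m_closed[OF sub] by (simp add: IET_group_def)

lemma H_id: "id \<in> H"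
  using subgroup.one_closed[OF sub] by (simp add: IET_group_def)

lemma H_bij: "f \<in> H \<Longrightarrow> bij f" using H_IET IET_bij by blast

lemma H_inv: assumes f: "f \<in> H" shows "inv' f \<in> H"
proof -
  note c = inv_comp_id[OF H_bij[OF f]]
  have "inv\<^bsub>IET_group n L circ\<^esub> f = inv' f"
    unfolding m_inv_def
  proof (rule the_equality)
    show "inv' f \<in> carrier (IET_group n L circ) \<and>
        f \<otimes>\<^bsub>IET_group n L circ\<^esub> inv' f = \<one>\<^bsub>IET_group n L circ\<^esub> \<and>
        inv' f \<otimes>\<^bsub>IET_group n L circ\<^esub> f = \<one>\<^bsub>IET_group n L circ\<^esub>"
      using c IET_inv[OF H_IET[OF f]] by (simp add: IET_group_def)
    fix y assume "y \<in> carrier (IET_group n L circ) \<and>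
        f \<otimes>\<^bsub>IET_group n L circ\<^esub> y = \<one>\<^bsub>IET_group n L circ\<^esub> \<and>
        y \<otimes>\<^bsub>IET_group n L circ\<^esub> f = \<one>\<^bsub>IET_group n L circ\<^esub>"
    then have "f \<circ> y = id" "y \<circ> f = id" by (auto simp: IET_group_def)
    then show "y = inv' f" by (rule inv_unique_comp[symmetric])
  qed
  then show ?thesis using subgroup.m_inv_closed[OF sub f] by simp
qed

lemma GH_simps: "carrier GH = H" "f \<otimes>\<^bsub>GH\<^esub> g = f \<circ> g" "\<one>\<^bsub>GH\<^esub> = id"
    "f \<otimes>\<^bsub>IET_group n L circ\<^esub> g = f \<circ> g" "\<one>\<^bsub>IET_group n L circ\<^esub> = id"
  by (simp_all add: IET_group_def)

lemma GH_group: "group GH"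
proof (rule groupI)
  fix f assume "f \<in> carrier GH"
  then have f: "f \<in> H" by simp
  show "\<exists>g\<in>carrier GH. g \<otimes>\<^bsub>GH\<^esub> f = \<one>\<^bsub>GH\<^esub>"
    unfolding GH_simps using H_inv[OF f] inv_comp_id(2)[OF H_bij[OF f]] by blast
qed (auto simp: GH_simps H_comp H_id o_assoc)

lemma GH_inv: assumes "f \<in> H" shows "inv\<^bsub>GH\<^esub> f = inv' f"
proof (rule group.inv_equality[OF GH_group])
  show "inv' f \<otimes>\<^bsub>GH\<^esub> f = \<one>\<^bsub>GH\<^esub>" using inv_comp_id(2)[OF H_bij[OF assms]] by (simp only: GH_simps)
qed (simp_all add: assms H_inv)

lemma GH_pow: "f [^]\<^bsub>GH\<^esub> (k::nat) = f ^^ k"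
proof (induction k)
  case (Suc k)
  have "f [^]\<^bsub>GH\<^esub> Suc k = f ^^ k \<circ> f"
    unfolding monoid.nat_pow_Suc[OF group.is_monoid[OF GH_group]] Suc by (rule GH_simps(2))
  then show ?case by (simp only: funpow_Suc_right)
qed (simp add: IET_group_def nat_pow_def id_def)

lemma H_funpow: "f \<in> H \<Longrightarrow> f ^^ k \<in> H"
  by (induction k) (auto intro: H_comp H_id simp: H_id[unfolded id_def])

lemma germ_funpow: "f \<in> H \<Longrightarrow> germ (f ^^ k) = germ f ^^ k"
proof (induction k)
  case (Suc k)
  have "germ (f \<circ> f ^^ k) = germ f \<circ> germ (f ^^ k)"
    by (rule germ_comp[OF H_IET H_IET]) (use Suc H_funpow in auto)
  then show ?case using Suc by (simp only: funpow.simps(2))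
qed (simp add: germ_id[unfolded id_def] id_def)

end

lemma (in iet_subgroup) virtually_abelian_GH:
  assumes fg: "finitely_generated_group GH" and tf: "torsion_free_group GH" and solv: "solvable GH"
  shows "virtually_abelian GH"
proof -
  interpret GH: group GH by (rule GH_group)
  have torsion: "f = id" if "f \<in> H" "k > 0" "f ^^ k = id" for f k
    using tf that unfolding torsion_free_group_def GH_pow GH_simps by blast
  have inj: "f = id" if f: "f \<in> H" "germ f = id" for f
    using germ_id_torsion[OF H_IET[OF f(1)] f(2)] torsion[OF f(1)] by blast
  have gc: "germ a \<circ> germ b = germ (a \<circ> b)" if "a \<in> H" "b \<in> H" for a b
    using germ_comp[OF H_IET[OF that(1)] H_IET[OF that(2)]] by (rule sym)
  have gi: "inv' (germ a) = germ (inv' a)" if "a \<in> H" for a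
    using germ_inv[OF H_IET[OF that]] by (rule sym)
  let ?G = "germ ` H"
  have Gpt: "pt g" if "g \<in> ?G" for g using that germ_pt H_IET by blast
  have Gcomp: "g \<circ> h \<in> ?G" if "g \<in> ?G" "h \<in> ?G" for g h
  proof -
    obtain a b where "a \<in> H" "b \<in> H" "g = germ a" "h = germ b" using \<open>g \<in> ?G\<close> \<open>h \<in> ?G\<close> by blast
    then have "g \<circ> h = germ (a \<circ> b)" "a \<circ> b \<in> H" using germ_comp[OF H_IET H_IET] H_comp by auto
    then show ?thesis by blast
  qed
  have Gid: "id \<in> ?G" using germ_id H_id by (metis image_eqI)
  have Ginv: "inv' g \<in> ?G" if "g \<in> ?G" for g
  proof -
    obtain a where "a \<in> H" "g = germ a" using \<open>g \<in> ?G\<close> by blast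
    then have "inv' g = germ (inv' a)" "inv' a \<in> H" using germ_inv[OF H_IET] H_inv by auto
    then show ?thesis by blast
  qed
  obtain Gs where Gs: "finite Gs" "Gs \<subseteq> H" "generate GH Gs = H"
    using fg by (auto simp: finitely_generated_group_def)
  \<comment> \<open>A discontinuity of a product f g is one of g, or is moved by g to one of f. By
    induction on words every discontinuity lies in the orbit of one belonging to a generator or its
    inverse.\<close>
  define \<Sigma> where "\<Sigma> = (\<Union>x\<in>Gs. disc (germ x) \<union> disc (inv' (germ x)))"
  have gen: "f \<in> H \<and> (\<forall>q\<in>disc (germ f). \<exists>h\<in>?G. \<exists>s\<in>\<Sigma>. q = h s)" if "f \<in> generate GH Gs" for f
    using that
  proof (induction rule: generate.induct)
    case one
    have "disc id = {}" unfolding disc_def rgt_id by simp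
    then show ?case using H_id unfolding GH_simps germ_id by blast
  next
    case (incl f)
    then have "disc (germ f) \<subseteq> \<Sigma>" by (auto simp: \<Sigma>_def)
    then show ?case using incl Gs(2) Gid by (metis id_apply subsetD)
  next
    case (inv f)
    have f: "f \<in> H" using inv Gs(2) by blast
    have "disc (germ (inv' f)) \<subseteq> \<Sigma>" using inv germ_inv[OF H_IET[OF f]] by (auto simp: \<Sigma>_def)
    then show ?case using H_inv[OF f] Gid unfolding GH_inv[OF f] by (metis id_apply subsetD)
  next
    case (eng f g)
    then have fg: "f \<in> H" "g \<in> H" by auto
    note pg = germ_pt[OF H_IET[OF fg(2)]] and pf = germ_pt[OF H_IET[OF fg(1)]]
    have "\<exists>h\<in>?G. \<exists>s\<in>\<Sigma>. q = h s" if "q \<in> disc (germ (f \<circ> g))" for q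
    proof -
      have "q \<in> disc (germ g) \<or> germ g q \<in> disc (germ f)"
        using that disc_comp[OF pf pg] germ_comp[OF H_IET H_IET, OF fg] by auto
      then show ?thesis
      proof
        assume "germ g q \<in> disc (germ f)"
        then obtain h s where h: "h \<in> ?G" "s \<in> \<Sigma>" "germ g q = h s" using eng by blast
        then have "q = (inv' (germ g) \<circ> h) s" using pt_inv_simps(1)[OF pg, of q] by simp
        moreover have "inv' (germ g) \<circ> h \<in> ?G" using Gcomp[OF Ginv h(1)] fg(2) by blast
        ultimately show ?thesis using h(2) by blast
      qed (use eng in blast)
    qed
    then show ?case using H_comp[OF fg] unfolding GH_simps by blast
  qed
  have ptg: "pt_group ?G (off n) \<Sigma>"
  proof
    show "finite \<Sigma>"
      unfolding \<Sigma>_def using Gs(1)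
    proof (intro finite_UN_I finite_UnI)
      fix x assume "x \<in> Gs"
      then have "pt (germ x)" using Gs(2) Gpt by blast
      then show "finite (disc (germ x))" "finite (disc (inv' (germ x)))"
        by (auto intro: pt_disc(1) pt_inv)
    qed
    show "g x = x" if "g \<in> ?G" "x \<notin> {0..off n}" for g x using that germ_supp by blast
    show "g = id" if "g \<in> ?G" "k > 0" "g ^^ k = id" for g k
    proof -
      obtain f where f: "f \<in> H" "g = germ f" using \<open>g \<in> ?G\<close> by blast
      have "f ^^ k = id" using inj[OF H_funpow[OF f(1)]] germ_funpow[OF f(1)] that(3) f(2) by simp
      then show ?thesis using torsion[OF f(1) that(2)] f(2) germ_id by simp
    qed
    show "\<exists>h\<in>?G. \<exists>s\<in>\<Sigma>. q = h s" if "g \<in> ?G" "q \<in> disc g" for g q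
    proof -
      obtain f where "f \<in> H" "g = germ f" using \<open>g \<in> ?G\<close> by blast
      then show ?thesis using gen[of f] Gs(3) that(2) by blast
    qed
  qed (rule Gpt Gid Gcomp Ginv; assumption)+
  let ?D = "\<lambda>i. (derived GH ^^ i) H"
  obtain d where d: "?D d = {id}"
    using GH.solvable_imp_trivial_derived_seq[OF solv[unfolded solvable_def]] by (auto simp: GH_simps)
  have norm: "?D i \<lhd> GH" for i using GH.exp_of_derived_normal[of i] by (simp add: GH_simps)
  have Dsub: "subgroup (?D i) GH" for i by (rule normal_imp_subgroup[OF norm])
  have DH: "?D i \<subseteq> H" for i using subgroup.subset[OF Dsub] by simp
  have chain: "derived_chain d (\<lambda>i. germ ` ?D i) ?G"
    unfolding derived_chain_def
  proof (intro conjI allI impI ballI)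
    show "germ ` ?D 0 = ?G" by simp
    show "germ ` ?D d = {id}" using d germ_id by simp
    fix i
    have Dc: "a \<circ> b \<in> ?D i" if "a \<in> ?D i" "b \<in> ?D i" for a b
      using subgroup.m_closed[OF Dsub that] by (simp only: GH_simps)
    have Di: "inv' a \<in> ?D i" if "a \<in> ?D i" for a
      using subgroup.m_inv_closed[OF Dsub that] unfolding GH_inv[OF subsetD[OF DH that]] .
    have Dn: "g \<circ> a \<circ> inv' g \<in> ?D i" if "g \<in> H" "a \<in> ?D i" for g a
    proof -
      have "g \<in> carrier GH" using that(1) by simp
      from normal.inv_op_closed2[OF norm this that(2)] show ?thesis
        unfolding GH_inv[OF that(1)] unfolding GH_simps .
    qed
    have D1: "id \<in> ?D i" using subgroup.one_closed[OF Dsub] by (simp only: GH_simps)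
    show "nsub (germ ` ?D i) ?G"
      unfolding nsub_def
    proof (intro conjI ballI)
      show "germ ` ?D i \<subseteq> ?G" using DH by blast
      show "id \<in> germ ` ?D i" using D1 germ_id by (metis image_eqI)
    next
      fix x y assume "x \<in> germ ` ?D i" "y \<in> germ ` ?D i"
      then obtain a b where ab: "a \<in> ?D i" "b \<in> ?D i" "x = germ a" "y = germ b" by blast
      then have "x \<circ> y = germ (a \<circ> b)" using germ_comp[OF H_IET H_IET, of a b] subsetD[OF DH] by simp
      then show "x \<circ> y \<in> germ ` ?D i" using Dc ab by blast
    next
      fix x assume "x \<in> germ ` ?D i"
      then obtain a where a: "a \<in> ?D i" "x = germ a" by blast
      then have "inv' x = germ (inv' a)" using germ_inv[OF H_IET, of a] subsetD[OF DH] by simp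
      then show "inv' x \<in> germ ` ?D i" using Di a by blast
    next
      fix x y assume "x \<in> ?G" "y \<in> germ ` ?D i"
      then obtain g a where ga: "g \<in> H" "a \<in> ?D i" "x = germ g" "y = germ a" by blast
      have aH: "a \<in> H" using ga(2) DH by blast
      have "x \<circ> y \<circ> inv' x = germ (g \<circ> a \<circ> inv' g)"
        unfolding ga(3,4) by (simp only: gi gc ga(1) aH H_comp H_inv)
      then show "x \<circ> y \<circ> inv' x \<in> germ ` ?D i" using Dn[OF ga(1,2)] by blast
    qed
    fix x y assume "x \<in> germ ` ?D i" "y \<in> germ ` ?D i"
    then obtain a b where ab: "a \<in> ?D i" "b \<in> ?D i" "x = germ a" "y = germ b" by blast
    then have H: "a \<in> H" "b \<in> H" using DH by blast+
    have "a \<otimes>\<^bsub>GH\<^esub> b \<otimes>\<^bsub>GH\<^esub> inv\<^bsub>GH\<^esub> a \<otimes>\<^bsub>GH\<^esub> inv\<^bsub>GH\<^esub> b \<in> derived GH (?D i)"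
      unfolding derived_def[of GH "?D i"]
      by (rule generate.incl, rule UN_I[OF ab(1)], rule UN_I[OF ab(2)], rule singletonI)
    then have "a \<circ> b \<circ> inv' a \<circ> inv' b \<in> ?D (Suc i)"
      by (simp only: GH_simps GH_inv[OF H(1)] GH_inv[OF H(2)] funpow.simps(2) comp_apply)
    moreover have "x \<circ> y \<circ> inv' x \<circ> inv' y = germ (a \<circ> b \<circ> inv' a \<circ> inv' b)"
      unfolding ab(3,4) by (simp only: gi gc H H_comp H_inv)
    ultimately show "x \<circ> y \<circ> inv' x \<circ> inv' y \<in> germ ` ?D (Suc i)" by blast
  qed
  obtain K' where K': "comm_fin_index K' ?G" using pt_group_virtually_commutative[OF ptg chain] ..
  note K'D = K'[unfolded comm_fin_index_def]
  define K where "K = {f \<in> H. germ f \<in> K'}"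
  have KS: "subgroup K GH"
  proof
    show "K \<subseteq> carrier GH" by (auto simp: K_def)
    show "\<one>\<^bsub>GH\<^esub> \<in> K" unfolding GH_simps K_def using K'D H_id germ_id by simp
    fix a assume a: "a \<in> K"
    then have aH: "a \<in> H" "germ a \<in> K'" by (auto simp: K_def)
    show "inv\<^bsub>GH\<^esub> a \<in> K"
      unfolding GH_inv[OF aH(1)] K_def using H_inv[OF aH(1)] germ_inv[OF H_IET[OF aH(1)]] K'D aH(2) by simp
    fix b assume "b \<in> K"
    then show "a \<otimes>\<^bsub>GH\<^esub> b \<in> K"
      unfolding GH_simps using aH germ_comp[OF H_IET H_IET, of a b] H_comp[of a b] K'D by (simp add: K_def)
  qed
  have comm: "a \<otimes>\<^bsub>GH\<^esub> b = b \<otimes>\<^bsub>GH\<^esub> a" if "a \<in> K" "b \<in> K" for a b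
  proof -
    have ab: "a \<in> H" "b \<in> H" "germ a \<in> K'" "germ b \<in> K'" using that by (auto simp: K_def)
    have "germ a \<circ> germ b = germ b \<circ> germ a" using K'D ab(3,4) by blast
    then have "germ (a \<circ> b) = germ (b \<circ> a)" using germ_comp[OF H_IET H_IET] ab(1,2) by simp
    \<comment> \<open>\<open>inj\<close> concerns the kernel only, so equality of germs is used
      through the quotient of the two products.\<close>
    then have "germ (a \<circ> b \<circ> inv' (b \<circ> a)) = germ (b \<circ> a) \<circ> germ (inv' (b \<circ> a))"
      using germ_comp[OF H_IET H_IET, of "a \<circ> b" "inv' (b \<circ> a)"] H_comp H_inv ab(1,2) by simp
    also have "\<dots> = germ (b \<circ> a \<circ> inv' (b \<circ> a))"
      using germ_comp[OF H_IET H_IET, of "b \<circ> a" "inv' (b \<circ> a)"] H_comp H_inv ab(1,2) by simp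
    also have "\<dots> = id" using inv_comp_id(1)[OF H_bij[OF H_comp[OF ab(2,1)]]] germ_id by simp
    finally have "a \<circ> b \<circ> inv' (b \<circ> a) = id"
      by (rule inj[rotated]) (use ab H_comp H_inv in simp)
    then have "a \<circ> b \<circ> (inv' (b \<circ> a) \<circ> (b \<circ> a)) = b \<circ> a" by (simp add: o_assoc)
    then show ?thesis unfolding GH_simps inv_comp_id(2)[OF H_bij[OF H_comp[OF ab(2,1)]]] by simp
  qed
  have "finite (rcosets\<^bsub>GH\<^esub> K)"
  proof -
    have "fin_index K' ?G" using K'D by (elim conjE)
    then obtain F where F0: "finite F" "F \<subseteq> ?G" "\<forall>g\<in>?G. \<exists>t\<in>F. inv' t \<circ> g \<in> K'"
      unfolding fin_index_def by (elim exE conjE) (rule that)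
    note F = F0(1,2) bspec[OF F0(3)]
    obtain E where E: "E \<subseteq> H" "finite E" "F = germ ` E" using finite_subset_image[OF F(1,2)] by blast
    \<comment> \<open>\<open>fin_index\<close> speaks of left cosets. Applying it to the inverse of
      f gives t with t^-1 f^-1 in K, so that K f = K t^-1.\<close>
    have "rcosets\<^bsub>GH\<^esub> K \<subseteq> (\<lambda>t. K #>\<^bsub>GH\<^esub> inv\<^bsub>GH\<^esub> t) ` E"
    proof
      fix C assume "C \<in> rcosets\<^bsub>GH\<^esub> K"
      then obtain f where f: "f \<in> H" "C = K #>\<^bsub>GH\<^esub> f" by (auto simp: RCOSETS_def)
      have "germ (inv' f) \<in> ?G" using H_inv[OF f(1)] by blast
      then obtain t where t: "t \<in> E" "inv' (germ t) \<circ> germ (inv' f) \<in> K'" using F(3) E(3) by blast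
      have tH: "t \<in> H" using t(1) E(1) by blast
      let ?k = "inv' t \<circ> inv' f"
      have "germ ?k \<in> K'"
        using t(2) germ_comp[OF H_IET H_IET, of "inv' t" "inv' f"] germ_inv[OF H_IET[OF tH]] H_inv tH f(1) by simp
      then have k: "?k \<in> K" using H_comp H_inv tH f(1) by (simp add: K_def)
      have "?k \<otimes>\<^bsub>GH\<^esub> f = inv' t"
        unfolding GH_simps o_assoc[symmetric] inv_comp_id(2)[OF H_bij[OF f(1)]] by simp
      then have "inv\<^bsub>GH\<^esub> t \<in> K #>\<^bsub>GH\<^esub> f"
        using k unfolding r_coset_def GH_inv[OF tH] by force
      from GH.repr_independence[OF this _ KS] f have "C = K #>\<^bsub>GH\<^esub> inv\<^bsub>GH\<^esub> t" by simp
      then show "C \<in> (\<lambda>t. K #>\<^bsub>GH\<^esub> inv\<^bsub>GH\<^esub> t) ` E" using t(1) by blast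
    qed
    then show ?thesis using E(2) by (meson finite_imageI finite_subset)
  qed
  then show ?thesis unfolding virtually_abelian_def using KS comm by blast
qed

theorem mainTheorem1:
  fixes n :: nat and L :: "nat \<Rightarrow> real" and circ :: "nat \<Rightarrow> bool"
    and H :: "(nat \<times> real \<Rightarrow> nat \<times> real) set"
  assumes "domain_ok n L"
    and "subgroup H (IET_group n L circ)"
    and "finitely_generated_group ((IET_group n L circ)\<lparr>carrier := H\<rparr>)"
    and "torsion_free_group ((IET_group n L circ)\<lparr>carrier := H\<rparr>)"
    and "solvable ((IET_group n L circ)\<lparr>carrier := H\<rparr>)"
  shows "virtually_abelian ((IET_group n L circ)\<lparr>carrier := H\<rparr>)"
proof -
  interpret iet_subgroup n L circ H by (intro iet_subgroup.intro iet_domain.intro iet_subgroup_axioms.intro assms(1,2))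
  show ?thesis by (rule virtually_abelian_GH[OF assms(3-5)])
qed

end
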